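(* Let $P\subseteq\mathbb{N}$ be a predicate. (a) $P$ is computable using a sufficiently long fast-growing sequence if and only if $P$ is $\Delta^1_1$ in the hyperjump of $0$. (b) $P$ is computable using a sufficiently long fast-growing sequence or extension thereof if and only if $P$ is $\Delta^1_1$.
   Context: All sequences are sequences of natural numbers. The hyperjump of $0$ is a complete $\Pi^1_1$ set of natural numbers. A valid notion of sufficiently long fast-growing sequences is a set $Q$ of finite sequences for which there is a function $f:\mathbb{N}\to\mathbb{N}$ such that for every infinite sequence $g$ with $g(0)>f(0)$ and $g(n+1)>f(g(n))$ for all $n$, there is $m$ such that every initial segment of $g$ of length at least $m$ is in $Q$. A valid notion of sufficiently long fast-growing sequences or extensions thereof is a set of finite sequences that is the closure, under taking arbitrary finite extensions, of a valid notion of sufficiently long fast-growing sequences. $P$ is computable using a sufficiently long fast-growing sequence (respectively, using a sufficiently long fast-growing sequence or extension thereof) iff there is a Turing machine $T$ such that for every $n$ there is a valid notion $Q$ of the respective kind (which may depend on $n$) such that for every $s\in Q$, $T$ given $n$ and $s$ as input outputs the truth value of $P(n)$. *)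

theory Defs
  imports Main
begin

section \<open>Turing machines\<close>

text \<open>
  Deterministic machines with finitely many two-way infinite tapes, finitely many states and a
  finite alphabet. States and symbols are natural numbers; the symbol 0 is the blank. The
  transition function is partial, and the machine halts where it is undefined.
\<close>

datatype move = MoveLeft | MoveStay | MoveRight

record tm =
  num_states :: nat
  num_symbols :: nat
  num_tapes :: nat
  delta :: "nat \<Rightarrow> nat list \<Rightarrow> (nat \<times> (nat \<times> move) list) option"

text \<open>
  Only the finitely many values of the transition function on the states below \<open>num_states\<close> and on
  tuples of symbols below \<open>num_symbols\<close> can matter in a run of a well-formed machine. The alphabet
  contains at least the blank 0 and the input symbols 1 and 2.
\<close>

definition wf_tm :: "tm \<Rightarrow> bool" where
  "wf_tm M \<longleftrightarrow>
     0 < num_states M \<and> 3 \<le> num_symbols M \<and> 0 < num_tapes M \<and>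
     (\<forall>q syms q' acts.
        q < num_states M \<longrightarrow> length syms = num_tapes M \<longrightarrow> set syms \<subseteq> {..<num_symbols M} \<longrightarrow>
        delta M q syms = Some (q', acts) \<longrightarrow>
          q' < num_states M \<and> length acts = num_tapes M \<and>
          fst ` set acts \<subseteq> {..<num_symbols M})"

text \<open>A tape is a pair of its contents and the position of its head.\<close>

type_synonym tape = "(int \<Rightarrow> nat) \<times> int"
type_synonym config = "nat \<times> tape list"

definition scan :: "tape \<Rightarrow> nat" where
  "scan t = fst t (snd t)"

fun shift :: "move \<Rightarrow> int \<Rightarrow> int" where
  "shift MoveLeft h = h - 1"
| "shift MoveStay h = h"
| "shift MoveRight h = h + 1"

fun act :: "tape \<Rightarrow> nat \<times> move \<Rightarrow> tape" where
  "act (c, h) (a, d) = (c(h := a), shift d h)"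

definition tm_step :: "tm \<Rightarrow> config \<Rightarrow> config \<Rightarrow> bool" where
  "tm_step M c c' \<longleftrightarrow>
     (\<exists>q' acts. delta M (fst c) (map scan (snd c)) = Some (q', acts) \<and>
        c' = (q', map2 act (snd c) acts))"

definition tm_halted :: "tm \<Rightarrow> config \<Rightarrow> bool" where
  "tm_halted M c \<longleftrightarrow> delta M (fst c) (map scan (snd c)) = None"

text \<open>
  The input is a list of natural numbers, each written in unary with the symbol 1 and terminated
  by the symbol 2. It is written on the first tape, starting at cell 0.
\<close>

definition encode_input :: "nat list \<Rightarrow> nat list" where
  "encode_input xs = concat (map (\<lambda>x. replicate x 1 @ [2]) xs)"

definition blank_tape :: tape where
  "blank_tape = (\<lambda>_. 0, 0)"

definition word_tape :: "nat list \<Rightarrow> tape" where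
  "word_tape w = (\<lambda>i. if 0 \<le> i \<and> nat i < length w then w ! nat i else 0, 0)"

definition tm_init :: "tm \<Rightarrow> nat list \<Rightarrow> config" where
  "tm_init M xs = (0, word_tape (encode_input xs) # replicate (num_tapes M - 1) blank_tape)"

text \<open>
  The output is read from the last tape (which is the input tape if there is only one tape): it is
  the length of the block of symbols 1 starting at cell 0, which must be followed by a blank.
\<close>

definition tape_output :: "tape \<Rightarrow> nat \<Rightarrow> bool" where
  "tape_output t k \<longleftrightarrow> (\<forall>i<k. fst t (int i) = 1) \<and> fst t (int k) = 0"

definition tm_computes :: "tm \<Rightarrow> nat list \<Rightarrow> nat \<Rightarrow> bool" where
  "tm_computes M xs k \<longleftrightarrow>
     (\<exists>c. (tm_step M)\<^sup>*\<^sup>* (tm_init M xs) c \<and> tm_halted M c \<and> tape_output (last (snd c)) k)"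

definition tm_computable :: "(nat \<Rightarrow> nat) \<Rightarrow> bool" where
  "tm_computable f \<longleftrightarrow> (\<exists>M. wf_tm M \<and> (\<forall>n. tm_computes M [n] (f n)))"


section \<open>Second-order arithmetic and the analytical hierarchy\<close>

text \<open>
  Arithmetical formulas of the language of second-order arithmetic: there are quantifiers over
  numbers only, but free set variables are allowed.
\<close>

datatype aterm =
    TVar nat | TZero | TOne | TPlus aterm aterm | TTimes aterm aterm

datatype aform =
    FEq aterm aterm | FLess aterm aterm | FMem aterm nat
  | FNot aform | FAnd aform aform | FAll nat aform

fun tval :: "(nat \<Rightarrow> nat) \<Rightarrow> aterm \<Rightarrow> nat" where
  "tval e (TVar x) = e x"
| "tval e TZero = 0"
| "tval e TOne = 1"
| "tval e (TPlus s t) = tval e s + tval e t"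
| "tval e (TTimes s t) = tval e s * tval e t"

fun sat :: "(nat \<Rightarrow> nat set) \<Rightarrow> (nat \<Rightarrow> nat) \<Rightarrow> aform \<Rightarrow> bool" where
  "sat S e (FEq s t) \<longleftrightarrow> tval e s = tval e t"
| "sat S e (FLess s t) \<longleftrightarrow> tval e s < tval e t"
| "sat S e (FMem t X) \<longleftrightarrow> tval e t \<in> S X"
| "sat S e (FNot p) \<longleftrightarrow> \<not> sat S e p"
| "sat S e (FAnd p q) \<longleftrightarrow> sat S e p \<and> sat S e q"
| "sat S e (FAll x p) \<longleftrightarrow> (\<forall>k. sat S (e(x := k)) p)"

text \<open>
  \<open>holds_at p n X A\<close>: the number variable 0 denotes \<open>n\<close>, the set variable 0 denotes \<open>X\<close> and the set
  variable 1 denotes the parameter \<open>A\<close>. All other free number variables denote 0 and all other set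
  variables denote the empty set; these are arithmetically definable values, so nothing is gained
  by using such variables.
\<close>

definition holds_at :: "aform \<Rightarrow> nat \<Rightarrow> nat set \<Rightarrow> nat set \<Rightarrow> bool" where
  "holds_at p n X A \<longleftrightarrow> sat ((\<lambda>_. {})(0 := X, 1 := A)) ((\<lambda>_. 0)(0 := n)) p"

definition Pi11_in :: "nat set \<Rightarrow> nat set \<Rightarrow> bool" where
  "Pi11_in A P \<longleftrightarrow> (\<exists>p. \<forall>n. n \<in> P \<longleftrightarrow> (\<forall>X. holds_at p n X A))"

definition Sigma11_in :: "nat set \<Rightarrow> nat set \<Rightarrow> bool" where
  "Sigma11_in A P \<longleftrightarrow> (\<exists>p. \<forall>n. n \<in> P \<longleftrightarrow> (\<exists>X. holds_at p n X A))"

definition Delta11_in :: "nat set \<Rightarrow> nat set \<Rightarrow> bool" where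
  "Delta11_in A P \<longleftrightarrow> Sigma11_in A P \<and> Pi11_in A P"

text \<open>The lightface classes: the empty parameter carries no information.\<close>

abbreviation Pi11 :: "nat set \<Rightarrow> bool" where
  "Pi11 \<equiv> Pi11_in {}"

abbreviation Delta11 :: "nat set \<Rightarrow> bool" where
  "Delta11 \<equiv> Delta11_in {}"

definition many_one_reducible :: "nat set \<Rightarrow> nat set \<Rightarrow> bool" where
  "many_one_reducible B H \<longleftrightarrow> (\<exists>f. tm_computable f \<and> (\<forall>n. n \<in> B \<longleftrightarrow> f n \<in> H))"

text \<open>
  The hyperjump of 0 is determined only up to computable isomorphism: it is a complete \<open>\<Pi>\<^sup>1\<^sub>1\<close> set.
\<close>

definition is_hyperjump_of_0 :: "nat set \<Rightarrow> bool" where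
  "is_hyperjump_of_0 H \<longleftrightarrow> Pi11 H \<and> (\<forall>B. Pi11 B \<longrightarrow> many_one_reducible B H)"


section \<open>Computability from sufficiently long fast-growing sequences\<close>

definition fast_growing :: "(nat \<Rightarrow> nat) \<Rightarrow> (nat \<Rightarrow> nat) \<Rightarrow> bool" where
  "fast_growing f g \<longleftrightarrow> g 0 > f 0 \<and> (\<forall>n. g (Suc n) > f (g n))"

definition initial_segment :: "(nat \<Rightarrow> nat) \<Rightarrow> nat \<Rightarrow> nat list" where
  "initial_segment g k = map g [0..<k]"

definition valid_notion :: "nat list set \<Rightarrow> bool" where
  "valid_notion Q \<longleftrightarrow>
     (\<exists>f. \<forall>g. fast_growing f g \<longrightarrow> (\<exists>m. \<forall>k\<ge>m. initial_segment g k \<in> Q))"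

definition extension_closure :: "nat list set \<Rightarrow> nat list set" where
  "extension_closure Q = {s @ t |s t. s \<in> Q}"

definition valid_notion_ext :: "nat list set \<Rightarrow> bool" where
  "valid_notion_ext Q \<longleftrightarrow> (\<exists>Q0. valid_notion Q0 \<and> Q = extension_closure Q0)"

text \<open>The truth values are output as the numbers 1 and 0.\<close>

definition computable_using :: "(nat list set \<Rightarrow> bool) \<Rightarrow> nat set \<Rightarrow> bool" where
  "computable_using V P \<longleftrightarrow>
     (\<exists>M. wf_tm M \<and>
        (\<forall>n. \<exists>Q. V Q \<and> (\<forall>s\<in>Q. tm_computes M (n # s) (of_bool (n \<in> P)))))"

definition computable_fast_growing :: "nat set \<Rightarrow> bool" where
  "computable_fast_growing P \<longleftrightarrow> computable_using valid_notion P"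

definition computable_fast_growing_ext :: "nat set \<Rightarrow> bool" where
  "computable_fast_growing_ext P \<longleftrightarrow> computable_using valid_notion_ext P"

end

theory Submission
  imports Defs "HOL-Library.Nat_Bijection"
begin

text \<open>
  Suppose first that a machine computes the truth value of \<open>P n\<close> from fast-growing sequences. Any two
  bounding functions have a common bound, so if extensions are allowed, \<open>n \<in> P\<close> holds iff for every
  function \<open>f\<close> some finite \<open>f\<close>-fast sequence forces the output 1 on all its extensions; the same
  holds for \<open>n \<notin> P\<close> and the output 0, and both conditions are \<open>\<Pi>\<^sup>1\<^sub>1\<close>. Without extensions, a finite
  sequence \<open>s\<close> is called settled with value \<open>w\<close> if for some \<open>f\<close> all proper extensions of \<open>s\<close> by
  \<open>f\<close>-fast sequences give the output \<open>w\<close>. This is a \<open>\<Sigma>\<^sup>1\<^sub>1\<close> condition, hence decidable from the hyperjump,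
  and \<open>n \<in> P\<close> holds iff for every \<open>f\<close> some \<open>f\<close>-fast sequence is settled with value 1.

  Conversely, let membership and non-membership be given by formulas \<open>\<exists>X. p\<close> and \<open>\<exists>X. \<not> q\<close>. If such a
  formula is true, then all existential number quantifiers in it can be bounded by a sufficiently fast
  sequence \<open>g\<close>; if it is false, then by compactness its bounded form for \<open>g\<close> is refuted at a finite
  stage, for every \<open>g\<close>. So one looks for the first stage at which one of the two formulas is refuted, and
  this depends on an initial segment of \<open>g\<close> only. With the hyperjump as a parameter, the
  same method approximates the parameter in the limit, and the answer is eventually correct.
\<close>

section \<open>Arithmetical and analytical predicates\<close>

text \<open>What separates (a) from (b) is stability. In (b) the answer is frozen by the first
  refutation, which looks only at an initial segment, so arbitrary further entries cannot change it.
  In (a) the oracle is replaced by a guess made from the full length of the input; it is guaranteed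
  on a given finite part only for long fast-growing inputs, and an extension by slow entries may
  spoil it. An existential number quantifier is bounded by the entry of the sequence at an index
  above all current values: finitely many assignments lie below the index, so a function of the
  index dominates their least witnesses. The set quantifier is bounded likewise, since a stage
  inspects only a finite part of the set, and the next entry of the sequence dominates the codes of
  the finite sets that matter. The argument \<open>u\<close> counts among the current values, so
  that one \<open>f\<close> serves all \<open>u\<close> at once, as guessing a whole set requires.
  In the other direction, machine runs become Delta11 without coding a run as a number: the set of
  all its stages is unique, so it may be quantified existentially or universally.\<close>

definition scons :: "'a \<Rightarrow> (nat \<Rightarrow> 'a) \<Rightarrow> nat \<Rightarrow> 'a" where
  "scons x s = (\<lambda>i. case i of 0 \<Rightarrow> x | Suc j \<Rightarrow> s j)"

lemma scons_simps [simp]: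
  "scons x s 0 = x" "scons x s (Suc i) = s i" "scons x s (numeral k) = s (pred_numeral k)"
  "(\<lambda>i. scons x s (Suc i)) = s"
  by (simp_all add: scons_def numeral_eq_Suc)

lemma scons_eta [simp]: "scons (s 0) (\<lambda>i. s (Suc i)) = s"
  by (auto simp: scons_def split: nat.split)

section \<open>Terms and a polynomial pairing\<close>

definition is_term :: "((nat \<Rightarrow> nat) \<Rightarrow> nat) \<Rightarrow> bool" where
  "is_term t \<longleftrightarrow> (\<exists>a. \<forall>e. tval e a = t e)"

lemma is_term_var [intro]: "is_term (\<lambda>e. e x)"
  unfolding is_term_def by (rule exI[of _ "TVar x"]) simp

lemma is_term_plus [intro]: "is_term s \<Longrightarrow> is_term t \<Longrightarrow> is_term (\<lambda>e. s e + t e)"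
  unfolding is_term_def by (metis tval.simps(4))

lemma is_term_times [intro]: "is_term s \<Longrightarrow> is_term t \<Longrightarrow> is_term (\<lambda>e. s e * t e)"
  unfolding is_term_def by (metis tval.simps(5))

lemma is_term_const [intro]: "is_term (\<lambda>e. c)"
proof (induction c)
  case 0
  show ?case unfolding is_term_def by (rule exI[of _ TZero]) simp
next
  case (Suc c)
  then obtain a where "\<forall>e. tval e a = c"
    unfolding is_term_def by blast
  then show ?case
    unfolding is_term_def by (intro exI[of _ "TPlus a TOne"]) simp
qed

lemma is_term_Suc [intro]: "is_term t \<Longrightarrow> is_term (\<lambda>e. Suc (t e))"
  using is_term_plus[OF _ is_term_const, of t 1] by simp

lemma is_term_subst:
  assumes "is_term t" and T: "\<And>x. is_term (T x)"
  shows "is_term (\<lambda>e. t (\<lambda>x. T x e))"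
proof -
  have "\<exists>b. \<forall>e. tval e b = tval (\<lambda>x. T x e) a" for a
  proof (induction a)
    case (TVar x)
    show ?case using T[of x] by (simp add: is_term_def)
  next
    case TZero
    show ?case by (rule exI[of _ TZero]) simp
  next
    case TOne
    show ?case by (rule exI[of _ TOne]) simp
  next
    case (TPlus a1 a2)
    then obtain b1 b2 where "\<And>e. tval e b1 = tval (\<lambda>x. T x e) a1" "\<And>e. tval e b2 = tval (\<lambda>x. T x e) a2"
      by blast
    then show ?case by (intro exI[of _ "TPlus b1 b2"]) simp
  next
    case (TTimes a1 a2)
    then obtain b1 b2 where "\<And>e. tval e b1 = tval (\<lambda>x. T x e) a1" "\<And>e. tval e b2 = tval (\<lambda>x. T x e) a2"
      by blast
    then show ?case by (intro exI[of _ "TTimes b1 b2"]) simp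
  qed
  then show ?thesis
    using assms(1) unfolding is_term_def by metis
qed

text \<open>Unlike \<open>prod_encode\<close>, which involves a division by 2, this is a term of the
  language. It is not onto, but injectivity is enough for coding.\<close>

definition pair :: "nat \<Rightarrow> nat \<Rightarrow> nat" where
  "pair a b = (a + b) * (a + b) + a"

text \<open>The pairs with sum \<open>s\<close> have values from \<open>s * s\<close> to
  \<open>s * s + s\<close>, below the next square. So the value determines the sum, and then
  \<open>a\<close>.\<close>

lemma pair_inject [simp]: "pair a b = pair c d \<longleftrightarrow> a = c \<and> b = d"
proof
  assume eq: "pair a b = pair c d"
  have lt: "pair x y < pair x' y'" if "x + y < x' + y'" for x y x' y'
  proof -
    have "pair x y < (x + y + 1) * (x + y + 1)"
      by (simp add: pair_def algebra_simps)
    also have "\<dots> \<le> (x' + y') * (x' + y')"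
      using that by (intro mult_le_mono) auto
    finally show ?thesis by (simp add: pair_def)
  qed
  then have "a + b = c + d"
    using eq by (metis linorder_neqE_nat nat_less_le)
  with eq show "a = c \<and> b = d"
    by (simp add: pair_def)
qed simp

lemma is_term_pair [intro]: "is_term s \<Longrightarrow> is_term t \<Longrightarrow> is_term (\<lambda>e. pair (s e) (t e))"
  unfolding pair_def by (intro is_term_plus is_term_times)

section \<open>Arithmetical predicates and their closure under substitution\<close>

type_synonym rpred = "(nat \<Rightarrow> nat set) \<Rightarrow> (nat \<Rightarrow> nat) \<Rightarrow> bool"

text \<open>Variables are in de Bruijn style: a quantifier binds variable 0 and shifts the others.\<close>

inductive arith :: "rpred \<Rightarrow> bool" where
  arith_eq: "is_term s \<Longrightarrow> is_term t \<Longrightarrow> arith (\<lambda>S e. s e = t e)"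
| arith_less: "is_term s \<Longrightarrow> is_term t \<Longrightarrow> arith (\<lambda>S e. s e < t e)"
| arith_mem: "is_term t \<Longrightarrow> arith (\<lambda>S e. t e \<in> S v)"
| arith_not: "arith \<phi> \<Longrightarrow> arith (\<lambda>S e. \<not> \<phi> S e)"
| arith_and: "arith \<phi> \<Longrightarrow> arith \<psi> \<Longrightarrow> arith (\<lambda>S e. \<phi> S e \<and> \<psi> S e)"
| arith_all: "arith (\<lambda>S e. \<phi> S (\<lambda>i. e (Suc i)) (e 0)) \<Longrightarrow> arith (\<lambda>S e. \<forall>k. \<phi> S e k)"

fun rename_term :: "(nat \<Rightarrow> nat) \<Rightarrow> aterm \<Rightarrow> aterm" where
  "rename_term \<rho> (TVar x) = TVar (\<rho> x)"
| "rename_term \<rho> TZero = TZero"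
| "rename_term \<rho> TOne = TOne"
| "rename_term \<rho> (TPlus s t) = TPlus (rename_term \<rho> s) (rename_term \<rho> t)"
| "rename_term \<rho> (TTimes s t) = TTimes (rename_term \<rho> s) (rename_term \<rho> t)"

fun rename_form :: "(nat \<Rightarrow> nat) \<Rightarrow> aform \<Rightarrow> aform" where
  "rename_form \<rho> (FEq s t) = FEq (rename_term \<rho> s) (rename_term \<rho> t)"
| "rename_form \<rho> (FLess s t) = FLess (rename_term \<rho> s) (rename_term \<rho> t)"
| "rename_form \<rho> (FMem t X) = FMem (rename_term \<rho> t) X"
| "rename_form \<rho> (FNot p) = FNot (rename_form \<rho> p)"
| "rename_form \<rho> (FAnd p q) = FAnd (rename_form \<rho> p) (rename_form \<rho> q)"
| "rename_form \<rho> (FAll x p) = FAll (\<rho> x) (rename_form \<rho> p)"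

lemma tval_rename_term: "tval e (rename_term \<rho> t) = tval (\<lambda>i. e (\<rho> i)) t"
  by (induction t) auto

text \<open>Injectivity prevents a renamed bound variable from capturing another variable.\<close>

lemma sat_rename_form:
  assumes "inj \<rho>"
  shows "sat S e (rename_form \<rho> p) = sat S (\<lambda>i. e (\<rho> i)) p"
proof (induction p arbitrary: e)
  case (FAll x p)
  have "(\<lambda>i. (e(\<rho> x := k)) (\<rho> i)) = (\<lambda>i. e (\<rho> i))(x := k)" for k
    using assms by (auto simp: inj_eq)
  then show ?case using FAll by simp
qed (simp_all add: tval_rename_term)

fun term_var_bound :: "aterm \<Rightarrow> nat" where
  "term_var_bound (TVar x) = Suc x"
| "term_var_bound TZero = 0"
| "term_var_bound TOne = 0"
| "term_var_bound (TPlus s t) = max (term_var_bound s) (term_var_bound t)"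
| "term_var_bound (TTimes s t) = max (term_var_bound s) (term_var_bound t)"

fun var_bound :: "aform \<Rightarrow> nat" where
  "var_bound (FEq s t) = max (term_var_bound s) (term_var_bound t)"
| "var_bound (FLess s t) = max (term_var_bound s) (term_var_bound t)"
| "var_bound (FMem t X) = term_var_bound t"
| "var_bound (FNot p) = var_bound p"
| "var_bound (FAnd p q) = max (var_bound p) (var_bound q)"
| "var_bound (FAll x p) = max (Suc x) (var_bound p)"

lemma tval_cong: "(\<And>i. i < term_var_bound t \<Longrightarrow> e i = e' i) \<Longrightarrow> tval e t = tval e' t"
  by (induction t) auto

lemma sat_cong: "(\<And>i. i < var_bound p \<Longrightarrow> e i = e' i) \<Longrightarrow> sat S e p = sat S e' p"
proof (induction p arbitrary: e e')
  case (FEq s t)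
  have "tval e s = tval e' s" "tval e t = tval e' t"
    by (rule tval_cong, rule FEq, simp)+
  then show ?case by simp
next
  case (FLess s t)
  have "tval e s = tval e' s" "tval e t = tval e' t"
    by (rule tval_cong, rule FLess, simp)+
  then show ?case by simp
next
  case (FMem t X)
  have "tval e t = tval e' t"
    by (rule tval_cong, rule FMem, simp)
  then show ?case by simp
next
  case (FNot p)
  have "sat S e p = sat S e' p"
    by (rule FNot.IH, rule FNot.prems, simp)
  then show ?case by simp
next
  case (FAnd p q)
  have "sat S e p = sat S e' p"
    by (rule FAnd.IH, rule FAnd.prems, simp)
  moreover have "sat S e q = sat S e' q"
    by (rule FAnd.IH, rule FAnd.prems, simp)
  ultimately show ?case by simp
next
  case (FAll x p)
  have "sat S (e(x := k)) p = sat S (e'(x := k)) p" for k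
  proof (rule FAll.IH)
    fix i assume "i < var_bound p"
    then have "e i = e' i" by (intro FAll.prems) simp
    then show "(e(x := k)) i = (e'(x := k)) i" by simp
  qed
  then show ?case by simp
qed

text \<open>The bridge from de Bruijn predicates to formulas with named variables. Only the
  quantifier has content: its variable needs a fresh name, and the remaining ones must be shifted
  back.\<close>

lemma arith_formula:
  assumes "arith \<phi>"
  shows "\<exists>p. \<forall>S e. sat S e p \<longleftrightarrow> \<phi> S e"
  using assms
proof induction
  case (arith_eq s t)
  then obtain a b where "\<And>e. tval e a = s e" "\<And>e. tval e b = t e"
    unfolding is_term_def by blast
  then show ?case by (intro exI[of _ "FEq a b"]) simp
next
  case (arith_less s t)
  then obtain a b where "\<And>e. tval e a = s e" "\<And>e. tval e b = t e"
    unfolding is_term_def by blast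
  then show ?case by (intro exI[of _ "FLess a b"]) simp
next
  case (arith_mem t v)
  then obtain a where "\<And>e. tval e a = t e"
    unfolding is_term_def by blast
  then show ?case by (intro exI[of _ "FMem a v"]) simp
next
  case (arith_not \<phi>)
  then obtain p where "\<And>S e. sat S e p \<longleftrightarrow> \<phi> S e" by blast
  then show ?case by (intro exI[of _ "FNot p"]) simp
next
  case (arith_and \<phi> \<psi>)
  then obtain p q where "\<And>S e. sat S e p \<longleftrightarrow> \<phi> S e" "\<And>S e. sat S e q \<longleftrightarrow> \<psi> S e" by blast
  then show ?case by (intro exI[of _ "FAnd p q"]) simp
next
  case (arith_all \<phi>)
  then obtain p where p: "sat S e p \<longleftrightarrow> \<phi> S (\<lambda>i. e (Suc i)) (e 0)" for S e
    by blast
  define N where "N = var_bound p"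
  \<comment> \<open>A cyclic permutation of \<open>0..N\<close>, continued by the identity so that
    it is injective: the bound variable 0 gets the fresh name \<open>N\<close>, and the shift of the
    others is undone.\<close>
  define \<rho> where "\<rho> i = (if i = 0 then N else if i \<le> N then i - 1 else i)" for i
  have "inj \<rho>"
    by (rule injI) (auto simp: \<rho>_def split: if_splits)
  have "sat S e (FAll N (rename_form \<rho> p)) \<longleftrightarrow> (\<forall>k. \<phi> S e k)" for S e
  proof -
    have "sat S (e(N := k)) (rename_form \<rho> p) = sat S (scons k e) p" for k
      unfolding sat_rename_form[OF \<open>inj \<rho>\<close>]
      by (rule sat_cong) (auto simp: \<rho>_def N_def scons_def split: nat.split)
    then show ?thesis by (simp add: p)
  qed
  then show ?case by blast
qed

text \<open>Quantifying over all \<open>T\<close> is what makes the induction work: below a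
  quantifier the hypothesis is used for \<open>T\<close> lifted past the bound variable.\<close>

definition renamable :: "rpred \<Rightarrow> bool" where
  "renamable \<phi> \<longleftrightarrow> (\<forall>T. (\<forall>x. is_term (T x)) \<longrightarrow> arith (\<lambda>S e. \<phi> S (\<lambda>x. T x e)))"

lemma arith_renamable:
  assumes "arith \<phi>"
  shows "renamable \<phi>"
  using assms
proof induction
  case (arith_eq s t)
  then show ?case
    unfolding renamable_def
    by (intro allI impI arith.arith_eq[OF is_term_subst[of s] is_term_subst[of t]]) auto
next
  case (arith_less s t)
  then show ?case
    unfolding renamable_def
    by (intro allI impI arith.arith_less[OF is_term_subst[of s] is_term_subst[of t]]) auto
next
  case (arith_mem t v)
  then show ?case
    unfolding renamable_def by (intro allI impI arith.arith_mem[OF is_term_subst[of t]]) auto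
next
  case (arith_not \<phi>)
  then show ?case
    unfolding renamable_def by (intro allI impI arith.arith_not) auto
next
  case (arith_and \<phi> \<psi>)
  then show ?case
    unfolding renamable_def by (intro allI impI arith.arith_and) auto
next
  case (arith_all \<phi>)
  have "arith (\<lambda>S e. \<forall>k. \<phi> S (\<lambda>x. T x e) k)" if T: "\<forall>x. is_term (T x)" for T
  proof (rule arith.arith_all)
    \<comment> \<open>\<open>T\<close> lifted under the binder: variable 0 is fixed, and the terms
      for the others are shifted.\<close>
    define U where "U x = (\<lambda>e. scons (e 0) (\<lambda>i. T i (\<lambda>i. e (Suc i))) x)" for x
    have "is_term (U x)" for x
    proof (cases x)
      case 0
      then show ?thesis by (simp add: U_def is_term_var)
    next
      case (Suc y)
      have "is_term (\<lambda>e. T y (\<lambda>i. e (Suc i)))"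
        by (rule is_term_subst[of "T y" "\<lambda>x e. e (Suc x)"]) (simp_all add: T is_term_var)
      then show ?thesis
        by (simp add: U_def Suc)
    qed
    then have "arith (\<lambda>S e. \<phi> S (\<lambda>i. U (Suc i) e) (U 0 e))"
      using arith_all.IH unfolding renamable_def by simp
    then show "arith (\<lambda>S e. \<phi> S (\<lambda>x. T x (\<lambda>i. e (Suc i))) (e 0))"
      unfolding U_def scons_simps .
  qed
  then show ?case
    unfolding renamable_def by blast
qed

lemma arith_ren:
  assumes "arith \<phi>" and "\<And>x. is_term (T x)"
  shows "arith (\<lambda>S e. \<phi> S (\<lambda>x. T x e))"
proof -
  have "(\<forall>x. is_term (T x)) \<longrightarrow> arith (\<lambda>S e. \<phi> S (\<lambda>x. T x e))"
    using arith_renamable[OF assms(1), unfolded renamable_def, THEN spec, of T] .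
  then show ?thesis using assms(2) by simp
qed

lemma arith_or:
  assumes "arith \<phi>" "arith \<psi>"
  shows "arith (\<lambda>S e. \<phi> S e \<or> \<psi> S e)"
proof -
  have "arith (\<lambda>S e. \<not> (\<not> \<phi> S e \<and> \<not> \<psi> S e))"
    by (intro arith_not arith_and assms)
  then show ?thesis by simp
qed

lemma arith_imp:
  assumes "arith \<phi>" "arith \<psi>"
  shows "arith (\<lambda>S e. \<phi> S e \<longrightarrow> \<psi> S e)"
proof -
  have "arith (\<lambda>S e. \<not> \<phi> S e \<or> \<psi> S e)"
    by (intro arith_not arith_or assms)
  then show ?thesis by (simp only: imp_conv_disj)
qed

lemma arith_iff:
  assumes "arith \<phi>" "arith \<psi>"
  shows "arith (\<lambda>S e. \<phi> S e \<longleftrightarrow> \<psi> S e)"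
proof -
  have "arith (\<lambda>S e. (\<phi> S e \<longrightarrow> \<psi> S e) \<and> (\<psi> S e \<longrightarrow> \<phi> S e))"
    by (intro arith_and arith_imp assms)
  then show ?thesis by (simp only: iff_conv_conj_imp)
qed

lemma arith_ex:
  assumes "arith (\<lambda>S e. \<phi> S (\<lambda>i. e (Suc i)) (e 0))"
  shows "arith (\<lambda>S e. \<exists>k. \<phi> S e k)"
proof -
  have "arith (\<lambda>S e. \<not> (\<forall>k. \<not> \<phi> S e k))"
    by (intro arith_not arith_all assms)
  then show ?thesis by simp
qed

lemma arith_const: "arith (\<lambda>S e. b)"
proof -
  have "arith (\<lambda>S e. (0::nat) = 0)" by (intro arith_eq is_term_const)
  then have "arith (\<lambda>S e. True)" "arith (\<lambda>S e. False)"
    using arith_not[of "\<lambda>S e. True"] by simp_all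
  then show ?thesis by (cases b) simp_all
qed

lemma arith_finite_ex:
  assumes "finite F" and "\<And>x. x \<in> F \<Longrightarrow> arith (\<phi> x)"
  shows "arith (\<lambda>S e. \<exists>x\<in>F. \<phi> x S e)"
  using assms
proof induction
  case empty
  show ?case by (simp add: arith_const)
next
  case (insert x F)
  have "arith (\<lambda>S e. \<phi> x S e \<or> (\<exists>x\<in>F. \<phi> x S e))"
    by (rule arith_or) (use insert in auto)
  then show ?case by simp
qed

lemma arith_finite_all:
  assumes "finite F" and "\<And>x. x \<in> F \<Longrightarrow> arith (\<phi> x)"
  shows "arith (\<lambda>S e. \<forall>x\<in>F. \<phi> x S e)"
proof -
  have "arith (\<lambda>S e. \<not> (\<exists>x\<in>F. \<not> \<phi> x S e))"
    by (intro arith_not arith_finite_ex assms)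
  then show ?thesis by simp
qed

text \<open>Set variables are replaced by arithmetically definable sets \<open>D v\<close>, which
  may depend on the environment. In the formula defining \<open>D v\<close> the candidate member is
  variable 0.\<close>

definition substitutable :: "rpred \<Rightarrow> bool" where
  "substitutable \<phi> \<longleftrightarrow>
    (\<forall>D T. (\<forall>v. arith (\<lambda>S e. e 0 \<in> D v S (\<lambda>i. e (Suc i)))) \<longrightarrow> (\<forall>x. is_term (T x)) \<longrightarrow>
       arith (\<lambda>S e. \<phi> (\<lambda>v. D v S e) (\<lambda>x. T x e)))"

lemma arith_substitutable:
  assumes "arith \<phi>"
  shows "substitutable \<phi>"
  using assms
proof induction
  case (arith_eq s t)
  then show ?case
    unfolding substitutable_def
    by (intro allI impI arith.arith_eq[OF is_term_subst[of s] is_term_subst[of t]]) auto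
next
  case (arith_less s t)
  then show ?case
    unfolding substitutable_def
    by (intro allI impI arith.arith_less[OF is_term_subst[of s] is_term_subst[of t]]) auto
next
  case (arith_mem t v)
  have "arith (\<lambda>S e. t (\<lambda>x. T x e) \<in> D v S e)"
    if D: "\<forall>v. arith (\<lambda>S e. e 0 \<in> D v S (\<lambda>i. e (Suc i)))" and T: "\<forall>x. is_term (T x)" for D T
  proof -
    have 1: "is_term (\<lambda>e. T x (\<lambda>i. e (Suc i)))" for x
      by (rule is_term_subst[of "T x" "\<lambda>x e. e (Suc x)"]) (simp_all add: T is_term_var)
    have "is_term (\<lambda>e. t (\<lambda>x. T x (\<lambda>i. e (Suc i))))"
      by (rule is_term_subst[of t "\<lambda>x e. T x (\<lambda>i. e (Suc i))"]) (rule arith_mem.hyps, rule 1)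
    then have "arith (\<lambda>S e. e 0 = t (\<lambda>x. T x (\<lambda>i. e (Suc i))) \<and> e 0 \<in> D v S (\<lambda>i. e (Suc i)))"
      by (rule arith.arith_and[OF arith.arith_eq[OF is_term_var] D[rule_format]])
    \<comment> \<open>Membership in \<open>D v\<close> is given for a variable only, so the term is
      first named by a quantified \<open>k\<close>.\<close>
    then have "arith (\<lambda>S e. \<exists>k. k = t (\<lambda>x. T x e) \<and> k \<in> D v S e)"
      by (rule arith_ex)
    then show ?thesis by simp
  qed
  then show ?case
    unfolding substitutable_def by blast
next
  case (arith_not \<phi>)
  then show ?case
    unfolding substitutable_def by (intro allI impI arith.arith_not) auto
next
  case (arith_and \<phi> \<psi>)
  then show ?case
    unfolding substitutable_def by (intro allI impI arith.arith_and) auto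
next
  case (arith_all \<phi>)
  have "arith (\<lambda>S e. \<forall>k. \<phi> (\<lambda>v. D v S e) (\<lambda>x. T x e) k)"
    if D: "\<forall>v. arith (\<lambda>S e. e 0 \<in> D v S (\<lambda>i. e (Suc i)))" and T: "\<forall>x. is_term (T x)" for D T
  proof (rule arith.arith_all)
    define U where "U x = (\<lambda>e. scons (e 0) (\<lambda>i. T i (\<lambda>i. e (Suc i))) x)" for x
    define D' where "D' v S e = D v S (\<lambda>i. e (Suc i))" for v S and e :: "nat \<Rightarrow> nat"
    have U: "is_term (U x)" for x
    proof (cases x)
      case 0
      then show ?thesis by (simp add: U_def is_term_var)
    next
      case (Suc y)
      have "is_term (\<lambda>e. T y (\<lambda>i. e (Suc i)))"
        by (rule is_term_subst[of "T y" "\<lambda>x e. e (Suc x)"]) (simp_all add: T is_term_var)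
      then show ?thesis
        by (simp add: U_def Suc)
    qed
    have D': "arith (\<lambda>S e. e 0 \<in> D' v S (\<lambda>i. e (Suc i)))" for v
    proof -
      \<comment> \<open>The candidate member stays at variable 0, and variable 1, the newly bound
        one, is skipped.\<close>
      define R where "R = scons (\<lambda>e. e 0) (\<lambda>i e. e (Suc (Suc i)) :: nat)"
      have "is_term (R x)" for x
        by (cases x) (simp_all add: R_def is_term_var)
      from arith_ren[OF D[rule_format, of v], of R, OF this] show ?thesis
        by (simp add: D'_def R_def)
    qed
    have "arith (\<lambda>S e. \<phi> (\<lambda>v. D' v S e) (\<lambda>i. U (Suc i) e) (U 0 e))"
      using arith_all.IH U D' unfolding substitutable_def by simp
    then show "arith (\<lambda>S e. \<phi> (\<lambda>v. D v S (\<lambda>i. e (Suc i))) (\<lambda>x. T x (\<lambda>i. e (Suc i))) (e 0))"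
      unfolding U_def D'_def scons_simps .
  qed
  then show ?case
    unfolding substitutable_def by blast
qed

lemma arith_subst:
  assumes "arith \<phi>" and "\<And>v. arith (\<lambda>S e. e 0 \<in> D v S (\<lambda>i. e (Suc i)))" and "\<And>x. is_term (T x)"
  shows "arith (\<lambda>S e. \<phi> (\<lambda>v. D v S e) (\<lambda>x. T x e))"
proof -
  have "(\<forall>v. arith (\<lambda>S e. e 0 \<in> D v S (\<lambda>i. e (Suc i)))) \<longrightarrow> (\<forall>x. is_term (T x)) \<longrightarrow>
      arith (\<lambda>S e. \<phi> (\<lambda>v. D v S e) (\<lambda>x. T x e))"
    using arith_substitutable[OF assms(1), unfolded substitutable_def, THEN spec, THEN spec, of D T] .
  then show ?thesis using assms(2,3) by simp
qed

section \<open>Sigma11 and Delta11 relations\<close>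

definition S11 :: "rpred \<Rightarrow> bool" where
  "S11 \<phi> \<longleftrightarrow> (\<exists>\<psi>. arith \<psi> \<and> (\<forall>S e. \<phi> S e \<longleftrightarrow> (\<exists>X. \<psi> (scons X S) e)))"

definition D11 :: "rpred \<Rightarrow> bool" where
  "D11 \<phi> \<longleftrightarrow> S11 \<phi> \<and> S11 (\<lambda>S e. \<not> \<phi> S e)"

lemma S11_E:
  assumes "S11 \<phi>"
  obtains \<psi> where "arith \<psi>" "\<And>S e. \<phi> S e \<longleftrightarrow> (\<exists>X. \<psi> (scons X S) e)"
  using assms unfolding S11_def by (elim exE conjE) simp

lemma S11_subst:
  assumes "S11 \<phi>" and D: "\<And>v. arith (\<lambda>S e. e 0 \<in> D v S (\<lambda>i. e (Suc i)))" and "\<And>x. is_term (T x)"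
  shows "S11 (\<lambda>S e. \<phi> (\<lambda>v. D v S e) (\<lambda>x. T x e))"
proof -
  obtain \<psi> where \<psi>: "arith \<psi>" "\<phi> S e \<longleftrightarrow> (\<exists>X. \<psi> (scons X S) e)" for S e
    by (rule S11_E[OF assms(1)]) (rule that)
  \<comment> \<open>The quantified set stays at set variable 0; the given substitution acts on the
    set variables above it.\<close>
  define D' where "D' v S e = scons (S 0) (\<lambda>v. D v (\<lambda>v. S (Suc v)) e) v" for v S e
  have "arith (\<lambda>S e. e 0 \<in> D' v S (\<lambda>i. e (Suc i)))" for v
  proof (cases v)
    case 0
    then show ?thesis by (simp add: D'_def arith_mem is_term_var)
  next
    case (Suc w)
    have "arith (\<lambda>S e. e 0 \<in> D w (\<lambda>v. S (Suc v)) (\<lambda>i. e (Suc i)))"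
      by (rule arith_subst[OF D[of w], of "\<lambda>v S e. S (Suc v)" "\<lambda>x e. e x", OF arith_mem[OF is_term_var] is_term_var])
    then show ?thesis using Suc by (simp add: D'_def)
  qed
  from arith_subst[of \<psi> D' T, OF \<psi>(1) this assms(3)]
  have "arith (\<lambda>S e. \<psi> (\<lambda>v. D' v S e) (\<lambda>x. T x e))" .
  moreover have "(\<lambda>v. D' v (scons X S) e) = scons X (\<lambda>v. D v S e)" for X S e
    by (auto simp: D'_def scons_def split: nat.split)
  ultimately show ?thesis
    unfolding S11_def by (intro exI[of _ "\<lambda>S e. \<psi> (\<lambda>v. D' v S e) (\<lambda>x. T x e)"]) (simp add: \<psi>(2))
qed

lemma S11_arith: "arith \<phi> \<Longrightarrow> S11 \<phi>"
proof -
  assume "arith \<phi>"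
  then have "arith (\<lambda>S e. \<phi> (\<lambda>v. S (Suc v)) e)"
    using arith_subst[of \<phi> "\<lambda>v S e. S (Suc v)" "\<lambda>x e. e x", OF _ arith_mem[OF is_term_var] is_term_var] by blast
  then show ?thesis
    unfolding S11_def by (intro exI[of _ "\<lambda>S e. \<phi> (\<lambda>v. S (Suc v)) e"]) simp
qed

text \<open>Two set quantifiers are contracted to one by coding the sets as even and odd members.\<close>

lemma S11_ex2:
  assumes "arith \<psi>"
  shows "S11 (\<lambda>S e. \<exists>X Y. \<psi> (scons X (scons Y S)) e)"
proof -
  define D :: "nat \<Rightarrow> (nat \<Rightarrow> nat set) \<Rightarrow> (nat \<Rightarrow> nat) \<Rightarrow> nat set" where
    "D v S e = scons {k. 2 * k \<in> S 0} (scons {k. 2 * k + 1 \<in> S 0} (\<lambda>v. S (Suc v))) v" for v S e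
  have "arith (\<lambda>S e. e 0 \<in> D v S (\<lambda>i. e (Suc i)))" for v
  proof -
    consider "v = 0" | "v = 1" | w where "v = Suc (Suc w)"
      by (metis One_nat_def not0_implies_Suc)
    then show ?thesis
    proof cases
      case 1
      then show ?thesis by (simp add: D_def) (intro arith_mem is_term_times is_term_const is_term_var)
    next
      case 2
      then show ?thesis by (simp add: D_def) (intro arith_mem is_term_Suc is_term_times is_term_const is_term_var)
    next
      case 3
      then show ?thesis by (simp add: D_def) (intro arith_mem is_term_var)
    qed
  qed
  from arith_subst[of \<psi> D "\<lambda>x e. e x", OF assms this is_term_var]
  have "arith (\<lambda>S e. \<psi> (\<lambda>v. D v S e) e)" .
  moreover have "(\<exists>X Y. \<psi> (scons X (scons Y S)) e) \<longleftrightarrow> (\<exists>Z. \<psi> (\<lambda>v. D v (scons Z S) e) e)" for S e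
  proof
    assume "\<exists>X Y. \<psi> (scons X (scons Y S)) e"
    then obtain X Y where XY: "\<psi> (scons X (scons Y S)) e" by blast
    define Z where "Z = (\<lambda>k. 2 * k) ` X \<union> (\<lambda>k. 2 * k + 1) ` Y"
    have "{k. 2 * k \<in> Z} = X" "{k. 2 * k + 1 \<in> Z} = Y"
      unfolding Z_def by (auto, (presburger)+)
    then have "(\<lambda>v. D v (scons Z S) e) = scons X (scons Y S)"
      by (auto simp: D_def)
    then show "\<exists>Z. \<psi> (\<lambda>v. D v (scons Z S) e) e"
      by (intro exI[of _ Z]) (simp add: XY)
  next
    assume "\<exists>Z. \<psi> (\<lambda>v. D v (scons Z S) e) e"
    then show "\<exists>X Y. \<psi> (scons X (scons Y S)) e"
      by (auto simp: D_def)
  qed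
  ultimately show ?thesis
    unfolding S11_def by (intro exI[of _ "\<lambda>S e. \<psi> (\<lambda>v. D v S e) e"]) simp
qed

lemma S11_exS:
  assumes "S11 (\<lambda>S e. \<phi> (\<lambda>v. S (Suc v)) e (S 0))"
  shows "S11 (\<lambda>S e. \<exists>X. \<phi> S e X)"
proof -
  obtain \<psi> where \<psi>: "arith \<psi>" "\<phi> (\<lambda>v. S (Suc v)) e (S 0) \<longleftrightarrow> (\<exists>X. \<psi> (scons X S) e)" for S e
    by (rule S11_E[OF assms]) (rule that)
  have "\<phi> S e X \<longleftrightarrow> (\<exists>Y. \<psi> (scons Y (scons X S)) e)" for S e X
    using \<psi>(2)[of "scons X S"] by simp
  then have *: "(\<exists>X. \<phi> S e X) \<longleftrightarrow> (\<exists>Y X. \<psi> (scons Y (scons X S)) e)" for S e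
    by (simp only:) (rule ex_comm)
  show ?thesis
    unfolding * by (rule S11_ex2) (rule \<psi>(1))
qed

lemma S11_and:
  assumes "S11 \<phi>" "S11 \<psi>"
  shows "S11 (\<lambda>S e. \<phi> S e \<and> \<psi> S e)"
proof -
  obtain \<phi>' where \<phi>': "arith \<phi>'" "\<phi> S e \<longleftrightarrow> (\<exists>X. \<phi>' (scons X S) e)" for S e
    by (rule S11_E[OF assms(1)]) (rule that)
  obtain \<psi>' where \<psi>': "arith \<psi>'" "\<psi> S e \<longleftrightarrow> (\<exists>X. \<psi>' (scons X S) e)" for S e
    by (rule S11_E[OF assms(2)]) (rule that)
  have "arith (\<lambda>S e. \<phi>' (\<lambda>v. scons (S 0) (\<lambda>v. S (Suc (Suc v))) v) e)"
  proof (rule arith_subst[OF \<phi>'(1), of "\<lambda>v S e. scons (S 0) (\<lambda>v. S (Suc (Suc v))) v" "\<lambda>x e. e x"])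
    show "arith (\<lambda>S e. e 0 \<in> scons (S 0) (\<lambda>v. S (Suc (Suc v))) v)" for v
      by (cases v) (simp_all, (rule arith_mem[OF is_term_var])+)
  qed (rule is_term_var)
  moreover have "arith (\<lambda>S e. \<psi>' (\<lambda>v. S (Suc v)) e)"
    by (rule arith_subst[OF \<psi>'(1), of "\<lambda>v S e. S (Suc v)" "\<lambda>x e. e x", OF arith_mem[OF is_term_var] is_term_var])
  ultimately have "S11 (\<lambda>S e. \<exists>X Y. \<phi>' (scons X S) e \<and> \<psi>' (scons Y S) e)"
    using S11_ex2[of "\<lambda>S e. \<phi>' (\<lambda>v. scons (S 0) (\<lambda>v. S (Suc (Suc v))) v) e \<and> \<psi>' (\<lambda>v. S (Suc v)) e"]
    by (simp add: arith_and)
  then show ?thesis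
    by (simp add: \<phi>'(2) \<psi>'(2))
qed

lemma S11_or:
  assumes "S11 \<phi>" "S11 \<psi>"
  shows "S11 (\<lambda>S e. \<phi> S e \<or> \<psi> S e)"
proof -
  obtain \<phi>' where \<phi>': "arith \<phi>'" "\<phi> S e \<longleftrightarrow> (\<exists>X. \<phi>' (scons X S) e)" for S e
    by (rule S11_E[OF assms(1)]) (rule that)
  obtain \<psi>' where \<psi>': "arith \<psi>'" "\<psi> S e \<longleftrightarrow> (\<exists>X. \<psi>' (scons X S) e)" for S e
    by (rule S11_E[OF assms(2)]) (rule that)
  show ?thesis
    unfolding S11_def \<phi>'(2) \<psi>'(2)
    by (intro exI[of _ "\<lambda>S e. \<phi>' S e \<or> \<psi>' S e"] conjI arith_or \<phi>' \<psi>') auto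
qed

lemma S11_ex:
  assumes "S11 (\<lambda>S e. \<phi> S (\<lambda>i. e (Suc i)) (e 0))"
  shows "S11 (\<lambda>S e. \<exists>k. \<phi> S e k)"
proof -
  obtain \<psi> where \<psi>: "arith \<psi>" "\<phi> S (\<lambda>i. e (Suc i)) (e 0) \<longleftrightarrow> (\<exists>X. \<psi> (scons X S) e)" for S e
    by (rule S11_E[OF assms]) (rule that)
  have *: "\<phi> S e k \<longleftrightarrow> (\<exists>X. \<psi> (scons X S) (scons k e))" for S e k
    using \<psi>(2)[of S "scons k e"] by simp
  have "arith (\<lambda>S e. \<exists>k. \<psi> S (scons k e))"
    by (rule arith_ex) (simp add: \<psi>(1))
  then show ?thesis
    unfolding S11_def * by (intro exI[of _ "\<lambda>S e. \<exists>k. \<psi> S (scons k e)"]) auto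
qed

text \<open>One witness \<open>X k\<close> is chosen for each \<open>k\<close>, and all of them are
  stored in a single set whose section at \<open>k\<close>, along \<open>pair\<close>, is
  \<open>X k\<close>.\<close>

lemma S11_all:
  assumes "S11 (\<lambda>S e. \<phi> S (\<lambda>i. e (Suc i)) (e 0))"
  shows "S11 (\<lambda>S e. \<forall>k. \<phi> S e k)"
proof -
  obtain \<psi> where \<psi>: "arith \<psi>" "\<phi> S (\<lambda>i. e (Suc i)) (e 0) \<longleftrightarrow> (\<exists>X. \<psi> (scons X S) e)" for S e
    by (rule S11_E[OF assms]) (rule that)
  have *: "\<phi> S e k \<longleftrightarrow> (\<exists>X. \<psi> (scons X S) (scons k e))" for S e k
    using \<psi>(2)[of S "scons k e"] by simp
  define D :: "nat \<Rightarrow> (nat \<Rightarrow> nat set) \<Rightarrow> (nat \<Rightarrow> nat) \<Rightarrow> nat set" where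
    "D v S e = scons {y. pair (e 0) y \<in> S 0} (\<lambda>v. S (Suc v)) v" for v S e
  have D: "arith (\<lambda>S e. e 0 \<in> D v S (\<lambda>i. e (Suc i)))" for v
    by (cases v) (simp_all add: D_def, (intro arith_mem is_term_pair is_term_var)+)
  have "arith (\<lambda>S e. \<psi> (\<lambda>v. D v S e) e)"
    by (rule arith_subst[of \<psi> D "\<lambda>x e. e x", OF \<psi>(1) D is_term_var])
  then have "arith (\<lambda>S e. \<forall>k. \<psi> (\<lambda>v. D v S (scons k e)) (scons k e))"
    by (intro arith_all) simp
  moreover have "(\<forall>k. \<exists>X. \<psi> (scons X S) (scons k e)) \<longleftrightarrow>
      (\<exists>Z. \<forall>k. \<psi> (\<lambda>v. D v (scons Z S) (scons k e)) (scons k e))" for S e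
  proof
    assume "\<forall>k. \<exists>X. \<psi> (scons X S) (scons k e)"
    then obtain X where X: "\<psi> (scons (X k) S) (scons k e)" for k by metis
    define Z where "Z = {z. \<exists>k y. z = pair k y \<and> y \<in> X k}"
    have Z: "(\<lambda>v. D v (scons Z S) (scons k e)) = scons (X k) S" for k
      by (auto simp: D_def Z_def)
    show "\<exists>Z. \<forall>k. \<psi> (\<lambda>v. D v (scons Z S) (scons k e)) (scons k e)"
      by (rule exI[of _ Z]) (simp add: Z X)
  next
    assume "\<exists>Z. \<forall>k. \<psi> (\<lambda>v. D v (scons Z S) (scons k e)) (scons k e)"
    then show "\<forall>k. \<exists>X. \<psi> (scons X S) (scons k e)"
      by (auto simp: D_def)
  qed
  ultimately show ?thesis
    unfolding S11_def *
    by (intro exI[of _ "\<lambda>S e. \<forall>k. \<psi> (\<lambda>v. D v S (scons k e)) (scons k e)"]) auto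
qed

lemma D11_S11: "D11 \<phi> \<Longrightarrow> S11 \<phi>"
  by (simp add: D11_def)

lemma D11_I: "S11 \<phi> \<Longrightarrow> S11 (\<lambda>S e. \<not> \<phi> S e) \<Longrightarrow> D11 \<phi>"
  by (simp add: D11_def)

lemma D11_not: "D11 \<phi> \<Longrightarrow> D11 (\<lambda>S e. \<not> \<phi> S e)"
  by (simp add: D11_def)

lemma D11_arith: "arith \<phi> \<Longrightarrow> D11 \<phi>"
  by (intro D11_I S11_arith arith_not)

lemma D11_and: "D11 \<phi> \<Longrightarrow> D11 \<psi> \<Longrightarrow> D11 (\<lambda>S e. \<phi> S e \<and> \<psi> S e)"
  unfolding D11_def de_Morgan_conj by (intro conjI S11_and S11_or) auto

lemma D11_or: "D11 \<phi> \<Longrightarrow> D11 \<psi> \<Longrightarrow> D11 (\<lambda>S e. \<phi> S e \<or> \<psi> S e)"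
  unfolding D11_def de_Morgan_disj by (intro conjI S11_and S11_or) auto

lemma D11_imp: "D11 \<phi> \<Longrightarrow> D11 \<psi> \<Longrightarrow> D11 (\<lambda>S e. \<phi> S e \<longrightarrow> \<psi> S e)"
  unfolding imp_conv_disj by (intro D11_or D11_not)

lemma D11_iff: "D11 \<phi> \<Longrightarrow> D11 \<psi> \<Longrightarrow> D11 (\<lambda>S e. \<phi> S e \<longleftrightarrow> \<psi> S e)"
  unfolding iff_conv_conj_imp by (intro D11_and D11_imp)

lemma D11_all:
  assumes "D11 (\<lambda>S e. \<phi> S (\<lambda>i. e (Suc i)) (e 0))"
  shows "D11 (\<lambda>S e. \<forall>k. \<phi> S e k)"
proof (rule D11_I)
  show "S11 (\<lambda>S e. \<forall>k. \<phi> S e k)"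
    by (intro S11_all D11_S11 assms)
  have "S11 (\<lambda>S e. \<exists>k. \<not> \<phi> S e k)"
    by (intro S11_ex D11_S11 D11_not assms)
  then show "S11 (\<lambda>S e. \<not> (\<forall>k. \<phi> S e k))"
    by simp
qed

lemma D11_ex:
  assumes "D11 (\<lambda>S e. \<phi> S (\<lambda>i. e (Suc i)) (e 0))"
  shows "D11 (\<lambda>S e. \<exists>k. \<phi> S e k)"
proof -
  have "D11 (\<lambda>S e. \<not> (\<forall>k. \<not> \<phi> S e k))"
    by (intro D11_not D11_all assms)
  then show ?thesis by simp
qed

lemma D11_subst:
  assumes "D11 \<phi>" and D: "\<And>v. arith (\<lambda>S e. e 0 \<in> D v S (\<lambda>i. e (Suc i)))" and T: "\<And>x. is_term (T x)"
  shows "D11 (\<lambda>S e. \<phi> (\<lambda>v. D v S e) (\<lambda>x. T x e))"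
proof (rule D11_I)
  show "S11 (\<lambda>S e. \<phi> (\<lambda>v. D v S e) (\<lambda>x. T x e))"
    by (rule S11_subst[OF D11_S11[OF assms(1)] D T])
  show "S11 (\<lambda>S e. \<not> \<phi> (\<lambda>v. D v S e) (\<lambda>x. T x e))"
    by (rule S11_subst[OF D11_S11[OF D11_not[OF assms(1)]] D T])
qed

text \<open>When \<open>\<phi>\<close> is solvable and \<open>\<psi>\<close> does not distinguish
  its solutions, "some solution satisfies \<open>\<psi>\<close>" and "no solution violates
  \<open>\<psi>\<close>" say the same; one is a Sigma11 and the other a Pi11 form.\<close>

lemma D11_sing:
  assumes "D11 (\<lambda>S e. \<phi> (\<lambda>v. S (Suc v)) e (S 0))" "D11 (\<lambda>S e. \<psi> (\<lambda>v. S (Suc v)) e (S 0))"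
    and "\<And>S e. \<exists>X. \<phi> S e X" and "\<And>S e X Y. \<phi> S e X \<Longrightarrow> \<phi> S e Y \<Longrightarrow> \<psi> S e X \<Longrightarrow> \<psi> S e Y"
  shows "D11 (\<lambda>S e. \<exists>X. \<phi> S e X \<and> \<psi> S e X)"
proof (rule D11_I)
  show "S11 (\<lambda>S e. \<exists>X. \<phi> S e X \<and> \<psi> S e X)"
    by (intro S11_exS S11_and D11_S11 assms)
  have "S11 (\<lambda>S e. \<exists>X. \<phi> S e X \<and> \<not> \<psi> S e X)"
    by (intro S11_exS S11_and D11_S11 D11_not assms)
  moreover have "(\<exists>X. \<phi> S e X \<and> \<not> \<psi> S e X) \<longleftrightarrow> \<not> (\<exists>X. \<phi> S e X \<and> \<psi> S e X)" for S e
    using assms(3,4) by metis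
  ultimately show "S11 (\<lambda>S e. \<not> (\<exists>X. \<phi> S e X \<and> \<psi> S e X))"
    by simp
qed

primrec stages :: "(nat \<Rightarrow> nat \<Rightarrow> bool) \<Rightarrow> (nat set \<Rightarrow> nat \<Rightarrow> bool) \<Rightarrow> nat \<Rightarrow> nat \<Rightarrow> nat set" where
  "stages A \<Phi> s 0 = {z. A s z}"
| "stages A \<Phi> s (Suc t) = {z. \<Phi> (stages A \<Phi> s t) z}"

text \<open>The set of all stages is the unique solution of the recursion equations.\<close>

lemma D11_stages:
  assumes A: "D11 (\<lambda>S e. A (e 0) (e 1))" and \<Phi>: "D11 (\<lambda>S e. \<Phi> (S 0) (e 0))"
  shows "D11 (\<lambda>S e. e 2 \<in> stages A \<Phi> (e 0) (e 1))"
proof -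
  define sec where "sec Z t = {y. pair t y \<in> Z}" for Z t
  define \<phi> where "\<phi> e Z \<longleftrightarrow> (\<forall>z. z \<in> sec Z 0 \<longleftrightarrow> A (e 0) z) \<and>
    (\<forall>t z. z \<in> sec Z (Suc t) \<longleftrightarrow> \<Phi> (sec Z t) z)" for e :: "nat \<Rightarrow> nat" and Z
  have stages: "sec Z t = stages A \<Phi> (e 0) t" if "\<phi> e Z" for e Z t
    using that by (induction t) (auto simp: \<phi>_def)
  have ex: "\<exists>Z. \<phi> e Z" for e
  proof -
    define Z where "Z = {z. \<exists>t y. z = pair t y \<and> y \<in> stages A \<Phi> (e 0) t}"
    have "sec Z t = stages A \<Phi> (e 0) t" for t
      by (auto simp: sec_def Z_def)
    then have "\<phi> e Z" by (simp add: \<phi>_def)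
    then show ?thesis ..
  qed
  define T :: "nat \<Rightarrow> (nat \<Rightarrow> nat) \<Rightarrow> nat" where "T = scons (\<lambda>e. e 1) (\<lambda>i e. e 0)"
  have T: "is_term (T x)" for x
    by (cases x) (simp_all add: T_def is_term_var)
  have 1: "D11 (\<lambda>S e. A (e 1) (e 0))"
    using D11_subst[OF A, of "\<lambda>v S e. S v" T, OF arith_mem[OF is_term_var] T]
    by (simp add: T_def numeral_eq_Suc)
  have 2: "D11 (\<lambda>S e. \<Phi> (sec (S 0) (e 1)) (e 0))"
  proof -
    have "arith (\<lambda>S e. e 0 \<in> sec (S 0) (e (Suc 1)))"
      unfolding sec_def mem_Collect_eq by (intro arith_mem is_term_pair is_term_var)
    from D11_subst[OF \<Phi>, of "\<lambda>v S e. sec (S 0) (e 1)" "\<lambda>x e. e x", OF this is_term_var]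
    show ?thesis .
  qed
  have 3: "D11 (\<lambda>S e. e 0 \<in> sec (S 0) 0)" "D11 (\<lambda>S e. e 0 \<in> sec (S 0) (Suc (e 1)))"
    "D11 (\<lambda>S e. e 2 \<in> sec (S 0) (e 1))"
    unfolding sec_def mem_Collect_eq
    by (intro D11_arith arith_mem is_term_pair is_term_Suc is_term_const is_term_var)+
  have "D11 (\<lambda>S e. \<phi> e (S 0))"
    unfolding \<phi>_def
    by (intro D11_and D11_all D11_iff) (use 1 2 3 in \<open>simp_all add: numeral_eq_Suc\<close>)
  then have "D11 (\<lambda>S e. \<exists>Z. \<phi> e Z \<and> e 2 \<in> sec Z (e 1))"
    by (intro D11_sing[of "\<lambda>S. \<phi>" "\<lambda>S e Z. e 2 \<in> sec Z (e 1)"] 3 ex) (auto simp: stages)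
  moreover have "(\<exists>Z. \<phi> e Z \<and> e 2 \<in> sec Z (e 1)) \<longleftrightarrow> e 2 \<in> stages A \<Phi> (e 0) (e 1)" for e
    using ex[of e] stages by metis
  ultimately show ?thesis by simp
qed

section \<open>Lists of numbers and runs of Turing machines\<close>

lemma D11_inst2:
  assumes "D11 (\<lambda>S e. R (e 0) (e 1))" "is_term s" "is_term t"
  shows "D11 (\<lambda>S e. R (s e) (t e))"
proof -
  have "is_term (scons s (\<lambda>i. t) x)" for x
    using assms by (cases x) auto
  from D11_subst[OF assms(1), of "\<lambda>v S e. S v" "scons s (\<lambda>i. t)", OF arith_mem[OF is_term_var] this]
  show ?thesis by simp
qed

lemma D11_inst3:
  assumes "D11 (\<lambda>S e. R (e 0) (e 1) (e 2))" "is_term s" "is_term t" "is_term u"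
  shows "D11 (\<lambda>S e. R (s e) (t e) (u e))"
proof -
  have "is_term (scons s (scons t (\<lambda>i. u)) x)" for x
  proof (cases x)
    case (Suc y)
    then show ?thesis using assms by (cases y) auto
  qed (use assms in auto)
  from D11_subst[OF assms(1), of "\<lambda>v S e. S v" "scons s (scons t (\<lambda>i. u))", OF arith_mem[OF is_term_var] this]
  show ?thesis by simp
qed

lemmas D11_eq = D11_arith[OF arith_eq]
lemmas D11_less = D11_arith[OF arith_less]
lemmas D11_mem = D11_arith[OF arith_mem]

lemmas D11_intros = D11_and D11_or D11_imp D11_iff D11_not D11_all D11_ex D11_eq D11_less D11_mem
lemmas arith_intros = arith_and arith_or arith_imp arith_iff arith_not arith_all arith_ex arith_eq arith_less arith_mem
lemmas is_term_intros = is_term_var is_term_plus is_term_times is_term_Suc is_term_pair is_term_const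

text \<open>Iteration is a run of \<open>stages\<close> through singletons: stage \<open>t\<close>
  from \<open>s\<close> is \<open>{(h ^^ t) s}\<close>.\<close>

lemma D11_funpow:
  assumes "D11 (\<lambda>S e. e 1 = h (e 0))"
  shows "D11 (\<lambda>S e. (h ^^ e 1) (e 0) = e 2)"
proof -
  define A where "A s z \<longleftrightarrow> z = s" for s z :: nat
  define \<Phi> where "\<Phi> X z \<longleftrightarrow> (\<exists>y. y \<in> X \<and> z = h y)" for X z
  have st: "stages A \<Phi> s t = {(h ^^ t) s}" for s t
    by (induction t) (auto simp: A_def \<Phi>_def)
  have "D11 (\<lambda>S e. A (e 0) (e 1))"
    unfolding A_def by (intro D11_eq is_term_var)
  moreover have "D11 (\<lambda>S e. \<Phi> (S 0) (e 0))"
    unfolding \<Phi>_def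
    by (intro D11_ex D11_and D11_mem is_term_var D11_inst2[OF assms, of "\<lambda>e. e 0" "\<lambda>e. e (Suc 0)"])
  ultimately show ?thesis
    using D11_stages[of A \<Phi>] by (simp add: st eq_commute)
qed

section \<open>Coded lists of numbers as Delta11 relations\<close>

definition cons_code :: "nat \<Rightarrow> nat \<Rightarrow> nat" where
  "cons_code x c = Suc (prod_encode (x, c))"

text \<open>Doubling removes the division in the triangular number, so the graph of
  \<open>cons_code\<close> is a polynomial equation.\<close>

lemma cons_code_eq: "c = cons_code x d \<longleftrightarrow> 2 * c = (x + d) * Suc (x + d) + 2 * x + 2"
proof -
  have "2 * triangle n = n * Suc n" for n
    by (induction n) simp_all
  from this[of "x + d"] show ?thesis
    by (auto simp: cons_code_def prod_encode_def)
qed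

lemma arith_cons_code: "is_term r \<Longrightarrow> is_term s \<Longrightarrow> is_term t \<Longrightarrow> arith (\<lambda>S e. r e = cons_code (s e) (t e))"
  unfolding cons_code_eq by (intro arith_eq is_term_intros)

lemmas D11_cons_code = D11_arith[OF arith_cons_code]

lemma list_decode_cons_code [simp]: "list_decode (cons_code x c) = x # list_decode c"
  by (simp add: cons_code_def)

lemma cons_code_list_encode: "cons_code x (list_encode xs) = list_encode (x # xs)"
  by (simp add: cons_code_def)

definition tl_code :: "nat \<Rightarrow> nat" where
  "tl_code c = list_encode (tl (list_decode c))"

lemma tl_code_eq: "d = tl_code c \<longleftrightarrow> c = 0 \<and> d = 0 \<or> (\<exists>x. c = cons_code x d)"
proof (cases "list_decode c")
  case Nil
  then have "c = 0" by (metis list_decode_inverse list_encode.simps(1))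
  then show ?thesis by (simp add: tl_code_def cons_code_def)
next
  case (Cons x xs)
  then have c: "c = list_encode (x # xs)" by (metis list_decode_inverse)
  then show ?thesis
    by (auto simp: tl_code_def cons_code_def)
qed

lemma tl_code_funpow: "list_decode ((tl_code ^^ i) c) = drop i (list_decode c)"
  by (induction i) (simp_all add: tl_code_def tl_drop drop_Suc)

lemma D11_tl_funpow: "is_term r \<Longrightarrow> is_term s \<Longrightarrow> is_term t \<Longrightarrow> D11 (\<lambda>S e. (tl_code ^^ r e) (s e) = t e)"
proof -
  have "D11 (\<lambda>S e. e 1 = tl_code (e 0))"
    unfolding tl_code_eq by (intro D11_intros D11_cons_code is_term_intros)
  then show "is_term r \<Longrightarrow> is_term s \<Longrightarrow> is_term t \<Longrightarrow> ?thesis"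
    using D11_inst3[OF D11_funpow, of tl_code s r t] by blast
qed

text \<open>A relation rather than a function: it fails past the end of the list, and this makes
  lengths and concatenations expressible by it.\<close>

definition nth_code :: "nat \<Rightarrow> nat \<Rightarrow> nat \<Rightarrow> bool" where
  "nth_code c i x \<longleftrightarrow> i < length (list_decode c) \<and> list_decode c ! i = x"

lemma nth_code_eq: "nth_code c i x \<longleftrightarrow> (\<exists>d t. (tl_code ^^ i) c = d \<and> d = cons_code x t)"
proof
  assume "nth_code c i x"
  then have "drop i (list_decode c) = x # drop (Suc i) (list_decode c)"
    by (auto simp: nth_code_def Cons_nth_drop_Suc)
  then have "(tl_code ^^ i) c = list_encode (x # drop (Suc i) (list_decode c))"
    by (metis tl_code_funpow list_decode_inverse)
  then show "\<exists>d t. (tl_code ^^ i) c = d \<and> d = cons_code x t"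
    by (metis cons_code_list_encode)
next
  assume "\<exists>d t. (tl_code ^^ i) c = d \<and> d = cons_code x t"
  then obtain t where "drop i (list_decode c) = x # list_decode t"
    by (metis tl_code_funpow list_decode_cons_code)
  then show "nth_code c i x"
    unfolding nth_code_def
    by (metis drop_all linorder_not_less list.distinct(1) Cons_nth_drop_Suc list.inject)
qed

lemma D11_nth_code: "is_term r \<Longrightarrow> is_term s \<Longrightarrow> is_term t \<Longrightarrow> D11 (\<lambda>S e. nth_code (r e) (s e) (t e))"
proof -
  have "D11 (\<lambda>S e. nth_code (e 0) (e 1) (e 2))"
    unfolding nth_code_eq by (intro D11_intros D11_tl_funpow D11_cons_code is_term_intros)
  then show "is_term r \<Longrightarrow> is_term s \<Longrightarrow> is_term t \<Longrightarrow> ?thesis"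
    by (rule D11_inst3)
qed

definition length_code :: "nat \<Rightarrow> nat \<Rightarrow> bool" where
  "length_code c n \<longleftrightarrow> length (list_decode c) = n"

lemma length_code_eq:
  "length_code c n \<longleftrightarrow> (\<forall>x. \<not> nth_code c n x) \<and> (\<forall>i. i < n \<longrightarrow> (\<exists>x. nth_code c i x))"
  unfolding length_code_def nth_code_def by (auto simp: not_less) (meson le_antisym not_le order_refl)

lemma D11_length_code: "is_term r \<Longrightarrow> is_term s \<Longrightarrow> D11 (\<lambda>S e. length_code (r e) (s e))"
proof -
  have "D11 (\<lambda>S e. length_code (e 0) (e 1))"
    unfolding length_code_eq by (intro D11_intros D11_nth_code is_term_intros)
  then show "is_term r \<Longrightarrow> is_term s \<Longrightarrow> ?thesis"
    by (rule D11_inst2)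
qed

definition append_code :: "nat \<Rightarrow> nat \<Rightarrow> nat \<Rightarrow> bool" where
  "append_code a b c \<longleftrightarrow> list_decode c = list_decode a @ list_decode b"

lemma append_code_eq:
  "append_code a b c \<longleftrightarrow> (\<exists>n. length_code a n \<and>
     (\<forall>i. i < n \<longrightarrow> (\<forall>x. nth_code c i x \<longleftrightarrow> nth_code a i x)) \<and> (tl_code ^^ n) c = b)"
proof
  assume *: "append_code a b c"
  have "(tl_code ^^ length (list_decode a)) c = b"
    using tl_code_funpow[of "length (list_decode a)" c] *
    by (metis append_code_def append_eq_conv_conj list_decode_inverse)
  then show "\<exists>n. length_code a n \<and>
     (\<forall>i. i < n \<longrightarrow> (\<forall>x. nth_code c i x \<longleftrightarrow> nth_code a i x)) \<and> (tl_code ^^ n) c = b"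
    using * by (intro exI[of _ "length (list_decode a)"])
      (auto simp: length_code_def nth_code_def append_code_def nth_append)
next
  assume "\<exists>n. length_code a n \<and>
     (\<forall>i. i < n \<longrightarrow> (\<forall>x. nth_code c i x \<longleftrightarrow> nth_code a i x)) \<and> (tl_code ^^ n) c = b"
  then obtain n where n: "length (list_decode a) = n" "(tl_code ^^ n) c = b"
    and nth: "\<And>i x. i < n \<Longrightarrow> nth_code c i x \<longleftrightarrow> nth_code a i x"
    by (auto simp: length_code_def)
  have at: "i < length (list_decode c) \<and> list_decode c ! i = list_decode a ! i" if "i < n" for i
    using nth[OF that, of "list_decode a ! i"] that n by (auto simp: nth_code_def)
  have "n \<le> length (list_decode c)"
    using at[of "length (list_decode c)"] by (cases "n \<le> length (list_decode c)") auto
  then have "take n (list_decode c) = list_decode a"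
    using at n by (intro nth_equalityI) auto
  then show "append_code a b c"
    using tl_code_funpow[of n c] n by (metis append_code_def append_take_drop_id)
qed

lemma D11_append_code: "is_term r \<Longrightarrow> is_term s \<Longrightarrow> is_term t \<Longrightarrow> D11 (\<lambda>S e. append_code (r e) (s e) (t e))"
proof -
  have "D11 (\<lambda>S e. append_code (e 0) (e 1) (e 2))"
    unfolding append_code_eq
    by (intro D11_intros D11_tl_funpow D11_length_code D11_nth_code is_term_intros)
  then show "is_term r \<Longrightarrow> is_term s \<Longrightarrow> is_term t \<Longrightarrow> ?thesis"
    by (rule D11_inst3)
qed

text \<open>Deletes the first symbol of the unary input: a positive head loses one 1, and at a head
  0 only its terminating 2 is left to delete. Iterating it reaches every input cell without building
  the encoded word.\<close>

definition next_code :: "nat \<Rightarrow> nat" where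
  "next_code c = (case list_decode c of [] \<Rightarrow> 0 | x # xs \<Rightarrow>
     (case x of 0 \<Rightarrow> list_encode xs | Suc y \<Rightarrow> list_encode (y # xs)))"

text \<open>The first symbol of the encoded input, with 0 as the blank behind its end.\<close>

definition char_code :: "nat \<Rightarrow> nat" where
  "char_code c = (case list_decode c of [] \<Rightarrow> 0 | x # xs \<Rightarrow> (case x of 0 \<Rightarrow> 2 | Suc y \<Rightarrow> 1))"

lemma code_cases:
  obtains "c = 0" | d where "c = cons_code 0 d" | x d where "c = cons_code (Suc x) d"
proof (cases "list_decode c")
  case Nil
  then show ?thesis using that(1) by (metis list_decode_inverse list_encode.simps(1))
next
  case (Cons x xs)
  then have "c = cons_code x (list_encode xs)"
    by (metis cons_code_list_encode list_decode_inverse)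
  then show ?thesis using that(2,3) by (cases x) auto
qed

lemma cons_code_inject [simp]: "cons_code x c = cons_code y d \<longleftrightarrow> x = y \<and> c = d"
  and cons_code_nonzero [simp]: "cons_code x c \<noteq> 0"
  by (auto simp: cons_code_def)

lemma next_code_eq:
  "d = next_code c \<longleftrightarrow> c = 0 \<and> d = 0 \<or> c = cons_code 0 d \<or>
     (\<exists>x b. c = cons_code (Suc x) b \<and> d = cons_code x b)"
  by (rule code_cases[of c]) (auto simp: next_code_def cons_code_def)

lemma char_code_eq:
  "a = char_code c \<longleftrightarrow> c = 0 \<and> a = 0 \<or> (\<exists>b. c = cons_code 0 b) \<and> a = 2 \<or>
     (\<exists>x b. c = cons_code (Suc x) b) \<and> a = 1"
  by (rule code_cases[of c]) (auto simp: char_code_def)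

lemma encode_input_nth:
  "(if p < length (encode_input xs) then encode_input xs ! p else 0)
     = char_code ((next_code ^^ p) (list_encode xs))"
proof (induction p arbitrary: xs)
  case 0
  show ?case
  proof (cases xs)
    case (Cons x ys)
    then show ?thesis
      by (cases x) (simp_all add: encode_input_def char_code_def)
  qed (simp add: encode_input_def char_code_def)
next
  case (Suc p)
  have nil: "(next_code ^^ p) 0 = 0" for p
    by (induction p) (simp_all add: next_code_def)
  consider "xs = []" | ys where "xs = 0 # ys" | x ys where "xs = Suc x # ys"
    by (metis list.exhaust not0_implies_Suc)
  then show ?case
  proof cases
    case 1
    then show ?thesis
      using nil[of "Suc p"] by (simp add: encode_input_def char_code_def)
  next
    case (2 ys)
    have "next_code (list_encode xs) = list_encode ys" "encode_input xs = 2 # encode_input ys"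
      unfolding 2 by (simp_all add: next_code_def encode_input_def del: list_encode.simps)
    then show ?thesis
      using Suc[of ys] by (simp only: funpow_Suc_right o_apply length_Cons nth_Cons_Suc Suc_less_eq)
  next
    case (3 x ys)
    have "next_code (list_encode xs) = list_encode (x # ys)"
      "encode_input xs = 1 # encode_input (x # ys)"
      unfolding 3 by (simp_all add: next_code_def encode_input_def del: list_encode.simps)
    then show ?thesis
      using Suc[of "x # ys"]
      by (simp only: funpow_Suc_right o_apply length_Cons nth_Cons_Suc Suc_less_eq)
  qed
qed

definition word_code :: "nat \<Rightarrow> nat \<Rightarrow> nat \<Rightarrow> bool" where
  "word_code s p a \<longleftrightarrow> a = char_code ((next_code ^^ p) s)"

lemma D11_word_code: "is_term r \<Longrightarrow> is_term s \<Longrightarrow> is_term t \<Longrightarrow> D11 (\<lambda>S e. word_code (r e) (s e) (t e))"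
proof -
  have n: "D11 (\<lambda>S e. e 1 = next_code (e 0))"
    unfolding next_code_eq by (intro D11_intros D11_cons_code is_term_intros)
  have c: "D11 (\<lambda>S e. e 1 = char_code (e 0))"
    unfolding char_code_eq by (intro D11_intros D11_cons_code is_term_intros)
  have w: "word_code s p a \<longleftrightarrow> (\<exists>d. (next_code ^^ p) s = d \<and> a = char_code d)" for s p a
    by (simp add: word_code_def)
  have "D11 (\<lambda>S e. word_code (e 0) (e 1) (e 2))"
    unfolding w
    by (intro D11_ex D11_and D11_inst3[OF D11_funpow[OF n]] D11_inst2[OF c] is_term_intros)
  then show "is_term r \<Longrightarrow> is_term s \<Longrightarrow> is_term t \<Longrightarrow> ?thesis"
    by (rule D11_inst3)
qed

section \<open>Runs of Turing machines as stages of an arithmetical operator\<close>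

definition next_config :: "tm \<Rightarrow> config \<Rightarrow> config" where
  "next_config M c = (case delta M (fst c) (map scan (snd c)) of
     None \<Rightarrow> c | Some (q, acts) \<Rightarrow> (q, map2 act (snd c) acts))"

lemma tm_computes_iff:
  "tm_computes M xs k \<longleftrightarrow> (\<exists>t c. (next_config M ^^ t) (tm_init M xs) = c \<and>
     tm_halted M c \<and> tape_output (last (snd c)) k)"
proof -
  have "\<exists>t. (next_config M ^^ t) a = c" if "(tm_step M)\<^sup>*\<^sup>* a c" for a c
    using that
  proof induction
    case base
    show ?case by (rule exI[of _ 0]) simp
  next
    case (step b c)
    then obtain t where "(next_config M ^^ t) a = b" by blast
    moreover have "next_config M b = c"
      using step.hyps(2) by (auto simp: tm_step_def next_config_def)
    ultimately have "(next_config M ^^ Suc t) a = c" by simp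
    then show ?case ..
  qed
  moreover have "(tm_step M)\<^sup>*\<^sup>* a ((next_config M ^^ t) a)" for a t
  proof (induction t)
    case (Suc t)
    let ?b = "(next_config M ^^ t) a"
    have "(tm_step M)\<^sup>*\<^sup>* ?b (next_config M ?b)"
    proof (cases "delta M (fst ?b) (map scan (snd ?b))")
      case None
      then show ?thesis by (simp add: next_config_def)
    next
      case (Some r)
      then have "tm_step M ?b (next_config M ?b)"
        by (cases r) (auto simp: next_config_def tm_step_def)
      then show ?thesis ..
    qed
    with Suc show ?case by simp
  qed simp
  ultimately show ?thesis
    unfolding tm_computes_def by blast
qed

text \<open>The invariant that keeps a run inside the finite domain on which \<open>wf_tm\<close>
  controls \<open>delta\<close>.\<close>

definition valid_config :: "tm \<Rightarrow> config \<Rightarrow> bool" where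
  "valid_config M c \<longleftrightarrow> fst c < num_states M \<and> length (snd c) = num_tapes M \<and>
     (\<forall>t\<in>set (snd c). \<forall>x. fst t x < num_symbols M)"

lemma valid_config_scan:
  assumes "valid_config M c"
  shows "length (map scan (snd c)) = num_tapes M" "set (map scan (snd c)) \<subseteq> {..<num_symbols M}"
  using assms by (auto simp: valid_config_def scan_def)

lemma valid_config_next:
  assumes "wf_tm M" and "valid_config M c"
  shows "valid_config M (next_config M c)"
proof (cases "delta M (fst c) (map scan (snd c))")
  case None
  then show ?thesis using assms by (simp add: next_config_def)
next
  case (Some r)
  obtain q acts where r: "r = (q, acts)" by (cases r)
  have wf: "q < num_states M" "length acts = num_tapes M" "fst ` set acts \<subseteq> {..<num_symbols M}"
    using assms Some valid_config_scan[OF assms(2)] unfolding wf_tm_def valid_config_def r by metis+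
  have "fst (act t a) x < num_symbols M" if "t \<in> set (snd c)" "a \<in> set acts" for t a x
  proof -
    have "fst a < num_symbols M" "fst t x < num_symbols M"
      using that wf(3) assms(2) by (auto simp: valid_config_def)
    then show ?thesis by (cases t; cases a) simp
  qed
  then have "\<forall>t\<in>set (map2 act (snd c) acts). \<forall>x. fst t x < num_symbols M"
    by (fastforce dest: set_zip_leftD set_zip_rightD)
  then show ?thesis
    using assms(2) wf Some r by (simp add: next_config_def valid_config_def)
qed

lemma encode_input_symbols: "set (encode_input xs) \<subseteq> {1, 2}"
  by (auto simp: encode_input_def)

lemma valid_config_init:
  assumes "wf_tm M"
  shows "valid_config M (tm_init M xs)"
proof -
  have "fst (word_tape (encode_input xs)) x < 3" for x
  proof (cases "nat x < length (encode_input xs)")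
    case True
    then have "encode_input xs ! nat x \<in> {1, 2}"
      using encode_input_symbols[of xs] nth_mem by blast
    then show ?thesis by (auto simp: word_tape_def)
  qed (simp add: word_tape_def)
  then show ?thesis
    using assms
    by (auto simp: wf_tm_def valid_config_def tm_init_def blank_tape_def intro: less_le_trans)
qed

lemma valid_config_run:
  "wf_tm M \<Longrightarrow> valid_config M ((next_config M ^^ t) (tm_init M xs))"
  by (induction t) (simp_all add: valid_config_init valid_config_next)

text \<open>A configuration is coded as the set of its elementary facts, tagged 0 for the state, by odd
  numbers for the head positions and by positive even numbers for the cells of the tapes.\<close>

definition config_set :: "config \<Rightarrow> nat set" where
  "config_set c = {pair 0 (fst c)} \<union>
     {z. \<exists>i<length (snd c). z = pair (2 * i + 1) (int_encode (snd (snd c ! i)))} \<union>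
     {z. \<exists>i<length (snd c). \<exists>x. z = pair (2 * i + 2) (pair x (fst (snd c ! i) (int_decode x)))}"

lemma config_set_simps [simp]:
  "pair 0 q \<in> config_set c \<longleftrightarrow> q = fst c"
  "pair (Suc (2 * i)) h \<in> config_set c \<longleftrightarrow> i < length (snd c) \<and> h = int_encode (snd (snd c ! i))"
  "pair (Suc (Suc (2 * i))) (pair x a) \<in> config_set c \<longleftrightarrow>
     i < length (snd c) \<and> a = fst (snd c ! i) (int_decode x)"
proof -
  show "pair 0 q \<in> config_set c \<longleftrightarrow> q = fst c"
    by (auto simp: config_set_def)
  have ne: "Suc (2 * i) \<noteq> 2 * j" "2 * j \<noteq> Suc (2 * i)" for i j :: nat
    by presburger+
  show "pair (Suc (2 * i)) h \<in> config_set c \<longleftrightarrow> i < length (snd c) \<and> h = int_encode (snd (snd c ! i))"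
    "pair (Suc (Suc (2 * i))) (pair x a) \<in> config_set c \<longleftrightarrow>
     i < length (snd c) \<and> a = fst (snd c ! i) (int_decode x)"
    using ne by (auto simp: config_set_def)
qed

definition shift_code :: "move \<Rightarrow> nat \<Rightarrow> nat \<Rightarrow> bool" where
  "shift_code d h h' \<longleftrightarrow> h' = int_encode (shift d (int_decode h))"

text \<open>\<open>int_encode\<close> sends \<open>i\<close> to \<open>2 * i\<close> and
  \<open>- 1 - i\<close> to \<open>2 * i + 1\<close> for natural \<open>i\<close>. The three cases
  are a nonnegative position, the step from -1 to 0, and a position below -1.\<close>

lemma shift_code_right:
  "shift_code MoveRight h h' \<longleftrightarrow>
     (\<exists>i. h = 2 * i \<and> h' = 2 * i + 2) \<or> h = 1 \<and> h' = 0 \<or> (\<exists>i. h = 2 * i + 3 \<and> h' = 2 * i + 1)"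
proof -
  consider i where "h = 2 * i" | "h = 1" | i where "h = 2 * i + 3"
  proof (cases "even h")
    case False
    then have "h = 1 \<or> (\<exists>i. h = 2 * i + 3)" by presburger
    then show ?thesis using that by blast
  qed (use that in \<open>auto elim!: evenE\<close>)
  moreover have "2 * i \<noteq> 2 * j + 3" "2 * j + 3 \<noteq> 2 * i" for i j :: nat
    by presburger+
  ultimately show ?thesis
    by cases (auto simp: shift_code_def int_encode_def int_decode_def sum_encode_def sum_decode_def
      nat_add_distrib)
qed

lemma shift_code_left: "shift_code MoveLeft h h' \<longleftrightarrow> shift_code MoveRight h' h"
  by (auto simp: shift_code_def)

lemma arith_shift_code:
  assumes "is_term s" "is_term t"
  shows "arith (\<lambda>S e. shift_code d (s e) (t e))"
proof -
  have "arith (\<lambda>S e. shift_code MoveRight (e 0) (e 1))"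
    unfolding shift_code_right by (intro arith_intros is_term_intros)
  note * = arith_ren[OF this, of "scons s (\<lambda>i. t)"] arith_ren[OF this, of "scons t (\<lambda>i. s)"]
  have "is_term (scons s (\<lambda>i. t) x)" "is_term (scons t (\<lambda>i. s) x)" for x
    using assms by (cases x; simp)+
  with * have "arith (\<lambda>S e. shift_code MoveRight (s e) (t e))" "arith (\<lambda>S e. shift_code MoveRight (t e) (s e))"
    by simp_all
  moreover have "arith (\<lambda>S e. t e = s e)"
    using assms by (intro arith_eq)
  ultimately show ?thesis
    by (cases d) (simp_all add: shift_code_left, simp add: shift_code_def)
qed

definition symbol_tuples :: "tm \<Rightarrow> nat list set" where
  "symbol_tuples M = {syms. set syms \<subseteq> {..<num_symbols M} \<and> length syms = num_tapes M}"

lemma finite_symbol_tuples: "finite (symbol_tuples M)"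
  unfolding symbol_tuples_def by (rule finite_lists_length_eq) simp

definition scans :: "tm \<Rightarrow> nat set \<Rightarrow> nat \<Rightarrow> nat list \<Rightarrow> bool" where
  "scans M X q syms \<longleftrightarrow> pair 0 q \<in> X \<and> (\<forall>i\<in>{..<num_tapes M}.
     \<exists>h. pair (Suc (2 * i)) h \<in> X \<and> pair (Suc (Suc (2 * i))) (pair h (syms ! i)) \<in> X)"

definition updated :: "nat \<Rightarrow> nat \<Rightarrow> (nat \<times> move) list \<Rightarrow> nat set \<Rightarrow> nat \<Rightarrow> bool" where
  "updated T q acts X z \<longleftrightarrow> z = pair 0 q \<or> (\<exists>i\<in>{..<T}. \<exists>h. pair (Suc (2 * i)) h \<in> X \<and>
     ((\<exists>h'. shift_code (snd (acts ! i)) h h' \<and> z = pair (Suc (2 * i)) h') \<or>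
      z = pair (Suc (Suc (2 * i))) (pair h (fst (acts ! i))) \<or>
      (\<exists>x a. x \<noteq> h \<and> pair (Suc (Suc (2 * i))) (pair x a) \<in> X \<and> z = pair (Suc (Suc (2 * i))) (pair x a))))"

text \<open>\<open>delta\<close> is an arbitrary function, but its relevant part is finite. Spelling
  it out as a finite disjunction over states and symbol tuples gives an arithmetical
  predicate.\<close>

definition config_step :: "tm \<Rightarrow> nat set \<Rightarrow> nat \<Rightarrow> bool" where
  "config_step M X z \<longleftrightarrow> (\<exists>q\<in>{..<num_states M}. \<exists>syms\<in>symbol_tuples M. scans M X q syms \<and>
     (case delta M q syms of None \<Rightarrow> z \<in> X | Some r \<Rightarrow> updated (num_tapes M) (fst r) (snd r) X z))"

definition halted_with :: "tm \<Rightarrow> nat set \<Rightarrow> nat \<Rightarrow> bool" where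
  "halted_with M X k \<longleftrightarrow>
     (\<exists>q\<in>{..<num_states M}. \<exists>syms\<in>symbol_tuples M. scans M X q syms \<and> delta M q syms = None) \<and>
     (\<forall>i. i < k \<longrightarrow> pair (Suc (Suc (2 * (num_tapes M - 1)))) (pair (2 * i) 1) \<in> X) \<and>
     pair (Suc (Suc (2 * (num_tapes M - 1)))) (pair (2 * k) 0) \<in> X"

lemma scans_config_set:
  assumes "length (snd c) = num_tapes M" and "length syms = num_tapes M"
  shows "scans M (config_set c) q syms \<longleftrightarrow> q = fst c \<and> syms = map scan (snd c)"
  using assms by (auto simp: scans_def scan_def list_eq_iff_nth_eq)

lemma act_eq: "act t a = ((fst t)(snd t := fst a), shift (snd a) (snd t))"
  by (cases t; cases a) simp

lemma int_decode_eq_iff: "int_decode x = y \<longleftrightarrow> x = int_encode y"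
  by auto

lemma updated_config_set:
  assumes "length ts = T" and "length acts = T"
  shows "updated T q acts (config_set (p, ts)) z \<longleftrightarrow> z \<in> config_set (q, map2 act ts acts)"
proof
  assume "updated T q acts (config_set (p, ts)) z"
  then show "z \<in> config_set (q, map2 act ts acts)"
    using assms unfolding updated_def
    by (auto simp: act_eq shift_code_def int_decode_eq_iff)
next
  assume "z \<in> config_set (q, map2 act ts acts)"
  then consider "z = pair 0 q"
    | i where "i < T" "z = pair (Suc (2 * i)) (int_encode (shift (snd (acts ! i)) (snd (ts ! i))))"
    | i x where "i < T"
        "z = pair (Suc (Suc (2 * i))) (pair x (((fst (ts ! i))(snd (ts ! i) := fst (acts ! i))) (int_decode x)))"
    using assms by (auto simp: config_set_def act_eq)
  then show "updated T q acts (config_set (p, ts)) z"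
  proof cases
    case (3 i x)
    then show ?thesis
      using assms unfolding updated_def
      by (cases "int_decode x = snd (ts ! i)") (auto intro!: bexI[of _ i] simp: int_decode_eq_iff)
  qed (use assms in \<open>auto simp: updated_def shift_code_def\<close>)
qed

lemma config_step_config_set:
  assumes "wf_tm M" and "valid_config M c"
  shows "config_step M (config_set c) z \<longleftrightarrow> z \<in> config_set (next_config M c)"
proof -
  let ?syms = "map scan (snd c)"
  have v: "fst c \<in> {..<num_states M}" "?syms \<in> symbol_tuples M" "length (snd c) = num_tapes M"
    using assms(2) valid_config_scan[OF assms(2)] by (auto simp: valid_config_def symbol_tuples_def)
  have "scans M (config_set c) q syms \<longleftrightarrow> q = fst c \<and> syms = ?syms" if "syms \<in> symbol_tuples M" for q syms
    using that v by (intro scans_config_set) (auto simp: symbol_tuples_def)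
  then have "config_step M (config_set c) z \<longleftrightarrow> (case delta M (fst c) ?syms of None \<Rightarrow> z \<in> config_set c
      | Some r \<Rightarrow> updated (num_tapes M) (fst r) (snd r) (config_set c) z)"
    using v(1,2) unfolding config_step_def by auto
  also have "\<dots> \<longleftrightarrow> z \<in> config_set (next_config M c)"
  proof (cases "delta M (fst c) ?syms")
    case (Some r)
    then have "length (snd r) = num_tapes M"
      using assms valid_config_scan[OF assms(2)] unfolding wf_tm_def valid_config_def
      by (metis prod.collapse)
    then show ?thesis
      using updated_config_set[OF v(3), of "snd r" "fst r" "fst c" z] Some
      by (cases r) (simp add: next_config_def)
  qed (simp add: next_config_def)
  finally show ?thesis .
qed

lemma halted_with_config_set:
  assumes "wf_tm M" and "valid_config M c"
  shows "halted_with M (config_set c) k \<longleftrightarrow> tm_halted M c \<and> tape_output (last (snd c)) k"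
proof -
  let ?syms = "map scan (snd c)"
  have v: "fst c \<in> {..<num_states M}" "?syms \<in> symbol_tuples M" "length (snd c) = num_tapes M"
    using assms(2) valid_config_scan[OF assms(2)] by (auto simp: valid_config_def symbol_tuples_def)
  have "scans M (config_set c) q syms \<longleftrightarrow> q = fst c \<and> syms = ?syms" if "syms \<in> symbol_tuples M" for q syms
    using that v by (intro scans_config_set) (auto simp: symbol_tuples_def)
  then have 1: "(\<exists>q\<in>{..<num_states M}. \<exists>syms\<in>symbol_tuples M.
      scans M (config_set c) q syms \<and> delta M q syms = None) \<longleftrightarrow> tm_halted M c"
    using v(1,2) unfolding tm_halted_def by auto
  have T: "0 < num_tapes M" using assms(1) by (simp add: wf_tm_def)
  then have "last (snd c) = snd c ! (num_tapes M - 1)"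
    using v(3) by (metis last_conv_nth length_greater_0_conv)
  then show ?thesis
    using T v(3) unfolding halted_with_def 1
    by (auto simp: tape_output_def int_decode_def sum_decode_def)
qed

lemma D11_config_step: "D11 (\<lambda>S e. config_step M (S 0) (e 0))"
proof -
  have u: "arith (\<lambda>S e. updated T q acts (S 0) (e 0))" for T q acts
    unfolding updated_def
    by (intro arith_intros arith_finite_ex is_term_intros finite_lessThan arith_shift_code)
  have "arith (\<lambda>S e. case delta M q syms of None \<Rightarrow> e 0 \<in> S 0
      | Some r \<Rightarrow> updated (num_tapes M) (fst r) (snd r) (S 0) (e 0))" for q syms
    by (cases "delta M q syms") (simp_all add: u, intro arith_intros is_term_intros)
  then have "arith (\<lambda>S e. config_step M (S 0) (e 0))"
    unfolding config_step_def scans_def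
    by (intro arith_intros arith_finite_ex arith_finite_all is_term_intros finite_lessThan finite_symbol_tuples)
  then show ?thesis by (rule D11_arith)
qed

lemma D11_halted_with: "D11 (\<lambda>S e. halted_with M (S 0) (e 0))"
  unfolding halted_with_def scans_def
  by (intro D11_arith arith_intros arith_finite_ex arith_finite_all is_term_intros finite_lessThan
      finite_symbol_tuples arith_const)

definition init_set :: "tm \<Rightarrow> nat \<Rightarrow> nat \<Rightarrow> bool" where
  "init_set M s z \<longleftrightarrow> z \<in> config_set (tm_init M (list_decode s))"

text \<open>Only the first tape depends on \<open>s\<close>, through \<open>word_code\<close>. Even
  \<open>x\<close> are the codes of its cells from 0 on, odd \<open>x\<close> those of the blank
  cells to the left.\<close>

lemma init_set_eq:
  assumes "0 < num_tapes M"
  shows "init_set M s z \<longleftrightarrow> z = pair 0 0 \<or> (\<exists>i\<in>{..<num_tapes M}. z = pair (Suc (2 * i)) 0) \<or>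
    (\<exists>i\<in>{1..<num_tapes M}. \<exists>x. z = pair (Suc (Suc (2 * i))) (pair x 0)) \<or>
    (\<exists>x a. z = pair 2 (pair x a) \<and> ((\<exists>p. x = 2 * p \<and> word_code s p a) \<or> (\<exists>p. x = 2 * p + 1 \<and> a = 0)))"
proof -
  let ?ts = "word_tape (encode_input (list_decode s)) # replicate (num_tapes M - 1) blank_tape"
  have len: "length ?ts = num_tapes M" using assms by simp
  have blank: "?ts ! i = blank_tape" if "i \<in> {1..<num_tapes M}" for i
    using that by (auto simp: nth_Cons')
  have head: "snd (?ts ! i) = 0" if "i < num_tapes M" for i
    using blank[of i] that by (cases i) (auto simp: word_tape_def blank_tape_def)
  have i0: "int_encode 0 = 0" by (simp add: int_encode_def sum_encode_def)
  have word: "fst (?ts ! 0) (int_decode x) = a \<longleftrightarrow>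
      (\<exists>p. x = 2 * p \<and> word_code s p a) \<or> (\<exists>p. x = 2 * p + 1 \<and> a = 0)" for x a
  proof (cases "even x")
    case True
    then obtain p where p: "x = 2 * p" ..
    then have "int_decode x = int p" by (simp add: int_decode_def sum_decode_def)
    then have "fst (?ts ! 0) (int_decode x) = (if p < length (encode_input (list_decode s))
        then encode_input (list_decode s) ! p else 0)"
      by (simp add: word_tape_def)
    also have "\<dots> = char_code ((next_code ^^ p) s)"
      by (simp only: encode_input_nth list_decode_inverse)
    finally have "fst (?ts ! 0) (int_decode x) = char_code ((next_code ^^ p) s)" .
    then show ?thesis using p by (auto simp: word_code_def) presburger
  next
    case False
    then obtain p where p: "x = 2 * p + 1" by (elim oddE)
    then have "int_decode x < 0" by (simp add: int_decode_def sum_decode_def)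
    then have "fst (?ts ! 0) (int_decode x) = 0" by (simp add: word_tape_def)
    then show ?thesis using p by auto presburger
  qed
  have split: "(\<exists>i<num_tapes M. Q i) \<longleftrightarrow> Q 0 \<or> (\<exists>i\<in>{1..<num_tapes M}. Q i)" for Q
  proof
    assume "\<exists>i<num_tapes M. Q i"
    then obtain i where i: "i < num_tapes M" "Q i" by (elim exE conjE)
    then show "Q 0 \<or> (\<exists>i\<in>{1..<num_tapes M}. Q i)"
      by (cases "i = 0") auto
  next
    assume "Q 0 \<or> (\<exists>i\<in>{1..<num_tapes M}. Q i)"
    then show "\<exists>i<num_tapes M. Q i"
      using assms by auto
  qed
  have "z \<in> config_set (0, ?ts) \<longleftrightarrow> z = pair 0 0 \<or> (\<exists>i<num_tapes M. z = pair (Suc (2 * i)) 0) \<or>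
    (\<exists>i<num_tapes M. \<exists>x. z = pair (Suc (Suc (2 * i))) (pair x (fst (?ts ! i) (int_decode x))))"
    using head i0 unfolding config_set_def fst_conv snd_conv len by auto
  also have "\<dots> \<longleftrightarrow> z = pair 0 0 \<or> (\<exists>i\<in>{..<num_tapes M}. z = pair (Suc (2 * i)) 0) \<or>
    (\<exists>i\<in>{1..<num_tapes M}. \<exists>x. z = pair (Suc (Suc (2 * i))) (pair x 0)) \<or>
    (\<exists>x a. z = pair 2 (pair x a) \<and> fst (?ts ! 0) (int_decode x) = a)"
    using blank unfolding split[of "\<lambda>i. \<exists>x. z = pair (Suc (Suc (2 * i))) (pair x (fst (?ts ! i) (int_decode x)))"]
    by (auto simp: blank_tape_def numeral_2_eq_2)
  finally show ?thesis
    unfolding word init_set_def tm_init_def .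
qed

text \<open>The set of facts at time \<open>t\<close> is determined by the input and
  \<open>t\<close>, so \<open>D11_sing\<close> applies to it; the time itself is an existential
  number quantifier.\<close>

lemma D11_tm_computes:
  assumes "wf_tm M" "is_term s" "is_term t"
  shows "D11 (\<lambda>S e. tm_computes M (list_decode (s e)) (t e))"
proof -
  have T: "0 < num_tapes M" using assms by (simp add: wf_tm_def)
  have init: "D11 (\<lambda>S e. init_set M (e 0) (e 1))"
    unfolding init_set_eq[OF T]
    by (intro D11_or D11_ex D11_and D11_word_code D11_arith[OF arith_finite_ex] D11_eq arith_intros is_term_intros
        finite_lessThan finite_atLeastLessThan)
  have st: "stages (init_set M) (config_step M) s t
      = config_set ((next_config M ^^ t) (tm_init M (list_decode s)))" for s t
  proof (induction t)
    case (Suc t)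
    then show ?case
      using config_step_config_set[OF assms(1) valid_config_run[OF assms(1)]] by auto
  qed (auto simp: init_set_def)
  \<comment> \<open>Equality of sets in pointwise form, since membership is the only atomic
    statement about sets.\<close>
  define \<phi> where "\<phi> s t X \<longleftrightarrow> (\<forall>z. z \<in> X \<longleftrightarrow> z \<in> stages (init_set M) (config_step M) s t)" for s t X
  have \<phi>: "\<phi> s t X \<longleftrightarrow> X = stages (init_set M) (config_step M) s t" for s t X
    by (auto simp: \<phi>_def)
  have mem: "D11 (\<lambda>S e. e 0 \<in> stages (init_set M) (config_step M) (e 2) (e 1))"
    by (rule D11_inst3[OF D11_stages[OF init D11_config_step]]) (intro is_term_intros)+
  have "D11 (\<lambda>S e. \<phi> (e 1) (e 0) (S 0))"
    unfolding \<phi>_def by (intro D11_all D11_iff D11_mem is_term_var) (use mem in \<open>simp add: numeral_2_eq_2\<close>)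
  moreover have "D11 (\<lambda>S e. halted_with M (S 0) (e 2))"
    using D11_subst[OF D11_halted_with, of "\<lambda>v S e. S v" "\<lambda>x e. e (x + 2)", OF arith_mem[OF is_term_var] is_term_var]
    by (simp add: numeral_2_eq_2)
  ultimately have "D11 (\<lambda>S e. \<exists>X. \<phi> (e 1) (e 0) X \<and> halted_with M X (e 2))"
    by (intro D11_sing[of "\<lambda>S e. \<phi> (e 1) (e 0)" "\<lambda>S e X. halted_with M X (e 2)"]) (auto simp: \<phi>)
  then have "D11 (\<lambda>S e. \<exists>t X. \<phi> (e 0) t X \<and> halted_with M X (e 1))"
    by (intro D11_ex) (simp add: numeral_2_eq_2)
  moreover have "(\<exists>t X. \<phi> s t X \<and> halted_with M X k) \<longleftrightarrow> tm_computes M (list_decode s) k" for s k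
    unfolding \<phi> st tm_computes_iff
    using halted_with_config_set[OF assms(1) valid_config_run[OF assms(1)]] by auto
  ultimately have "D11 (\<lambda>S e. tm_computes M (list_decode (e 0)) (e 1))"
    by simp
  then show ?thesis
    by (rule D11_inst2) fact+
qed

section \<open>From fast-growing sequences to analytical definitions\<close>

text \<open>Halted configurations are fixed points of \<open>next_config\<close>, so both runs end
  in the same one; and the first cell of the output that is not 1 has only one position.\<close>

lemma tm_computes_unique:
  assumes "tm_computes M xs k" and "tm_computes M xs k'"
  shows "k = k'"
proof -
  have halted: "(next_config M ^^ d) c = c" if "tm_halted M c" for c d
    using that by (induction d) (simp_all add: next_config_def tm_halted_def)
  obtain t t' where *: "tm_halted M ((next_config M ^^ t) (tm_init M xs))"
      "tape_output (last (snd ((next_config M ^^ t) (tm_init M xs)))) k"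
      "tm_halted M ((next_config M ^^ t') (tm_init M xs))"
      "tape_output (last (snd ((next_config M ^^ t') (tm_init M xs)))) k'"
    using assms unfolding tm_computes_iff by blast
  have "(next_config M ^^ t) (tm_init M xs) = (next_config M ^^ t') (tm_init M xs)"
  proof (cases "t \<le> t'")
    case True
    then have "t' = (t' - t) + t" by simp
    then show ?thesis using halted[OF *(1), of "t' - t"] by (metis comp_apply funpow_add)
  next
    case False
    then have "t = (t - t') + t'" by simp
    then show ?thesis using halted[OF *(3), of "t - t'"] by (metis comp_apply funpow_add)
  qed
  with * have out: "tape_output t k" "tape_output t k'"
    if "t = last (snd ((next_config M ^^ t') (tm_init M xs)))" for t
    using that by simp_all
  show ?thesis
    using out[OF refl] unfolding tape_output_def by (metis linorder_neqE_nat zero_neq_one)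
qed

section \<open>Finite fast-growing lists and the truth value they determine\<close>

definition fast_list :: "(nat \<Rightarrow> nat) \<Rightarrow> nat list \<Rightarrow> bool" where
  "fast_list f xs \<longleftrightarrow> (\<forall>i<length xs. f (case i of 0 \<Rightarrow> 0 | Suc j \<Rightarrow> xs ! j) < xs ! i)"

lemma fast_list_mono: "fast_list f' xs \<Longrightarrow> (\<And>x. f x \<le> f' x) \<Longrightarrow> fast_list f xs"
  unfolding fast_list_def by (meson le_less_trans)

lemma fast_growing_mono: "fast_growing f' g \<Longrightarrow> (\<And>x. f x \<le> f' x) \<Longrightarrow> fast_growing f g"
  unfolding fast_growing_def by (meson le_less_trans)

text \<open>Only the seam is critical: the first entry of \<open>t\<close> exceeds
  \<open>f' 0\<close>, so it suffices that \<open>f' 0\<close> majorizes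
  \<open>f (last s)\<close>.\<close>

lemma fast_list_append:
  assumes "fast_list f s" "fast_list f' t" and "\<And>x. f x \<le> f' x" and "s \<noteq> [] \<Longrightarrow> f (last s) \<le> f' 0"
  shows "fast_list f (s @ t)"
  unfolding fast_list_def
proof (intro allI impI)
  fix i assume i: "i < length (s @ t)"
  show "f (case i of 0 \<Rightarrow> 0 | Suc j \<Rightarrow> (s @ t) ! j) < (s @ t) ! i"
  proof (cases "i < length s")
    case True
    then show ?thesis
      using assms(1) by (auto simp: fast_list_def nth_append split: nat.split)
  next
    case False
    then obtain j where j: "i = length s + j" "j < length t"
      using i by (metis add_diff_inverse_nat length_append nat_add_left_cancel_less)
    have t: "f' (case j of 0 \<Rightarrow> 0 | Suc j \<Rightarrow> t ! j) < t ! j"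
      using assms(2) j by (auto simp: fast_list_def)
    show ?thesis
    proof (cases j)
      case 0
      then show ?thesis
        using j t assms(3)[of 0] assms(4) le_less_trans
        by (cases s rule: rev_cases) (auto simp: nth_append)
    next
      case (Suc k)
      then show ?thesis
        using j t assms(3)[of "t ! k"] by (auto simp: nth_append)
    qed
  qed
qed

lemma fast_list_Nil: "fast_list f []"
  by (simp add: fast_list_def)

lemma fast_list_take:
  assumes "fast_list f s"
  shows "fast_list f (take k s)"
  unfolding fast_list_def
proof (intro allI impI)
  fix i assume "i < length (take k s)"
  then show "f (case i of 0 \<Rightarrow> 0 | Suc j \<Rightarrow> take k s ! j) < take k s ! i"
    using assms unfolding fast_list_def by (cases i) auto
qed

lemma length_initial_segment [simp]: "length (initial_segment g k) = k"
  by (simp add: initial_segment_def)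

lemma nth_initial_segment [simp]: "i < k \<Longrightarrow> initial_segment g k ! i = g i"
  by (simp add: initial_segment_def)

lemma fast_growing_iff: "fast_growing f g \<longleftrightarrow> (\<forall>k. fast_list f (initial_segment g k))"
proof
  assume *: "fast_growing f g"
  show "\<forall>k. fast_list f (initial_segment g k)"
    unfolding fast_list_def
  proof (intro allI impI)
    fix k i assume "i < length (initial_segment g k)"
    then show "f (case i of 0 \<Rightarrow> 0 | Suc j \<Rightarrow> initial_segment g k ! j) < initial_segment g k ! i"
      using * by (cases i) (auto simp: fast_growing_def)
  qed
next
  assume *: "\<forall>k. fast_list f (initial_segment g k)"
  have "f (case i of 0 \<Rightarrow> 0 | Suc j \<Rightarrow> g j) < g i" for i
    using *[rule_format, of "Suc i", unfolded fast_list_def, rule_format, of i]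
    by (cases i) auto
  from this[of 0] this[of "Suc _"] show "fast_growing f g"
    by (simp add: fast_growing_def)
qed

lemma initial_segment_split:
  assumes "length s \<le> k" and "initial_segment g (length s) = s"
  obtains t where "initial_segment g k = s @ t"
proof -
  have "initial_segment g k = initial_segment g (length s) @ map g [length s..<k]"
    using assms(1) unfolding initial_segment_def
    by (metis le_add_diff_inverse map_append upt_add_eq_append zero_le)
  then show ?thesis using that assms(2) by metis
qed

text \<open>Behind \<open>s\<close> the least admissible values are taken. With
  \<open>s = []\<close> this also shows that fast-growing sequences exist.\<close>

lemma fast_list_extend:
  assumes "fast_list f s"
  obtains g where "fast_growing f g" "initial_segment g (length s) = s"
proof -
  define g where "g = rec_nat (if s = [] then Suc (f 0) else s ! 0)
    (\<lambda>n v. if Suc n < length s then s ! Suc n else Suc (f v))"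
  have g: "g i = s ! i" if "i < length s" for i
    using that by (cases i) (auto simp: g_def)
  have "fast_growing f g"
    unfolding fast_growing_def
  proof (intro conjI allI)
    show "f 0 < g 0"
      using assms by (auto simp: g_def fast_list_def)
    fix n
    show "f (g n) < g (Suc n)"
    proof (cases "Suc n < length s")
      case True
      then show ?thesis
        using assms g[of n] g[of "Suc n"] by (auto simp: fast_list_def dest: spec[of _ "Suc n"])
    qed (simp add: g_def)
  qed
  moreover have "initial_segment g (length s) = s"
    by (rule nth_equalityI) (simp_all add: g)
  ultimately show ?thesis by (rule that)
qed

text \<open>A fast list that forces \<open>w\<close> lies on an \<open>f0\<close>-fast sequence.
  That sequence eventually stays in \<open>Q0\<close>, and at a common length the machine has to
  output both \<open>w\<close> and \<open>v\<close>.\<close>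

lemma valid_notion_ext_truth:
  assumes "valid_notion Q0" and "\<And>s. s \<in> extension_closure Q0 \<Longrightarrow> tm_computes M (n # s) v"
  shows "(\<forall>f. \<exists>s. fast_list f s \<and> (\<forall>t. tm_computes M (n # s @ t) w)) \<longleftrightarrow> w = v"
proof -
  obtain f0 where f0: "\<And>g. fast_growing f0 g \<Longrightarrow> \<exists>m. \<forall>k\<ge>m. initial_segment g k \<in> Q0"
    using assms(1) unfolding valid_notion_def by blast
  have Q: "tm_computes M (n # s @ t) v" if "s \<in> Q0" for s t
    using that by (intro assms(2)) (auto simp: extension_closure_def)
  show ?thesis
  proof
    assume "\<forall>f. \<exists>s. fast_list f s \<and> (\<forall>t. tm_computes M (n # s @ t) w)"
    then obtain s where s: "fast_list f0 s" "\<And>t. tm_computes M (n # s @ t) w" by blast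
    then obtain g where g: "fast_growing f0 g" "initial_segment g (length s) = s"
      using fast_list_extend by blast
    then obtain m where m: "\<And>k. m \<le> k \<Longrightarrow> initial_segment g k \<in> Q0"
      using f0 by blast
    obtain t where "initial_segment g (max m (length s)) = s @ t"
      using initial_segment_split[OF max.cobounded2 g(2)] by blast
    then show "w = v"
      using Q[OF m[of "max m (length s)"], of "[]"] s(2)[of t] tm_computes_unique by force
  next
    assume "w = v"
    show "\<forall>f. \<exists>s. fast_list f s \<and> (\<forall>t. tm_computes M (n # s @ t) w)"
    proof
      fix f
      obtain g where g: "fast_growing (\<lambda>x. max (f x) (f0 x)) g"
        using fast_list_extend[of "\<lambda>x. max (f x) (f0 x)" "[]"] by (auto simp: fast_list_def)
      then have "fast_growing f g" "fast_growing f0 g"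
        by (rule fast_growing_mono; simp)+
      then obtain m where "fast_list f (initial_segment g m)" "initial_segment g m \<in> Q0"
        using f0 fast_growing_iff by blast
      then show "\<exists>s. fast_list f s \<and> (\<forall>t. tm_computes M (n # s @ t) w)"
        using Q \<open>w = v\<close> by blast
    qed
  qed
qed

text \<open>The continuation \<open>t\<close> is fast by itself, starting anew from 0; the seam with
  \<open>s\<close> is controlled through the choice of the function. Excluding \<open>t = []\<close>
  ensures that a failure to be settled yields a proper extension, so that repeated failures produce
  an infinite sequence.\<close>

definition settled :: "tm \<Rightarrow> nat \<Rightarrow> nat list \<Rightarrow> nat \<Rightarrow> bool" where
  "settled M n s w \<longleftrightarrow> (\<exists>f. \<forall>t. t \<noteq> [] \<longrightarrow> fast_list f t \<longrightarrow> tm_computes M (n # s @ t) w)"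

text \<open>If no fast-growing list were settled with the right value, one could repeatedly extend it and
  obtain a fast-growing sequence on which the computed value is wrong infinitely often.\<close>

lemma valid_notion_truth:
  assumes "valid_notion Q" and Q: "\<And>s. s \<in> Q \<Longrightarrow> tm_computes M (n # s) v"
  shows "(\<forall>f. \<exists>s. fast_list f s \<and> settled M n s w) \<longleftrightarrow> w = v"
proof -
  obtain f0 where f0: "\<And>g. fast_growing f0 g \<Longrightarrow> \<exists>m. \<forall>k\<ge>m. initial_segment g k \<in> Q"
    using assms(1) unfolding valid_notion_def by blast
  show ?thesis
  proof
    assume "\<forall>f. \<exists>s. fast_list f s \<and> settled M n s w"
    then obtain s f where s: "fast_list f0 s"
      and f: "\<And>t. t \<noteq> [] \<Longrightarrow> fast_list f t \<Longrightarrow> tm_computes M (n # s @ t) w"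
      unfolding settled_def by blast
    \<comment> \<open>Above \<open>f\<close>, so that the continuation is covered by the settledness
      of \<open>s\<close>; above \<open>f0\<close>, so that it is fast for \<open>Q\<close>; and
      above the constant \<open>f0 (last s)\<close>, which takes care of the seam.\<close>
    define F where "F x = max (f x) (max (f0 x) (f0 (last s)))" for x
    obtain g where g: "fast_growing F g"
      using fast_list_extend[of F "[]"] by (auto simp: fast_list_def)
    define h where "h i = (if i < length s then s ! i else g (i - length s))" for i
    have h: "initial_segment h (length s + k) = s @ initial_segment g k" for k
      by (rule nth_equalityI) (auto simp: h_def nth_append)
    have hs: "initial_segment h k = take k s" if "k \<le> length s" for k
      using that by (intro nth_equalityI) (auto simp: h_def)
    have "fast_list f0 (initial_segment h k)" for k
    proof (cases "k \<le> length s")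
      case True
      then show ?thesis using hs[OF True] fast_list_take[OF s] by simp
    next
      case False
      then obtain j where k: "k = length s + j" by (metis le_Suc_ex nat_le_linear)
      have "fast_list F (initial_segment g j)" using g fast_growing_iff by blast
      then show ?thesis
        unfolding k h by (intro fast_list_append[OF s]) (auto simp: F_def)
    qed
    then obtain m where m: "\<And>k. m \<le> k \<Longrightarrow> initial_segment h k \<in> Q"
      using f0 fast_growing_iff by blast
    \<comment> \<open>The length \<open>Suc m\<close> makes the continuation nonempty and the whole
      list longer than \<open>m\<close>.\<close>
    have "fast_list F (initial_segment g (Suc m))" using g fast_growing_iff by blast
    then have "fast_list f (initial_segment g (Suc m))"
      by (rule fast_list_mono) (simp add: F_def)
    moreover have "initial_segment g (Suc m) \<noteq> []" by (simp add: initial_segment_def)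
    ultimately have "tm_computes M (n # initial_segment h (length s + Suc m)) w"
      unfolding h by (intro f)
    moreover have "tm_computes M (n # initial_segment h (length s + Suc m)) v"
      by (intro Q m) simp
    ultimately show "w = v" by (rule tm_computes_unique)
  next
    assume "w = v"
    show "\<forall>f. \<exists>s. fast_list f s \<and> settled M n s w"
    proof (rule ccontr)
      assume "\<not> ?thesis"
      then obtain f where f: "\<And>s. fast_list f s \<Longrightarrow> \<not> settled M n s v"
        unfolding \<open>w = v\<close> by blast
      define F where "F x = max (f x) (f0 x)" for x
      have step: "\<exists>t. t \<noteq> [] \<and> fast_list F (s @ t) \<and> \<not> tm_computes M (n # s @ t) v" if "fast_list F s" for s
      proof -
        \<comment> \<open>The constant \<open>F (last s)\<close> again makes the concatenation fast
          across the seam.\<close>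
        define F' where "F' x = max (F x) (F (last s))" for x
        have "\<not> settled M n s v"
          using that by (intro f) (auto intro: fast_list_mono simp: F_def)
        then obtain t where t: "t \<noteq> []" "fast_list F' t" "\<not> tm_computes M (n # s @ t) v"
          unfolding settled_def by blast
        moreover have "fast_list F (s @ t)"
          by (rule fast_list_append[OF that t(2)]) (auto simp: F'_def)
        ultimately show ?thesis by blast
      qed
      have start: "\<exists>s. fast_list F s"
        using fast_list_Nil by blast
      have ext: "\<exists>s'. fast_list F s' \<and> (\<exists>t. t \<noteq> [] \<and> s' = s @ t \<and> \<not> tm_computes M (n # s') v)"
        if "fast_list F s" for s
        using step[OF that] by blast
      have "\<exists>S. \<forall>k. fast_list F (S k) \<and>
          (\<exists>t. t \<noteq> [] \<and> S (Suc k) = S k @ t \<and> \<not> tm_computes M (n # S (Suc k)) v)"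
        by (rule dependent_nat_choice[of "\<lambda>_. fast_list F"
              "\<lambda>k s s'. \<exists>t. t \<noteq> [] \<and> s' = s @ t \<and> \<not> tm_computes M (n # s') v",
              OF start ext])
      then obtain S where "\<forall>k. fast_list F (S k) \<and>
          (\<exists>t. t \<noteq> [] \<and> S (Suc k) = S k @ t \<and> \<not> tm_computes M (n # S (Suc k)) v)"
        by (rule exE)
      then have S: "fast_list F (S k)"
        and S': "\<exists>t. t \<noteq> [] \<and> S (Suc k) = S k @ t \<and> \<not> tm_computes M (n # S (Suc k)) v" for k
        by simp_all
      have len: "k \<le> length (S k)" for k
      proof (induction k)
        case (Suc k)
        obtain t where "t \<noteq> []" "S (Suc k) = S k @ t" using S' by blast
        with Suc show ?case by (cases t) auto
      qed simp
      have pre: "\<exists>u. S (k + d) = S k @ u" for k d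
      proof (induction d)
        case (Suc d)
        then obtain u where u: "S (k + d) = S k @ u" by blast
        obtain t where "S (Suc (k + d)) = S (k + d) @ t" using S' by blast
        then show ?case using u by simp
      qed simp
      \<comment> \<open>The limit of the growing lists; index \<open>i\<close> is in range because
        the list \<open>S (Suc i)\<close> has length at least \<open>Suc i\<close>.\<close>
      define g where "g i = S (Suc i) ! i" for i
      have g: "g i = S k ! i" if "i < length (S k)" for i k
      proof (cases "Suc i \<le> k")
        case True
        then obtain u where "S k = S (Suc i) @ u" using pre[of "Suc i" "k - Suc i"] by auto
        then show ?thesis using len[of "Suc i"] by (simp add: g_def nth_append)
      next
        case False
        then obtain u where "S (Suc i) = S k @ u" using pre[of k "Suc i - k"] by auto
        then show ?thesis using that by (simp add: g_def nth_append)
      qed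
      have seg: "initial_segment g (length (S k)) = S k" for k
        by (rule nth_equalityI) (simp_all add: g)
      have "initial_segment g k = take k (S k)" for k
        using len[of k] by (intro nth_equalityI) (simp_all add: g)
      then have "fast_list F (initial_segment g k)" for k
        using fast_list_take[OF S] by simp
      then have "fast_growing f0 g"
        by (intro fast_growing_mono[of F g f0]) (auto simp: F_def fast_growing_iff)
      then obtain m where m: "\<And>k. m \<le> k \<Longrightarrow> initial_segment g k \<in> Q" using f0 by blast
      have "tm_computes M (n # S (Suc m)) v"
        using Q[OF m[of "length (S (Suc m))"]] len[of "Suc m"] seg by simp
      then show False using S' by blast
    qed
  qed
qed

section \<open>Function quantifiers and the analytical definitions\<close>

definition graph :: "(nat \<Rightarrow> nat) \<Rightarrow> nat set" where
  "graph f = range (\<lambda>x. pair x (f x))"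

lemma pair_in_graph [simp]: "pair x y \<in> graph f \<longleftrightarrow> y = f x"
  by (auto simp: graph_def)

text \<open>Since \<open>pair\<close> is not onto, the first conjunct is what excludes stray members
  that are no pairs and makes \<open>X\<close> equal to a graph.\<close>

definition is_graph :: "nat set \<Rightarrow> bool" where
  "is_graph X \<longleftrightarrow> (\<forall>z. z \<in> X \<longrightarrow> (\<exists>x y. z = pair x y)) \<and>
     (\<forall>x. \<exists>y. pair x y \<in> X \<and> (\<forall>y'. pair x y' \<in> X \<longrightarrow> y' = y))"

lemma is_graph_iff: "is_graph X \<longleftrightarrow> (\<exists>f. X = graph f)"
proof
  assume X: "is_graph X"
  then have "\<forall>x. \<exists>y. pair x y \<in> X \<and> (\<forall>y'. pair x y' \<in> X \<longrightarrow> y' = y)"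
    by (simp add: is_graph_def)
  then obtain f where f: "\<And>x. pair x (f x) \<in> X" "\<And>x y'. pair x y' \<in> X \<Longrightarrow> y' = f x"
    by metis
  have "X = graph f"
  proof (intro set_eqI iffI)
    fix z assume "z \<in> X"
    moreover from this X obtain x y where "z = pair x y" by (auto simp: is_graph_def)
    ultimately show "z \<in> graph f" using f(2) by simp
  qed (auto simp: graph_def f)
  then show "\<exists>f. X = graph f" by (rule exI[of _ f])
next
  assume "\<exists>f. X = graph f"
  then obtain f where f: "X = graph f" by blast
  have "\<exists>x y. z = pair x y" if "z \<in> graph f" for z
    using that by (auto simp: graph_def)
  then show "is_graph X" by (auto simp: is_graph_def f)
qed

lemma arith_is_graph: "arith (\<lambda>S e. is_graph (S 0))"
  unfolding is_graph_def by (intro arith_intros is_term_intros)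

lemma S11_ex_fun:
  assumes "S11 (\<lambda>S e. \<phi> (\<lambda>v. S (Suc v)) e (S 0))"
  shows "S11 (\<lambda>S e. \<exists>f. \<phi> S e (graph f))"
proof -
  have "S11 (\<lambda>S e. \<exists>X. is_graph X \<and> \<phi> S e X)"
    by (intro S11_exS S11_and S11_arith arith_is_graph assms)
  moreover have "(\<exists>X. is_graph X \<and> \<phi> S e X) \<longleftrightarrow> (\<exists>f. \<phi> S e (graph f))" for S e
    unfolding is_graph_iff by auto
  ultimately show ?thesis by simp
qed

definition fast_code :: "nat set \<Rightarrow> nat \<Rightarrow> bool" where
  "fast_code X c \<longleftrightarrow> (\<forall>x. nth_code c 0 x \<longrightarrow> (\<exists>y. pair 0 y \<in> X \<and> y < x)) \<and>
     (\<forall>i x x'. nth_code c i x \<longrightarrow> nth_code c (Suc i) x' \<longrightarrow> (\<exists>y. pair x y \<in> X \<and> y < x'))"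

lemma fast_code_graph: "fast_code (graph f) c \<longleftrightarrow> fast_list f (list_decode c)"
proof
  assume *: "fast_code (graph f) c"
  show "fast_list f (list_decode c)"
    unfolding fast_list_def
  proof (intro allI impI)
    fix i assume "i < length (list_decode c)"
    then show "f (case i of 0 \<Rightarrow> 0 | Suc j \<Rightarrow> list_decode c ! j) < list_decode c ! i"
      using * by (cases i) (auto simp: fast_code_def nth_code_def)
  qed
next
  assume *: "fast_list f (list_decode c)"
  have "f 0 < list_decode c ! 0" if "list_decode c \<noteq> []"
    using *[unfolded fast_list_def, rule_format, of 0] that by simp
  moreover have "f (list_decode c ! i) < list_decode c ! Suc i" if "Suc i < length (list_decode c)" for i
    using *[unfolded fast_list_def, rule_format, of "Suc i"] that by simp
  ultimately show "fast_code (graph f) c"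
    by (auto simp: fast_code_def nth_code_def)
qed

lemma D11_fast_code:
  assumes "is_term t"
  shows "D11 (\<lambda>S e. fast_code (S v) (t e))"
proof -
  have "D11 (\<lambda>S e. fast_code (S 0) (e 0))"
    unfolding fast_code_def by (intro D11_intros D11_nth_code is_term_intros)
  from D11_subst[OF this, of "\<lambda>i S e. S v" "\<lambda>i. t", OF arith_mem[OF is_term_var] assms]
  show ?thesis .
qed

text \<open>The parameter is set variable 0 of \<open>\<phi>\<close>; putting the quantified set in
  front moves it to variable 1, as \<open>holds_at\<close> expects.\<close>

lemma Sigma11_in_S11:
  assumes "S11 \<phi>" and "\<And>n. n \<in> P \<longleftrightarrow> \<phi> ((\<lambda>_. {})(0 := A)) ((\<lambda>_. 0)(0 := n))"
  shows "Sigma11_in A P"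
proof -
  obtain \<psi> where \<psi>: "arith \<psi>" "\<phi> S e \<longleftrightarrow> (\<exists>X. \<psi> (scons X S) e)" for S e
    by (rule S11_E[OF assms(1)]) (rule that)
  obtain p where "\<forall>S e. sat S e p \<longleftrightarrow> \<psi> S e"
    using arith_formula[OF \<psi>(1)] by (rule exE)
  then have p: "sat S e p \<longleftrightarrow> \<psi> S e" for S e
    by (elim allE)
  have "scons X ((\<lambda>_. {})(0 := A)) = (\<lambda>_. {})(0 := X, 1 := A)" for X :: "nat set"
  proof
    fix i show "scons X ((\<lambda>_. {})(0 := A)) i = ((\<lambda>_. {})(0 := X, 1 := A)) i"
      by (cases i) auto
  qed
  then show ?thesis
    unfolding Sigma11_in_def holds_at_def
    by (intro exI[of _ p]) (simp add: assms(2) \<psi>(2) p)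
qed

lemma Pi11_in_Compl: "Pi11_in A P \<longleftrightarrow> Sigma11_in A (- P)"
proof
  assume "Pi11_in A P"
  then obtain p where p: "\<And>n. n \<in> P \<longleftrightarrow> (\<forall>X. holds_at p n X A)"
    unfolding Pi11_in_def by blast
  show "Sigma11_in A (- P)"
    unfolding Sigma11_in_def by (rule exI[of _ "FNot p"]) (simp add: p holds_at_def)
next
  assume "Sigma11_in A (- P)"
  then obtain p where "\<forall>n. n \<in> - P \<longleftrightarrow> (\<exists>X. holds_at p n X A)"
    unfolding Sigma11_in_def by blast
  then have p: "\<And>n. n \<in> P \<longleftrightarrow> \<not> (\<exists>X. holds_at p n X A)" by blast
  show "Pi11_in A P"
    unfolding Pi11_in_def by (rule exI[of _ "FNot p"]) (simp add: p holds_at_def)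
qed

text \<open>\<open>\<phi> b\<close> says that \<open>b\<close> is the wrong truth value. Refuting 0
  defines \<open>P\<close>, and refuting 1 defines its complement.\<close>

lemma Delta11_in_S11:
  assumes "\<And>b. S11 (\<phi> b)"
    and "\<And>n b. \<phi> b ((\<lambda>_. {})(0 := A)) ((\<lambda>_. 0)(0 := n)) \<longleftrightarrow> b \<noteq> (of_bool (n \<in> P) :: nat)"
  shows "Delta11_in A P"
  unfolding Delta11_in_def Pi11_in_Compl
proof
  show "Sigma11_in A P"
    by (rule Sigma11_in_S11[OF assms(1)[of 0]]) (simp add: assms(2))
  show "Sigma11_in A (- P)"
    by (rule Sigma11_in_S11[OF assms(1)[of 1]]) (simp add: assms(2))
qed

theorem fast_growing_ext_Delta11:
  assumes "computable_fast_growing_ext P"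
  shows "Delta11 P"
proof -
  obtain M where M: "wf_tm M"
    and Q: "\<And>n. \<exists>Q. valid_notion_ext Q \<and> (\<forall>s\<in>Q. tm_computes M (n # s) (of_bool (n \<in> P)))"
    using assms unfolding computable_fast_growing_ext_def computable_using_def by blast
  have truth: "(\<forall>f. \<exists>s. fast_list f s \<and> (\<forall>t. tm_computes M (n # s @ t) w)) \<longleftrightarrow> w = of_bool (n \<in> P)"
    for n w
  proof -
    obtain Q0 where "valid_notion Q0"
      "\<And>s. s \<in> extension_closure Q0 \<Longrightarrow> tm_computes M (n # s) (of_bool (n \<in> P))"
      using Q[of n] unfolding valid_notion_ext_def by blast
    then show ?thesis by (rule valid_notion_ext_truth)
  qed
  \<comment> \<open>The code \<open>d\<close> ranges over all extensions; \<open>a\<close> and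
    \<open>u\<close> only name the concatenation and the full input, which are available as
    relations.\<close>
  define R where "R n c w \<longleftrightarrow> (\<forall>d a u. append_code c d a \<longrightarrow> u = cons_code n a \<longrightarrow>
    tm_computes M (list_decode u) w)" for n c w
  have R: "R n c w \<longleftrightarrow> (\<forall>t. tm_computes M (n # list_decode c @ t) w)" for n c w
    unfolding R_def append_code_def by (auto, metis list_encode_inverse)
  have DR: "D11 (\<lambda>S e. R (e 0) (e 1) w)" for w
    unfolding R_def
    by (intro D11_intros D11_append_code D11_cons_code D11_tm_computes[OF M] is_term_intros)
  \<comment> \<open>This negates the characterization in \<open>truth\<close>: a wrong
    \<open>w\<close> is witnessed by one function \<open>f\<close>.\<close>
  have "S11 (\<lambda>S e. \<exists>f. \<forall>c. \<not> (fast_code (graph f) c \<and> R (e 0) c w))" for w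
    by (intro S11_ex_fun[of "\<lambda>S e X. \<forall>c. \<not> (fast_code X c \<and> R (e 0) c w)"] D11_S11 D11_all D11_not
        D11_and D11_fast_code D11_inst2[OF DR] is_term_var)
  moreover have "(\<exists>f. \<forall>c. \<not> (fast_code (graph f) c \<and> R n c w)) \<longleftrightarrow> w \<noteq> of_bool (n \<in> P)" for n w
    using truth[of n w] unfolding fast_code_graph R by (metis list_encode_inverse)
  ultimately show ?thesis
    by (intro Delta11_in_S11[of "\<lambda>w S e. \<exists>f. \<forall>c. \<not> (fast_code (graph f) c \<and> R (e 0) c w)"]) simp_all
qed

theorem fast_growing_Delta11_hyperjump:
  assumes "is_hyperjump_of_0 H" and "computable_fast_growing P"
  shows "Delta11_in H P"
proof -
  obtain M where M: "wf_tm M"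
    and Q: "\<And>n. \<exists>Q. valid_notion Q \<and> (\<forall>s\<in>Q. tm_computes M (n # s) (of_bool (n \<in> P)))"
    using assms(2) unfolding computable_fast_growing_def computable_using_def by blast
  have truth: "(\<forall>f. \<exists>s. fast_list f s \<and> settled M n s w) \<longleftrightarrow> w = of_bool (n \<in> P)" for n w
  proof -
    obtain Q where "valid_notion Q" "\<And>s. s \<in> Q \<Longrightarrow> tm_computes M (n # s) (of_bool (n \<in> P))"
      using Q[of n] by blast
    then show ?thesis by (rule valid_notion_truth)
  qed
  \<comment> \<open>The set of pairs that are not settled, because this side is Pi11 and hence
    reducible to \<open>H\<close>. The number 0 codes no pair and belongs to
    \<open>B w\<close>.\<close>
  define B where "B w = {u. \<forall>n c. u = cons_code n c \<longrightarrow> \<not> settled M n (list_decode c) w}" for w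
  have "S11 (\<lambda>S e. \<not> e 0 \<in> B w)" for w
  proof -
    define R where "R X n c \<longleftrightarrow> (\<forall>d a u. d \<noteq> 0 \<longrightarrow> fast_code X d \<longrightarrow> append_code c d a \<longrightarrow> u = cons_code n a \<longrightarrow>
      tm_computes M (list_decode u) w)" for X n c
    have nz: "d \<noteq> 0 \<longleftrightarrow> list_decode d \<noteq> []" for d
      by (metis list_decode.simps(1) list_decode_inverse list_encode.simps(1))
    have R: "R (graph f) n c \<longleftrightarrow> (\<forall>t. t \<noteq> [] \<longrightarrow> fast_list f t \<longrightarrow> tm_computes M (n # list_decode c @ t) w)" for f n c
      unfolding R_def append_code_def fast_code_graph nz by (auto, metis list_encode_inverse)
    have "S11 (\<lambda>S e. \<exists>f. e (Suc (Suc 0)) = cons_code (e (Suc 0)) (e 0) \<and> R (graph f) (e (Suc 0)) (e 0))"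
      unfolding R_def
      by (rule S11_ex_fun[of "\<lambda>S e X. e (Suc (Suc 0)) = cons_code (e (Suc 0)) (e 0) \<and> R X (e (Suc 0)) (e 0)",
            unfolded R_def])
         (intro D11_S11 D11_intros D11_append_code D11_fast_code D11_cons_code
            D11_tm_computes[OF M] is_term_intros)
    then have "S11 (\<lambda>S e. \<exists>n c f. e 0 = cons_code n c \<and> R (graph f) n c)"
      by (intro S11_ex)
    moreover have "(\<exists>n c f. u = cons_code n c \<and> R (graph f) n c) \<longleftrightarrow> \<not> u \<in> B w" for u
      unfolding B_def R settled_def by blast
    ultimately show ?thesis by simp
  qed
  then have "Pi11 (B w)" for w
    unfolding Pi11_in_Compl by (rule Sigma11_in_S11) simp
  then have "\<forall>w. \<exists>h N. wf_tm N \<and> (\<forall>u. tm_computes N [u] (h u)) \<and> (\<forall>u. u \<in> B w \<longleftrightarrow> h u \<in> H)"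
    using assms(1) unfolding is_hyperjump_of_0_def many_one_reducible_def tm_computable_def by metis
  then obtain h N where N: "\<And>w. wf_tm (N w)" "\<And>w u. tm_computes (N w) [u] (h w u)"
    and h: "\<And>w u. u \<in> B w \<longleftrightarrow> h w u \<in> H"
    by metis
  \<comment> \<open>The reduction enters formulas through the runs of the machine that computes
    it.\<close>
  have Dh: "D11 (\<lambda>S e. e 1 = h w (e 0))" for w
  proof -
    have "D11 (\<lambda>S e. \<exists>c. c = cons_code (e 0) 0 \<and> tm_computes (N w) (list_decode c) (e 1))"
      by (intro D11_intros D11_cons_code D11_tm_computes[OF N(1)] is_term_intros)
    moreover have "(\<exists>c. c = cons_code x 0 \<and> tm_computes (N w) (list_decode c) y) \<longleftrightarrow> y = h w x" for x y
      using N(2)[of w x] tm_computes_unique by auto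
    ultimately show ?thesis by simp
  qed
  \<comment> \<open>Here \<open>h w u \<in> H\<close> expresses that the list is not settled with
    value \<open>w\<close>. Replacing the Sigma11 condition by an oracle question leaves
    \<open>f\<close> as the only function quantifier.\<close>
  define R where "R w A X n \<longleftrightarrow> (\<forall>c u y. fast_code X c \<longrightarrow> u = cons_code n c \<longrightarrow> y = h w u \<longrightarrow> y \<in> A)"
    for w n and A X :: "nat set"
  have R: "R w H (graph f) n \<longleftrightarrow> (\<forall>s. \<not> (fast_list f s \<and> settled M n s w))" for w f n
  proof -
    have "h w (cons_code n c) \<in> H \<longleftrightarrow> \<not> settled M n (list_decode c) w" for c
      unfolding h[symmetric] by (auto simp: B_def)
    then have "R w H (graph f) n \<longleftrightarrow> (\<forall>c. fast_list f (list_decode c) \<longrightarrow> \<not> settled M n (list_decode c) w)"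
      unfolding R_def fast_code_graph by auto
    then show ?thesis by (metis list_encode_inverse)
  qed
  have "S11 (\<lambda>S e. \<exists>f. R w (S 0) (graph f) (e 0))" for w
    unfolding R_def
    by (rule S11_ex_fun[of "\<lambda>S e X. R w (S 0) X (e 0)", unfolded R_def])
       (intro D11_S11 D11_intros D11_fast_code D11_cons_code D11_inst2[OF Dh] is_term_intros)
  moreover have "(\<exists>f. R w H (graph f) n) \<longleftrightarrow> w \<noteq> of_bool (n \<in> P)" for n w
    using truth[of n w] unfolding R by blast
  ultimately show ?thesis
    by (intro Delta11_in_S11[of "\<lambda>w S e. \<exists>f. R w (S 0) (graph f) (e 0)"]) simp_all
qed

section \<open>Register programs on Turing machines\<close>

datatype basic = Inc nat | Dec nat | Head move

datatype test = NonZero nat | Sees "nat set"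

datatype cmd = Basic basic | Seq cmd cmd | While test cmd

text \<open>A state consists of the position of the head on the input tape, which is read-only, and of the
  contents of the registers.\<close>

type_synonym state = "int \<times> (nat \<Rightarrow> nat)"

fun apply_basic :: "basic \<Rightarrow> state \<Rightarrow> state" where
  "apply_basic (Inc r) (p, \<sigma>) = (p, \<sigma>(r := Suc (\<sigma> r)))"
| "apply_basic (Dec r) (p, \<sigma>) = (p, \<sigma>(r := \<sigma> r - 1))"
| "apply_basic (Head m) (p, \<sigma>) = (shift m p, \<sigma>)"

text \<open>A register value will be a head position, and a \<open>Dec\<close> at 0 would move the
  head to cell -1. So \<open>Dec\<close> may be executed on positive registers only.\<close>

fun enabled :: "basic \<Rightarrow> state \<Rightarrow> bool" where
  "enabled (Dec r) (p, \<sigma>) = (0 < \<sigma> r)"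
| "enabled _ _ = True"

fun holds :: "(int \<Rightarrow> nat) \<Rightarrow> test \<Rightarrow> state \<Rightarrow> bool" where
  "holds w (NonZero r) (p, \<sigma>) = (\<sigma> r \<noteq> 0)"
| "holds w (Sees A) (p, \<sigma>) = (w p \<in> A)"

inductive exec :: "(int \<Rightarrow> nat) \<Rightarrow> cmd \<Rightarrow> state \<Rightarrow> state \<Rightarrow> bool" for w where
  exec_Basic: "enabled b s \<Longrightarrow> s' = apply_basic b s \<Longrightarrow> exec w (Basic b) s s'"
| exec_Seq: "exec w c s s' \<Longrightarrow> exec w d s' s'' \<Longrightarrow> exec w (Seq c d) s s''"
| exec_While_stop: "\<not> holds w t s \<Longrightarrow> exec w (While t c) s s"
| exec_While_loop: "holds w t s \<Longrightarrow> exec w c s s' \<Longrightarrow> exec w (While t c) s' s'' \<Longrightarrow> exec w (While t c) s s''"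

datatype instr = Do basic | Branch test nat | Jump nat

text \<open>Addresses are absolute, with \<open>a\<close> the address of the first instruction. The
  exit of a loop skips its \<open>Branch\<close>, its body and its closing \<open>Jump\<close>,
  whence the 2.\<close>

fun compile :: "nat \<Rightarrow> cmd \<Rightarrow> instr list" where
  "compile a (Basic b) = [Do b]"
| "compile a (Seq c d) = compile a c @ compile (a + length (compile a c)) d"
| "compile a (While t c) =
    Branch t (a + length (compile (Suc a) c) + 2) # compile (Suc a) c @ [Jump a]"

fun instr_step :: "(int \<Rightarrow> nat) \<Rightarrow> instr \<Rightarrow> nat \<times> state \<Rightarrow> nat \<times> state" where
  "instr_step w (Do b) (pc, s) = (Suc pc, apply_basic b s)"
| "instr_step w (Branch t a) (pc, s) = (if holds w t s then Suc pc else a, s)"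
| "instr_step w (Jump a) (pc, s) = (a, s)"

definition code_step :: "(int \<Rightarrow> nat) \<Rightarrow> instr list \<Rightarrow> nat \<times> state \<Rightarrow> nat \<times> state \<Rightarrow> bool" where
  "code_step w P x y \<longleftrightarrow> fst x < length P \<and> (\<forall>b. P ! fst x = Do b \<longrightarrow> enabled b (snd x)) \<and>
     y = instr_step w (P ! fst x) x"

definition code_at :: "instr list \<Rightarrow> nat \<Rightarrow> instr list \<Rightarrow> bool" where
  "code_at P a Q \<longleftrightarrow> (\<exists>P1 P2. P = P1 @ Q @ P2 \<and> length P1 = a)"

lemma code_at_append: "code_at P a (Q @ R) \<longleftrightarrow> code_at P a Q \<and> code_at P (a + length Q) R"
proof
  assume "code_at P a (Q @ R)"
  then obtain P1 P2 where P: "P = P1 @ (Q @ R) @ P2" "length P1 = a"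
    unfolding code_at_def by blast
  then have "P = P1 @ Q @ (R @ P2)" "P = (P1 @ Q) @ R @ P2" "length (P1 @ Q) = a + length Q"
    by simp_all
  with P(2) show "code_at P a Q \<and> code_at P (a + length Q) R"
    unfolding code_at_def by blast
next
  assume "code_at P a Q \<and> code_at P (a + length Q) R"
  then obtain P1 P2 P3 P4 where P: "P = P1 @ Q @ P2" "length P1 = a"
      "P = P3 @ R @ P4" "length P3 = a + length Q"
    unfolding code_at_def by blast
  then have "(P1 @ Q) @ P2 = P3 @ (R @ P4)" "length (P1 @ Q) = length P3"
    by simp_all
  then have "P2 = R @ P4"
    by (meson append_eq_append_conv)
  with P show "code_at P a (Q @ R)"
    unfolding code_at_def by auto
qed

lemma code_at_nth: "code_at P a (i # Q) \<Longrightarrow> a < length P \<and> P ! a = i"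
  by (auto simp: code_at_def nth_append)

lemma exec_compile:
  assumes "exec w c s s'" and "code_at P a (compile a c)"
  shows "(code_step w P)\<^sup>*\<^sup>* (a, s) (a + length (compile a c), s')"
  using assms
proof (induction arbitrary: a)
  case (exec_Basic b s s')
  then have "code_step w P (a, s) (Suc a, s')"
    using code_at_nth[of P a "Do b" "[]"] by (simp add: code_step_def)
  then show ?case by auto
next
  case (exec_Seq c s s' d s'')
  have "(code_step w P)\<^sup>*\<^sup>* (a, s) (a + length (compile a c), s')"
    using exec_Seq by (simp add: code_at_append)
  moreover have "(code_step w P)\<^sup>*\<^sup>* (a + length (compile a c), s')
      (a + length (compile a c) + length (compile (a + length (compile a c)) d), s'')"
    using exec_Seq by (simp add: code_at_append)
  ultimately show ?case by (simp add: add.assoc)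
next
  case (exec_While_stop t s c)
  then have "code_step w P (a, s) (a + length (compile (Suc a) c) + 2, s)"
    using code_at_nth[of P a] by (simp add: code_step_def)
  then show ?case by auto
next
  case (exec_While_loop t s c s' s'')
  let ?n = "length (compile (Suc a) c)"
  have code: "code_at P a [Branch t (a + ?n + 2)]" "code_at P (Suc a) (compile (Suc a) c)"
      "code_at P (Suc a + ?n) [Jump a]"
    using exec_While_loop.prems
      code_at_append[of P a "[Branch t (a + ?n + 2)]" "compile (Suc a) c @ [Jump a]"]
      code_at_append[of P "Suc a" "compile (Suc a) c" "[Jump a]"]
    by simp_all
  have "code_step w P (a, s) (Suc a, s)"
    using code_at_nth[OF code(1)] exec_While_loop.hyps by (simp add: code_step_def)
  moreover have "(code_step w P)\<^sup>*\<^sup>* (Suc a, s) (Suc a + ?n, s')"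
    using exec_While_loop.IH(1)[OF code(2)] .
  moreover have "code_step w P (Suc a + ?n, s') (a, s')"
    using code_at_nth[OF code(3)] by (simp add: code_step_def)
  moreover have "(code_step w P)\<^sup>*\<^sup>* (a, s') (a + length (compile a (While t c)), s'')"
    using exec_While_loop.IH(2)[OF exec_While_loop.prems] .
  ultimately show ?case
    by (meson converse_rtranclp_into_rtranclp rtranclp_trans)
qed

fun basic_regs :: "basic \<Rightarrow> nat set" where
  "basic_regs (Inc r) = {r}"
| "basic_regs (Dec r) = {r}"
| "basic_regs (Head m) = {}"

fun test_regs :: "test \<Rightarrow> nat set" where
  "test_regs (NonZero r) = {r}"
| "test_regs (Sees A) = {}"

fun instr_regs :: "instr \<Rightarrow> nat set" where
  "instr_regs (Do b) = basic_regs b"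
| "instr_regs (Branch t a) = test_regs t"
| "instr_regs (Jump a) = {}"

lemma finite_instr_regs: "finite (instr_regs i)"
proof (cases i)
  case (Do b)
  then show ?thesis by (cases b) auto
next
  case (Branch t a)
  then show ?thesis by (cases t) auto
qed simp

fun targets :: "instr \<Rightarrow> nat set" where
  "targets (Do b) = {}"
| "targets (Branch t a) = {a}"
| "targets (Jump a) = {a}"

text \<open>The address just past the code is allowed; there the simulating machine writes its
  output.\<close>

lemma compile_targets: "i \<in> set (compile a c) \<Longrightarrow> x \<in> targets i \<Longrightarrow> x \<le> a + length (compile a c)"
proof (induction c arbitrary: a)
  case (Seq c d)
  then show ?case by fastforce
next
  case (While t c)
  then show ?case by fastforce
qed simp

text \<open>The tapes of the simulating machine: the input, one tape for each register, whose head
  position is the value of the register and whose only non-blank symbol is a 2 at cell 0, and the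
  output.\<close>

definition reg_tapes :: "(int \<Rightarrow> nat) \<Rightarrow> nat \<Rightarrow> nat \<Rightarrow> (int \<Rightarrow> nat) \<Rightarrow> state \<Rightarrow> tape list" where
  "reg_tapes w R m out s = map (\<lambda>i. if i = 0 then (w, fst s)
     else if i \<le> R then ((\<lambda>_. 0)(0 := m), int (snd s (i - 1))) else (out, 0)) [0..<R + 2]"

fun basic_move :: "basic \<Rightarrow> nat \<Rightarrow> move" where
  "basic_move (Inc r) i = (if i = Suc r then MoveRight else MoveStay)"
| "basic_move (Dec r) i = (if i = Suc r then MoveLeft else MoveStay)"
| "basic_move (Head m) i = (if i = 0 then m else MoveStay)"

fun test_symbols :: "nat list \<Rightarrow> test \<Rightarrow> bool" where
  "test_symbols syms (NonZero r) = (syms ! Suc r \<noteq> 2)"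
| "test_symbols syms (Sees A) = (syms ! 0 \<in> A)"

definition moves :: "nat \<Rightarrow> nat list \<Rightarrow> (nat \<Rightarrow> move) \<Rightarrow> (nat \<times> move) list" where
  "moves R syms d = map (\<lambda>i. (syms ! i, d i)) [0..<R + 2]"

text \<open>State 0 marks cell 0 of the register tapes, which makes zero recognizable. Instruction
  \<open>pc\<close> is executed in state \<open>pc + 1\<close>. State \<open>length P + 1\<close>
  writes the truth value of register 0 being nonzero, and its successor halts.\<close>

definition code_delta :: "instr list \<Rightarrow> nat \<Rightarrow> nat \<Rightarrow> nat list \<Rightarrow> (nat \<times> (nat \<times> move) list) option" where
  "code_delta P R q syms =
    (if q = 0 then Some (1, map (\<lambda>i. (if 1 \<le> i \<and> i \<le> R then 2 else syms ! i, MoveStay)) [0..<R + 2])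
     else if q \<le> length P then (case P ! (q - 1) of
         Do b \<Rightarrow> Some (Suc q, moves R syms (basic_move b))
       | Branch t a \<Rightarrow> Some (if test_symbols syms t then Suc q else Suc a, moves R syms (\<lambda>_. MoveStay))
       | Jump a \<Rightarrow> Some (Suc a, moves R syms (\<lambda>_. MoveStay)))
     else if q = Suc (length P) then Some (Suc q,
       map (\<lambda>i. (if i = Suc R \<and> syms ! 1 \<noteq> 2 then 1 else syms ! i, MoveStay)) [0..<R + 2])
     else None)"

definition code_tm :: "instr list \<Rightarrow> nat \<Rightarrow> tm" where
  "code_tm P R = \<lparr>num_states = length P + 3, num_symbols = 3, num_tapes = R + 2, delta = code_delta P R\<rparr>"

lemma wf_code_tm:
  assumes "\<And>i x. i \<in> set P \<Longrightarrow> x \<in> targets i \<Longrightarrow> x \<le> length P"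
  shows "wf_tm (code_tm P R)"
proof -
  have "q' < length P + 3 \<and> length acts = R + 2 \<and> fst ` set acts \<subseteq> {..<3}"
    if q: "q < length P + 3" and syms: "length syms = R + 2" "set syms \<subseteq> {..<3}"
      and delta: "code_delta P R q syms = Some (q', acts)" for q syms q' acts
  proof -
    have s: "syms ! i < 3" if "i < R + 2" for i
      using syms that nth_mem[of i syms] by (metis lessThan_iff subsetD)
    consider "q = 0" | "0 < q" "q \<le> length P" | "q = Suc (length P)" | "Suc (length P) < q"
      by linarith
    then show ?thesis
    proof cases
      case 2
      have "q - 1 < length P" using 2 by linarith
      then have "P ! (q - 1) \<in> set P" by simp
      then have t: "x \<le> length P" if "x \<in> targets (P ! (q - 1))" for x
        using that assms by blast
      show ?thesis
        using delta 2 t s by (cases "P ! (q - 1)") (auto simp: code_delta_def moves_def)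
    qed (use delta s in \<open>auto simp: code_delta_def\<close>)
  qed
  then show ?thesis
    by (auto simp: wf_tm_def code_tm_def)
qed

lemma scan_reg_tapes:
  assumes "i < R + 2"
  shows "map scan (reg_tapes w R m out s) ! i = (if i = 0 then w (fst s)
    else if i \<le> R then (if snd s (i - 1) = 0 then m else 0) else out 0)"
  using assms by (auto simp: reg_tapes_def scan_def simp del: upt_Suc)

lemma act_scan: "act t (scan t, d) = (fst t, shift d (snd t))"
  by (cases t) (simp add: scan_def)

lemma map2_act_moves:
  assumes "length ts = R + 2"
  shows "map2 act ts (moves R (map scan ts) d) = map (\<lambda>i. (fst (ts ! i), shift (d i) (snd (ts ! i)))) [0..<R + 2]"
  using assms by (intro nth_equalityI) (simp_all add: moves_def act_scan del: upt_Suc)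

lemma length_reg_tapes [simp]: "length (reg_tapes w R m out s) = R + 2"
  by (simp add: reg_tapes_def)

lemma nth_reg_tapes:
  assumes "i < R + 2"
  shows "reg_tapes w R m out s ! i = (if i = 0 then (w, fst s)
     else if i \<le> R then ((\<lambda>_. 0)(0 := m), int (snd s (i - 1))) else (out, 0))"
  using assms by (simp add: reg_tapes_def del: upt_Suc)

lemma reg_tapes_stay:
  "map2 act (reg_tapes w R m out s) (moves R (map scan (reg_tapes w R m out s)) (\<lambda>_. MoveStay)) = reg_tapes w R m out s"
  by (subst map2_act_moves) (auto intro!: nth_equalityI simp del: upt_Suc)

lemma reg_tapes_basic:
  assumes "basic_regs b \<subseteq> {..<R}" and "enabled b s"
  shows "map2 act (reg_tapes w R m out s) (moves R (map scan (reg_tapes w R m out s)) (basic_move b))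
    = reg_tapes w R m out (apply_basic b s)"
proof (subst map2_act_moves)
  show "map (\<lambda>i. (fst (reg_tapes w R m out s ! i), shift (basic_move b i) (snd (reg_tapes w R m out s ! i)))) [0..<R + 2]
      = reg_tapes w R m out (apply_basic b s)"
    using assms
    by (cases s; cases b)
       (auto intro!: nth_equalityI simp: nth_reg_tapes simp del: upt_Suc)
qed simp

lemma test_symbols_reg_tapes:
  assumes "test_regs t \<subseteq> {..<R}"
  shows "test_symbols (map scan (reg_tapes w R 2 out s)) t = holds w t s"
  using assms by (cases s; cases t) (auto simp: scan_reg_tapes simp del: nth_map)

lemma code_tm_step:
  assumes "code_step w P (pc, s) (pc', s')" and "\<And>i. i \<in> set P \<Longrightarrow> instr_regs i \<subseteq> {..<R}"
  shows "tm_step (code_tm P R) (Suc pc, reg_tapes w R 2 out s) (Suc pc', reg_tapes w R 2 out s')"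
proof -
  have pc: "pc < length P" and step: "(pc', s') = instr_step w (P ! pc) (pc, s)"
    and en: "\<And>b. P ! pc = Do b \<Longrightarrow> enabled b s"
    using assms(1) by (simp_all add: code_step_def)
  have regs: "instr_regs (P ! pc) \<subseteq> {..<R}"
    using assms(2) pc by simp
  show ?thesis
  proof (cases "P ! pc")
    case (Do b)
    then show ?thesis
      using pc step en regs
      by (auto simp: tm_step_def code_tm_def code_delta_def reg_tapes_basic)
  next
    case (Branch t a)
    then show ?thesis
      using pc step regs
      by (auto simp: tm_step_def code_tm_def code_delta_def reg_tapes_stay test_symbols_reg_tapes)
  next
    case (Jump a)
    then show ?thesis
      using pc step by (auto simp: tm_step_def code_tm_def code_delta_def reg_tapes_stay)
  qed
qed

lemma code_tm_steps:
  assumes "(code_step w P)\<^sup>*\<^sup>* x y" and "\<And>i. i \<in> set P \<Longrightarrow> instr_regs i \<subseteq> {..<R}"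
  shows "(tm_step (code_tm P R))\<^sup>*\<^sup>* (Suc (fst x), reg_tapes w R 2 out (snd x)) (Suc (fst y), reg_tapes w R 2 out (snd y))"
  using assms(1)
proof induction
  case (step y z)
  then have "tm_step (code_tm P R) (Suc (fst y), reg_tapes w R 2 out (snd y)) (Suc (fst z), reg_tapes w R 2 out (snd z))"
    using code_tm_step[of w P "fst y" "snd y" "fst z" "snd z"] assms(2) by simp
  with step.IH show ?case by simp
qed simp

theorem cmd_tm:
  "\<exists>M. wf_tm M \<and> (\<forall>xs p \<sigma>. exec (fst (word_tape (encode_input xs))) c (0, \<lambda>_. 0) (p, \<sigma>) \<longrightarrow>
     tm_computes M xs (of_bool (\<sigma> 0 \<noteq> 0)))"
proof -
  define P where "P = compile 0 c"
  have "finite (\<Union>i\<in>set P. instr_regs i)"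
    by (simp add: finite_instr_regs)
  then obtain R0 where R0: "\<And>r. r \<in> (\<Union>i\<in>set P. instr_regs i) \<Longrightarrow> r < R0"
    unfolding finite_nat_set_iff_bounded by blast
  \<comment> \<open>At least one register tape, because the output is taken from register 0 even
    when the program never mentions it.\<close>
  define R where "R = Suc R0"
  have R: "\<And>i. i \<in> set P \<Longrightarrow> instr_regs i \<subseteq> {..<R}" "0 < R"
    using R0 by (auto simp: R_def intro!: less_SucI)
  let ?M = "code_tm P R"
  have "wf_tm ?M"
    using compile_targets[of _ 0 c] by (intro wf_code_tm) (simp add: P_def)
  moreover have "tm_computes ?M xs (of_bool (\<sigma> 0 \<noteq> 0))"
    if ex: "exec (fst (word_tape (encode_input xs))) c (0, \<lambda>_. 0) (p, \<sigma>)" for xs p \<sigma>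
  proof -
    define w where "w = fst (word_tape (encode_input xs))"
    define out :: "int \<Rightarrow> nat" where "out = (\<lambda>_. 0)(0 := of_bool (\<sigma> 0 \<noteq> 0))"
    have zero: "(\<lambda>_. 0)(0 := 0) = (\<lambda>_ :: int. 0 :: nat)"
      by auto
    have mark: "(\<lambda>_. 0)(0 := 2, int k := 0) = (\<lambda>_ :: int. 0 :: nat)(0 := 2)" if "0 < k" for k
      using that by auto
    have "tm_init ?M xs = (0, reg_tapes w R 0 (\<lambda>_. 0) (0, \<lambda>_. 0))"
      by (auto simp: tm_init_def code_tm_def nth_reg_tapes nth_Cons' blank_tape_def w_def word_tape_def zero
          intro!: nth_equalityI)
    moreover have "tm_step ?M (0, reg_tapes w R 0 (\<lambda>_. 0) (0, \<lambda>_. 0)) (Suc 0, reg_tapes w R 2 (\<lambda>_. 0) (0, \<lambda>_. 0))"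
      unfolding tm_step_def
      by (simp add: code_tm_def code_delta_def del: upt_Suc)
         (auto intro!: nth_equalityI simp: nth_reg_tapes scan_def zero simp del: upt_Suc)
    moreover have "(code_step w P)\<^sup>*\<^sup>* (0, (0, \<lambda>_. 0)) (length P, (p, \<sigma>))"
      using exec_compile[OF ex, of P 0] by (auto simp: w_def P_def code_at_def)
    from code_tm_steps[OF this R(1), of "\<lambda>_. 0"]
    have "(tm_step ?M)\<^sup>*\<^sup>* (Suc 0, reg_tapes w R 2 (\<lambda>_. 0) (0, \<lambda>_. 0)) (Suc (length P), reg_tapes w R 2 (\<lambda>_. 0) (p, \<sigma>))"
      by simp
    moreover have "tm_step ?M (Suc (length P), reg_tapes w R 2 (\<lambda>_. 0) (p, \<sigma>))
        (Suc (Suc (length P)), reg_tapes w R 2 out (p, \<sigma>))"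
      unfolding tm_step_def using R(2)
      by (simp add: code_tm_def code_delta_def del: upt_Suc)
         (auto intro!: nth_equalityI simp: nth_reg_tapes scan_def out_def zero mark simp del: upt_Suc)
    ultimately have "(tm_step ?M)\<^sup>*\<^sup>* (tm_init ?M xs) (Suc (Suc (length P)), reg_tapes w R 2 out (p, \<sigma>))"
      by (metis converse_rtranclp_into_rtranclp rtranclp.rtrancl_into_rtrancl)
    moreover have "tm_halted ?M (Suc (Suc (length P)), reg_tapes w R 2 out (p, \<sigma>))"
      by (simp add: tm_halted_def code_tm_def code_delta_def)
    moreover have "last (reg_tapes w R 2 out (p, \<sigma>)) = (out, 0)"
      by (simp add: reg_tapes_def)
    then have "tape_output (last (reg_tapes w R 2 out (p, \<sigma>))) (of_bool (\<sigma> 0 \<noteq> 0))"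
      by (simp add: tape_output_def out_def)
    ultimately show ?thesis
      unfolding tm_computes_def by (metis snd_conv)
  qed
  ultimately show ?thesis by blast
qed

section \<open>Functions computed by register programs\<close>

lemma exec_move:
  assumes "r \<noteq> s"
  shows "exec w (While (NonZero r) (Seq (Basic (Dec r)) (Basic (Inc s)))) (p, \<sigma>) (p, \<sigma>(r := 0, s := \<sigma> s + \<sigma> r))"
proof (induction "\<sigma> r" arbitrary: \<sigma>)
  case 0
  then have eq: "\<sigma>(r := 0, s := \<sigma> s + \<sigma> r) = \<sigma>" by auto
  show ?case
    unfolding eq using 0 by (intro exec_While_stop) simp
next
  case (Suc n)
  let ?\<sigma> = "\<sigma>(r := n, s := Suc (\<sigma> s))"
  have "exec w (Seq (Basic (Dec r)) (Basic (Inc s))) (p, \<sigma>) (p, ?\<sigma>)"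
  proof (rule exec_Seq)
    show "exec w (Basic (Dec r)) (p, \<sigma>) (p, \<sigma>(r := n))"
      by (rule exec_Basic) (use Suc(2) in \<open>auto simp flip: Suc(2)\<close>)
    show "exec w (Basic (Inc s)) (p, \<sigma>(r := n)) (p, ?\<sigma>)"
      by (rule exec_Basic) (use assms in auto)
  qed
  moreover have "exec w (While (NonZero r) (Seq (Basic (Dec r)) (Basic (Inc s)))) (p, ?\<sigma>) (p, ?\<sigma>(r := 0, s := ?\<sigma> s + ?\<sigma> r))"
    using assms by (intro Suc(1)) simp
  moreover have "?\<sigma>(r := 0, s := ?\<sigma> s + ?\<sigma> r) = \<sigma>(r := 0, s := \<sigma> s + \<sigma> r)"
    using assms Suc(2) by auto
  ultimately show ?case
    using Suc(2) by (auto intro: exec_While_loop)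
qed

lemma exec_clear: "exec w (While (NonZero r) (Basic (Dec r))) (p, \<sigma>) (p, \<sigma>(r := 0))"
proof (induction "\<sigma> r" arbitrary: \<sigma>)
  case 0
  then have eq: "\<sigma>(r := 0) = \<sigma>" by auto
  show ?case
    unfolding eq using 0 by (intro exec_While_stop) simp
next
  case (Suc n)
  have "exec w (Basic (Dec r)) (p, \<sigma>) (p, \<sigma>(r := n))"
    by (rule exec_Basic) (use Suc(2) in \<open>auto simp flip: Suc(2)\<close>)
  moreover have "exec w (While (NonZero r) (Basic (Dec r))) (p, \<sigma>(r := n)) (p, (\<sigma>(r := n))(r := 0))"
    by (rule Suc(1)) simp
  ultimately show ?case
    using Suc(2) by (auto intro: exec_While_loop)
qed

lemma exec_copy:
  assumes "r \<noteq> s" "r \<noteq> t" "s \<noteq> t"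
  shows "exec w (While (NonZero r) (Seq (Basic (Dec r)) (Seq (Basic (Inc s)) (Basic (Inc t))))) (p, \<sigma>)
    (p, \<sigma>(r := 0, s := \<sigma> s + \<sigma> r, t := \<sigma> t + \<sigma> r))"
proof (induction "\<sigma> r" arbitrary: \<sigma>)
  case 0
  then have eq: "\<sigma>(r := 0, s := \<sigma> s + \<sigma> r, t := \<sigma> t + \<sigma> r) = \<sigma>" by auto
  show ?case
    unfolding eq using 0 by (intro exec_While_stop) simp
next
  case (Suc n)
  let ?\<sigma> = "\<sigma>(r := n, s := Suc (\<sigma> s), t := Suc (\<sigma> t))"
  have "exec w (Basic (Dec r)) (p, \<sigma>) (p, \<sigma>(r := n))"
    by (rule exec_Basic) (use Suc(2) in \<open>auto simp flip: Suc(2)\<close>)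
  moreover have "exec w (Basic (Inc s)) (p, \<sigma>(r := n)) (p, \<sigma>(r := n, s := Suc (\<sigma> s)))"
    by (rule exec_Basic) (use assms in auto)
  moreover have "exec w (Basic (Inc t)) (p, \<sigma>(r := n, s := Suc (\<sigma> s))) (p, ?\<sigma>)"
    by (rule exec_Basic) (use assms in auto)
  ultimately have "exec w (Seq (Basic (Dec r)) (Seq (Basic (Inc s)) (Basic (Inc t)))) (p, \<sigma>) (p, ?\<sigma>)"
    by (blast intro: exec_Seq)
  moreover have "exec w (While (NonZero r) (Seq (Basic (Dec r)) (Seq (Basic (Inc s)) (Basic (Inc t))))) (p, ?\<sigma>)
      (p, ?\<sigma>(r := 0, s := ?\<sigma> s + ?\<sigma> r, t := ?\<sigma> t + ?\<sigma> r))"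
    using assms by (intro Suc(1)) simp
  moreover have "?\<sigma>(r := 0, s := ?\<sigma> s + ?\<sigma> r, t := ?\<sigma> t + ?\<sigma> r)
      = \<sigma>(r := 0, s := \<sigma> s + \<sigma> r, t := \<sigma> t + \<sigma> r)"
    using assms Suc(2) by auto
  ultimately show ?case
    using Suc(2) by (auto intro: exec_While_loop)
qed

text \<open>\<open>L\<close> assigns to each variable the register which holds it. All registers from \<open>b\<close> on are free
  and are zero before and, apart from the result in \<open>b\<close>, after the computation.\<close>

definition realizes :: "((nat \<Rightarrow> nat) \<Rightarrow> nat) \<Rightarrow> (nat \<Rightarrow> nat) \<Rightarrow> nat \<Rightarrow> cmd \<Rightarrow> bool" where
  "realizes F L b c \<longleftrightarrow> (\<forall>w p \<sigma>. (\<forall>r\<ge>b. \<sigma> r = 0) \<longrightarrow>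
     exec w c (p, \<sigma>) (p, \<sigma>(b := F (\<lambda>i. \<sigma> (L i)))))"

text \<open>Programs exist for every placement of the variables below any \<open>b\<close>; a
  subprogram can therefore be run on top of registers already in use.\<close>

definition computable :: "((nat \<Rightarrow> nat) \<Rightarrow> nat) \<Rightarrow> bool" where
  "computable F \<longleftrightarrow> (\<forall>L b. (\<forall>i. L i < b) \<longrightarrow> (\<exists>c. realizes F L b c))"

lemma realizes_exec:
  assumes "realizes F L b c" and "\<And>r. b \<le> r \<Longrightarrow> \<sigma> r = 0"
  shows "exec w c (p, \<sigma>) (p, \<sigma>(b := F (\<lambda>i. \<sigma> (L i))))"
  using assms unfolding realizes_def by simp

lemma computable_E:
  assumes "computable F" and "\<And>i. L i < b"
  obtains c where "realizes F L b c"
proof -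
  have "\<exists>c. realizes F L b c"
    using assms unfolding computable_def by simp
  then show ?thesis by (elim exE) (rule that)
qed

lemma computable_I:
  assumes "\<And>L b. (\<And>i. L i < b) \<Longrightarrow> \<exists>c. \<forall>w p \<sigma>. (\<forall>r\<ge>b. \<sigma> r = 0) \<longrightarrow>
     exec w c (p, \<sigma>) (p, \<sigma>(b := F (\<lambda>i. \<sigma> (L i))))"
  shows "computable F"
  using assms unfolding computable_def realizes_def by simp

lemma computable_var: "computable (\<lambda>e. e x)"
proof (rule computable_I)
  fix L :: "nat \<Rightarrow> nat" and b
  assume "\<And>i. L i < b"
  then have L: "L x < b" by simp
  \<comment> \<open>Moving a value empties its source. So it is moved to \<open>b\<close> and to the
    scratch register \<open>Suc b\<close> together, and \<open>?d\<close> restores the source from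
    the latter.\<close>
  let ?c = "While (NonZero (L x)) (Seq (Basic (Dec (L x))) (Seq (Basic (Inc b)) (Basic (Inc (Suc b)))))"
  let ?d = "While (NonZero (Suc b)) (Seq (Basic (Dec (Suc b))) (Basic (Inc (L x))))"
  have "exec w (Seq ?c ?d) (p, \<sigma>) (p, \<sigma>(b := \<sigma> (L x)))" if "\<forall>r\<ge>b. \<sigma> r = 0" for w p \<sigma>
  proof -
    have z: "\<sigma> b = 0" "\<sigma> (Suc b) = 0" using that by simp_all
    let ?\<sigma> = "\<sigma>(L x := 0, b := \<sigma> b + \<sigma> (L x), Suc b := \<sigma> (Suc b) + \<sigma> (L x))"
    have "exec w ?c (p, \<sigma>) (p, ?\<sigma>)"
      using L by (intro exec_copy) auto
    moreover have "exec w ?d (p, ?\<sigma>) (p, ?\<sigma>(Suc b := 0, L x := ?\<sigma> (L x) + ?\<sigma> (Suc b)))"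
      using L by (intro exec_move) auto
    moreover have "?\<sigma>(Suc b := 0, L x := ?\<sigma> (L x) + ?\<sigma> (Suc b)) = \<sigma>(b := \<sigma> (L x))"
      using L z by auto
    ultimately show ?thesis by (metis exec_Seq)
  qed
  then show "\<exists>c. \<forall>w p \<sigma>. (\<forall>r\<ge>b. \<sigma> r = 0) \<longrightarrow> exec w c (p, \<sigma>) (p, \<sigma>(b := \<sigma> (L x)))"
    by blast
qed

lemma computable_zero: "computable (\<lambda>e. 0)"
proof (rule computable_I)
  fix L :: "nat \<Rightarrow> nat" and b
  have "exec w (Basic (Head MoveStay)) (p, \<sigma>) (p, \<sigma>(b := 0))" if "\<forall>r\<ge>b. \<sigma> r = 0" for w p \<sigma>
    by (rule exec_Basic) (use that in auto)
  then show "\<exists>c. \<forall>w p \<sigma>. (\<forall>r\<ge>b. \<sigma> r = 0) \<longrightarrow> exec w c (p, \<sigma>) (p, \<sigma>(b := 0))"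
    by blast
qed

lemma computable_Suc:
  assumes "computable F"
  shows "computable (\<lambda>e. Suc (F e))"
proof (rule computable_I)
  fix L :: "nat \<Rightarrow> nat" and b
  assume L: "\<And>i. L i < b"
  obtain c where "realizes F L b c"
    by (rule computable_E[of F L b, OF assms L])
  note c = realizes_exec[OF this]
  have "exec w (Seq c (Basic (Inc b))) (p, \<sigma>) (p, \<sigma>(b := Suc (F (\<lambda>i. \<sigma> (L i)))))"
    if "\<forall>r\<ge>b. \<sigma> r = 0" for w p \<sigma>
    by (rule exec_Seq[OF c exec_Basic]) (use that in auto)
  then show "\<exists>c. \<forall>w p \<sigma>. (\<forall>r\<ge>b. \<sigma> r = 0) \<longrightarrow> exec w c (p, \<sigma>) (p, \<sigma>(b := Suc (F (\<lambda>i. \<sigma> (L i)))))"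
    by blast
qed

lemma computable_let:
  assumes "computable G" and "computable F"
  shows "computable (\<lambda>e. G (scons (F e) e))"
proof (rule computable_I)
  fix L :: "nat \<Rightarrow> nat" and b
  assume L: "\<And>i. L i < b"
  obtain c where "realizes F L b c"
    by (rule computable_E[of F L b, OF assms(2) L])
  note c = realizes_exec[OF this]
  have "scons b L i < Suc b" for i
    using L by (cases i) (simp_all add: less_SucI)
  then obtain d where "realizes G (scons b L) (Suc b) d"
    by (rule computable_E[of G "scons b L" "Suc b", OF assms(1)])
  note d = realizes_exec[OF this]
  let ?clear = "While (NonZero b) (Basic (Dec b))"
  let ?move = "While (NonZero (Suc b)) (Seq (Basic (Dec (Suc b))) (Basic (Inc b)))"
  have "exec w (Seq c (Seq d (Seq ?clear ?move))) (p, \<sigma>)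
      (p, \<sigma>(b := G (scons (F (\<lambda>i. \<sigma> (L i))) (\<lambda>i. \<sigma> (L i)))))"
    if "\<forall>r\<ge>b. \<sigma> r = 0" for w p \<sigma>
  proof -
    define u where "u = F (\<lambda>i. \<sigma> (L i))"
    define v where "v = G (scons u (\<lambda>i. \<sigma> (L i)))"
    have ne: "L i \<noteq> b" for i using L[of i] by simp
    have "(\<lambda>i. (\<sigma>(b := u)) (scons b L i)) = scons u (\<lambda>i. \<sigma> (L i))"
      using ne by (auto simp: scons_def split: nat.split)
    then have v: "v = G (\<lambda>i. (\<sigma>(b := u)) (scons b L i))" by (simp add: v_def)
    have "exec w c (p, \<sigma>) (p, \<sigma>(b := u))"
      unfolding u_def by (rule c) (use that in simp)
    moreover have "exec w d (p, \<sigma>(b := u)) (p, \<sigma>(b := u, Suc b := v))"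
      unfolding v by (rule d) (use that in simp)
    moreover have "exec w ?clear (p, \<sigma>(b := u, Suc b := v)) (p, \<sigma>(b := u, Suc b := v, b := 0))"
      by (rule exec_clear)
    moreover have "exec w ?move (p, \<sigma>(b := u, Suc b := v, b := 0)) (p, \<sigma>(b := v))"
    proof -
      let ?\<sigma> = "\<sigma>(b := u, Suc b := v, b := 0)"
      have "?\<sigma>(Suc b := 0, b := ?\<sigma> b + ?\<sigma> (Suc b)) = \<sigma>(b := v)"
        using that by auto
      then show ?thesis
        using exec_move[of "Suc b" b w p ?\<sigma>] by simp
    qed
    ultimately have "exec w (Seq c (Seq d (Seq ?clear ?move))) (p, \<sigma>) (p, \<sigma>(b := v))"
      by (intro exec_Seq)
    then show ?thesis by (simp add: v_def u_def)
  qed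
  then show "\<exists>c. \<forall>w p \<sigma>. (\<forall>r\<ge>b. \<sigma> r = 0) \<longrightarrow>
      exec w c (p, \<sigma>) (p, \<sigma>(b := G (scons (F (\<lambda>i. \<sigma> (L i))) (\<lambda>i. \<sigma> (L i)))))"
    by blast
qed

lemma computable_ren:
  assumes "computable F"
  shows "computable (\<lambda>e. F (\<lambda>i. e (\<rho> i)))"
proof (rule computable_I)
  fix L :: "nat \<Rightarrow> nat" and b
  assume L: "\<And>i. L i < b"
  obtain c where "realizes F (\<lambda>i. L (\<rho> i)) b c"
    by (rule computable_E[of F "\<lambda>i. L (\<rho> i)" b, OF assms L])
  then show "\<exists>c. \<forall>w p \<sigma>. (\<forall>r\<ge>b. \<sigma> r = 0) \<longrightarrow> exec w c (p, \<sigma>) (p, \<sigma>(b := F (\<lambda>i. \<sigma> (L (\<rho> i)))))"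
    unfolding realizes_def by (rule exI)
qed

lemma computable_rec:
  assumes A: "computable A" and N: "computable N" and B: "computable (\<lambda>e. B (\<lambda>j. e (Suc (Suc j))) (e 1) (e 0))"
  shows "computable (\<lambda>e. rec_nat (A e) (\<lambda>i y. B e i y) (N e))"
proof (rule computable_I)
  fix L :: "nat \<Rightarrow> nat" and b
  assume L: "\<And>i. L i < b"
  obtain ca where "realizes A L b ca"
    by (rule computable_E[of A L b, OF A L])
  note ca = realizes_exec[OF this]
  have "L i < b + 2" for i using L[of i] by simp
  then obtain cn where "realizes N L (b + 2) cn"
    by (rule computable_E[of N L "b + 2", OF N])
  note cn = realizes_exec[OF this]
  \<comment> \<open>Register \<open>b\<close> holds the current value, \<open>b + 1\<close> the
    index of the round and \<open>b + 2\<close> the number of rounds left; the body works from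
    \<open>b + 3\<close> on.\<close>
  define L' where "L' = scons b (scons (b + 1) L)"
  have "L' i < b + 3" for i
  proof (cases i)
    case (Suc j)
    then show ?thesis using L[of "j - 1"] by (cases j) (simp_all add: L'_def)
  qed (simp add: L'_def)
  then obtain cb where "realizes (\<lambda>e. B (\<lambda>j. e (Suc (Suc j))) (e 1) (e 0)) L' (b + 3) cb"
    by (rule computable_E[of "\<lambda>e. B (\<lambda>j. e (Suc (Suc j))) (e 1) (e 0)" L' "b + 3", OF B])
  note cb = realizes_exec[OF this]
  let ?clear = "\<lambda>r. While (NonZero r) (Basic (Dec r))"
  let ?move = "While (NonZero (b + 3)) (Seq (Basic (Dec (b + 3))) (Basic (Inc b)))"
  let ?body = "Seq (Basic (Dec (b + 2))) (Seq cb (Seq (?clear b) (Seq ?move (Basic (Inc (b + 1))))))"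
  let ?loop = "While (NonZero (b + 2)) ?body"
  have "exec w (Seq ca (Seq cn (Seq ?loop (?clear (b + 1))))) (p, \<sigma>)
      (p, \<sigma>(b := rec_nat (A (\<lambda>i. \<sigma> (L i))) (\<lambda>i y. B (\<lambda>i. \<sigma> (L i)) i y) (N (\<lambda>i. \<sigma> (L i)))))"
    if z: "\<forall>r\<ge>b. \<sigma> r = 0" for w p \<sigma>
  proof -
    define e where "e = (\<lambda>i. \<sigma> (L i))"
    define R where "R = rec_nat (A e) (\<lambda>i y. B e i y)"
    define st where "st i n = \<sigma>(b := R i, b + 1 := i, b + 2 := n)" for i n
    have ne: "L i \<noteq> b" "L i \<noteq> Suc b" "L i \<noteq> Suc (Suc b)" for i using L[of i] by simp_all
    have body: "exec w ?body (p, st i (Suc n)) (p, st (Suc i) n)" for i n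
    proof -
      have "exec w (Basic (Dec (b + 2))) (p, st i (Suc n)) (p, st i n)"
        by (rule exec_Basic) (auto simp: st_def)
      moreover have "exec w cb (p, st i n) (p, (st i n)(b + 3 := R (Suc i)))"
      proof -
        have "(\<lambda>j. st i n (L' (Suc (Suc j)))) = e" "st i n (L' 1) = i" "st i n (L' 0) = R i"
          using ne by (auto simp: st_def L'_def e_def)
        then show ?thesis
          using cb[of "st i n" w p] z by (simp add: R_def st_def)
      qed
      moreover have "exec w (?clear b) (p, (st i n)(b + 3 := R (Suc i))) (p, (st i n)(b + 3 := R (Suc i), b := 0))"
        by (rule exec_clear)
      moreover have "exec w ?move (p, (st i n)(b + 3 := R (Suc i), b := 0)) (p, (st i n)(b := R (Suc i)))"
      proof -
        let ?\<sigma> = "(st i n)(b + 3 := R (Suc i), b := 0)"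
        have "?\<sigma>(b + 3 := 0, b := ?\<sigma> b + ?\<sigma> (b + 3)) = (st i n)(b := R (Suc i))"
          using z by (auto simp: st_def)
        then show ?thesis
          using exec_move[of "b + 3" b w p ?\<sigma>] by simp
      qed
      moreover have "exec w (Basic (Inc (b + 1))) (p, (st i n)(b := R (Suc i))) (p, st (Suc i) n)"
        by (rule exec_Basic) (auto simp: st_def)
      ultimately show ?thesis
        by (intro exec_Seq)
    qed
    have loop: "exec w ?loop (p, st i n) (p, st (i + n) 0)" for i n
    proof (induction n arbitrary: i)
      case 0
      then show ?case by (auto intro!: exec_While_stop simp: st_def)
    next
      case (Suc n)
      have rest: "exec w ?loop (p, st (Suc i) n) (p, st (i + Suc n) 0)"
        using Suc[of "Suc i"] by simp
      show ?case
        by (rule exec_While_loop[OF _ body rest]) (simp add: st_def)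
    qed
    have "exec w ca (p, \<sigma>) (p, \<sigma>(b := R 0))"
      using ca[of \<sigma> w p] z by (simp add: R_def e_def)
    moreover have "exec w cn (p, \<sigma>(b := R 0)) (p, st 0 (N e))"
    proof -
      have "(\<lambda>i. (\<sigma>(b := R 0)) (L i)) = e"
        using ne by (auto simp: e_def)
      moreover have "\<sigma>(b := R 0, b + 2 := n) = st 0 n" for n
        using z by (auto simp: st_def)
      ultimately show ?thesis
        using cn[of "\<sigma>(b := R 0)" w p] z by simp
    qed
    moreover have "exec w ?loop (p, st 0 (N e)) (p, st (N e) 0)"
      using loop[of 0 "N e"] by simp
    moreover have "exec w (?clear (b + 1)) (p, st (N e) 0) (p, \<sigma>(b := R (N e)))"
    proof -
      have "(st (N e) 0)(b + 1 := 0) = \<sigma>(b := R (N e))"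
        using z by (auto simp: st_def)
      then show ?thesis
        using exec_clear[of w "b + 1" p "st (N e) 0"] by simp
    qed
    ultimately have "exec w (Seq ca (Seq cn (Seq ?loop (?clear (b + 1))))) (p, \<sigma>) (p, \<sigma>(b := R (N e)))"
      by (intro exec_Seq)
    then show ?thesis by (simp add: R_def e_def)
  qed
  then show "\<exists>c. \<forall>w p \<sigma>. (\<forall>r\<ge>b. \<sigma> r = 0) \<longrightarrow> exec w c (p, \<sigma>)
      (p, \<sigma>(b := rec_nat (A (\<lambda>i. \<sigma> (L i))) (\<lambda>i y. B (\<lambda>i. \<sigma> (L i)) i y) (N (\<lambda>i. \<sigma> (L i)))))"
    by blast
qed

lemma computable_const: "computable (\<lambda>e. k)"
  by (induction k) (simp_all add: computable_zero computable_Suc)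

lemma computable_comp1:
  assumes "computable (\<lambda>e. g (e 0))" "computable F"
  shows "computable (\<lambda>e. g (F e))"
  using computable_let[OF assms] by simp

lemma computable_comp2:
  assumes "computable (\<lambda>e. g (e 0) (e 1))" "computable F" "computable G"
  shows "computable (\<lambda>e. g (F e) (G e))"
proof -
  have "computable (\<lambda>e. F (\<lambda>i. e (Suc i)))"
    by (rule computable_ren[OF assms(2)])
  then have "computable (\<lambda>e. g (F (\<lambda>i. e (Suc i))) (e 0))"
    using computable_let[OF computable_ren[OF assms(1), of "\<lambda>i. if i = 0 then 0 else 1"], of "\<lambda>e. F (\<lambda>i. e (Suc i))"] by simp
  from computable_let[OF this assms(3)] show ?thesis by simp
qed

lemma computable_add: "computable F \<Longrightarrow> computable G \<Longrightarrow> computable (\<lambda>e. F e + G e)"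
proof (rule computable_comp2[of "(+)"])
  have "rec_nat m (\<lambda>i y. Suc y) n = m + n" for m n by (induction n) auto
  then show "computable (\<lambda>e. e 0 + e 1)"
    using computable_rec[of "\<lambda>e. e 0" "\<lambda>e. e 1" "\<lambda>e i y. Suc y", OF computable_var computable_var computable_Suc[OF computable_var]] by simp
qed

lemma computable_mult: "computable F \<Longrightarrow> computable G \<Longrightarrow> computable (\<lambda>e. F e * G e)"
proof (rule computable_comp2[of "(*)"])
  have "rec_nat 0 (\<lambda>i y. y + m) n = m * n" for m n :: nat by (induction n) auto
  then show "computable (\<lambda>e. e 0 * e 1)"
    using computable_rec[of "\<lambda>e. 0" "\<lambda>e. e 1" "\<lambda>e i y. y + e 0", OF computable_zero computable_var computable_add[OF computable_var computable_var]] by simp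
qed

lemma computable_diff: "computable F \<Longrightarrow> computable G \<Longrightarrow> computable (\<lambda>e. F e - G e)"
proof (rule computable_comp2[of "(-)"])
  have "rec_nat 0 (\<lambda>i y. i) n = n - 1" for n :: nat by (induction n) auto
  then have "computable (\<lambda>e. e 0 - 1)"
    using computable_rec[of "\<lambda>e. 0" "\<lambda>e. e 0" "\<lambda>e i y. i", OF computable_zero computable_var computable_var] by simp
  then have pred: "computable (\<lambda>e. e 0 - 1)" .
  have "rec_nat m (\<lambda>i y. y - 1) n = m - n" for m n :: nat by (induction n) auto
  then show "computable (\<lambda>e. e 0 - e 1)"
    using computable_rec[of "\<lambda>e. e 0" "\<lambda>e. e 1" "\<lambda>e i y. y - 1", OF computable_var computable_var computable_comp1[of "\<lambda>x. x - 1", OF pred computable_var]]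
    by simp
qed

lemma computable_max:
  assumes "computable F" "computable G"
  shows "computable (\<lambda>e. max (F e) (G e))"
proof -
  have "max m n = m + (n - m)" for m n :: nat by simp
  then show ?thesis
    by (simp only:) (intro computable_add computable_diff assms)
qed

section \<open>Decidable relations, bounded quantifiers and coded lists\<close>

definition decidable :: "((nat \<Rightarrow> nat) \<Rightarrow> bool) \<Rightarrow> bool" where
  "decidable \<phi> \<longleftrightarrow> computable (\<lambda>e. of_bool (\<phi> e))"

lemma decidable_cong:
  assumes "decidable \<phi>" "\<And>e. \<phi> e = \<psi> e"
  shows "decidable \<psi>"
proof -
  have "\<phi> = \<psi>" by (rule ext) (rule assms(2))
  with assms(1) show ?thesis by simp
qed

lemma decidable_ren: "decidable \<phi> \<Longrightarrow> decidable (\<lambda>e. \<phi> (\<lambda>i. e (\<rho> i)))"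
  unfolding decidable_def by (rule computable_ren)

lemma decidable_let: "decidable \<phi> \<Longrightarrow> computable F \<Longrightarrow> decidable (\<lambda>e. \<phi> (scons (F e) e))"
  unfolding decidable_def by (rule computable_let)

lemma decidable_const: "decidable (\<lambda>e. b)"
  unfolding decidable_def by (rule computable_const)

lemma decidable_not:
  assumes "decidable \<phi>"
  shows "decidable (\<lambda>e. \<not> \<phi> e)"
proof -
  have "computable (\<lambda>e. 1 - of_bool (\<phi> e))"
    using assms unfolding decidable_def by (intro computable_diff computable_const)
  moreover have "of_bool (\<not> b) = (1 :: nat) - of_bool b" for b by simp
  ultimately show ?thesis unfolding decidable_def by (simp only:)
qed

lemma decidable_and:
  assumes "decidable \<phi>" "decidable \<psi>"
  shows "decidable (\<lambda>e. \<phi> e \<and> \<psi> e)"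
  using computable_mult[OF assms[unfolded decidable_def]] unfolding decidable_def of_bool_conj .

lemma decidable_or:
  assumes "decidable \<phi>" "decidable \<psi>"
  shows "decidable (\<lambda>e. \<phi> e \<or> \<psi> e)"
  by (rule decidable_cong[OF decidable_not[OF decidable_and[OF decidable_not[OF assms(1)] decidable_not[OF assms(2)]]]]) simp

lemma decidable_imp:
  assumes "decidable \<phi>" "decidable \<psi>"
  shows "decidable (\<lambda>e. \<phi> e \<longrightarrow> \<psi> e)"
  unfolding imp_conv_disj by (intro decidable_or decidable_not assms)

lemma decidable_less:
  assumes "computable F" "computable G"
  shows "decidable (\<lambda>e. F e < G e)"
proof -
  have "computable (\<lambda>e. 1 - (1 - (G e - F e)))"
    by (intro computable_diff computable_const assms)
  moreover have "of_bool (m < n) = 1 - (1 - (n - m))" for m n :: nat by auto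
  ultimately show ?thesis unfolding decidable_def by (simp only:)
qed

lemma decidable_le:
  assumes "computable F" "computable G"
  shows "decidable (\<lambda>e. F e \<le> G e)"
  unfolding not_less[symmetric] by (intro decidable_not decidable_less assms)

lemma decidable_eq:
  assumes "computable F" "computable G"
  shows "decidable (\<lambda>e. F e = G e)"
  unfolding order_eq_iff by (intro decidable_and decidable_le assms)

lemma decidable_ball:
  assumes "decidable (\<lambda>e. \<phi> (\<lambda>i. e (Suc i)) (e 0))" "computable N"
  shows "decidable (\<lambda>e. \<forall>k<N e. \<phi> e k)"
proof -
  have "computable (\<lambda>e. e 0 * of_bool (\<phi> (\<lambda>i. e (Suc (Suc i))) (e 1)))"
    using decidable_ren[OF assms(1), of Suc] unfolding decidable_def by (intro computable_mult computable_var) simp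
  then have "computable (\<lambda>e. rec_nat 1 (\<lambda>i y. y * of_bool (\<phi> e i)) (N e))"
    by (rule computable_rec[of "\<lambda>e. 1" N "\<lambda>e i y. y * of_bool (\<phi> e i)", OF computable_const assms(2)])
  moreover have "of_bool (\<forall>k<n. \<psi> k) = (rec_nat 1 (\<lambda>i y. y * of_bool (\<psi> i)) n :: nat)"
    for n and \<psi> :: "nat \<Rightarrow> bool"
  proof (induction n)
    case (Suc n)
    have "(\<forall>k<Suc n. \<psi> k) \<longleftrightarrow> (\<forall>k<n. \<psi> k) \<and> \<psi> n"
      by (auto simp: less_Suc_eq)
    then show ?case by (simp only: of_bool_conj Suc.IH nat.rec)
  qed simp
  ultimately show ?thesis unfolding decidable_def by (simp only:)
qed

lemma decidable_bex:
  assumes "decidable (\<lambda>e. \<phi> (\<lambda>i. e (Suc i)) (e 0))" "computable N"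
  shows "decidable (\<lambda>e. \<exists>k<N e. \<phi> e k)"
  by (rule decidable_cong[OF decidable_not[OF decidable_ball[of "\<lambda>e k. \<not> \<phi> e k" N, OF decidable_not[OF assms(1)] assms(2)]]]) simp

lemma decidable_bex_le:
  assumes "decidable (\<lambda>e. \<phi> (\<lambda>i. e (Suc i)) (e 0))" "computable N"
  shows "decidable (\<lambda>e. \<exists>k\<le>N e. \<phi> e k)"
  unfolding less_Suc_eq_le[symmetric] by (intro decidable_bex computable_Suc assms)

lemma computable_sum:
  assumes "computable (\<lambda>e. F (\<lambda>i. e (Suc i)) (e 0))" "computable N"
  shows "computable (\<lambda>e. \<Sum>k<N e. F e k)"
proof -
  have "computable (\<lambda>e. e 0 + F (\<lambda>i. e (Suc (Suc i))) (e 1))"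
    using computable_ren[OF assms(1), of Suc] by (intro computable_add computable_var) simp
  then have "computable (\<lambda>e. rec_nat 0 (\<lambda>i y. y + F e i) (N e))"
    by (rule computable_rec[of "\<lambda>e. 0" N "\<lambda>e i y. y + F e i", OF computable_const assms(2)])
  moreover have "(\<Sum>k<n. f k) = rec_nat 0 (\<lambda>i y. y + f i) n" for n and f :: "nat \<Rightarrow> nat"
    by (induction n) auto
  ultimately show ?thesis by (simp only:)
qed

lemma computable_prod_encode:
  assumes "computable F" "computable G"
  shows "computable (\<lambda>e. prod_encode (F e, G e))"
proof -
  have "triangle n = (\<Sum>k<Suc n. k)" for n
    by (induction n) auto
  then have "prod_encode (m, n) = (\<Sum>k<Suc (m + n). k) + m" for m n
    by (simp add: prod_encode_def)
  then show ?thesis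
    by (simp only:) (intro computable_add computable_sum computable_Suc computable_var assms)
qed

lemma computable_cons_code:
  assumes "computable F" "computable G"
  shows "computable (\<lambda>e. cons_code (F e) (G e))"
  unfolding cons_code_def by (intro computable_Suc computable_prod_encode assms)

lemma cons_code_gt: "x < cons_code x c" "c < cons_code x c"
  using le_prod_encode_1[of x c] le_prod_encode_2[of c x] by (simp_all add: cons_code_def)

text \<open>Bounded search as a sum with at most one nonzero term, bounded sums being available from
  primitive recursion. Head and tail of a code are smaller than the code, so the bounds
  suffice.\<close>

definition hd_code :: "nat \<Rightarrow> nat" where
  "hd_code c = (\<Sum>x<c. x * of_bool (\<exists>d<c. c = cons_code x d))"

lemma hd_code_cons [simp]: "hd_code (cons_code x c) = x"
proof -
  let ?c = "cons_code x c"
  have "y * of_bool (\<exists>d<?c. ?c = cons_code y d) = (if y = x then x else 0)" for y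
    using cons_code_gt(2)[of c x] by auto
  then show ?thesis
    using cons_code_gt(1)[of x c] by (simp add: hd_code_def)
qed

lemma tl_code_0 [simp]: "tl_code 0 = 0"
  by (simp add: tl_code_def)

lemma tl_code_cons [simp]: "tl_code (cons_code x c) = c"
  by (simp add: tl_code_def)

lemma tl_code_sum: "tl_code c = (\<Sum>d<c. d * of_bool (\<exists>x<c. c = cons_code x d))"
proof (cases c rule: code_cases)
  case 1
  then show ?thesis by simp
next
  case (2 b)
  have "d * of_bool (\<exists>x<c. c = cons_code x d) = (if d = b then b else 0)" for d
    using cons_code_gt(1)[of 0 b] 2 by auto
  then show ?thesis
    using cons_code_gt(2)[of b 0] 2 by simp
next
  case (3 y b)
  have "d * of_bool (\<exists>x<c. c = cons_code x d) = (if d = b then b else 0)" for d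
    using cons_code_gt(1)[of "Suc y" b] 3 by auto
  then show ?thesis
    using cons_code_gt(2)[of b "Suc y"] 3 by simp
qed

lemma computable_hd_code:
  assumes "computable F"
  shows "computable (\<lambda>e. hd_code (F e))"
proof (rule computable_comp1[OF _ assms])
  show "computable (\<lambda>e. hd_code (e 0))"
    unfolding hd_code_def
    by (intro computable_sum computable_mult computable_var decidable_bex[unfolded decidable_def] decidable_eq[unfolded decidable_def] computable_cons_code)
qed

lemma computable_tl_code:
  assumes "computable F"
  shows "computable (\<lambda>e. tl_code (F e))"
proof (rule computable_comp1[OF _ assms])
  show "computable (\<lambda>e. tl_code (e 0))"
    unfolding tl_code_sum
    by (intro computable_sum computable_mult computable_var decidable_bex[unfolded decidable_def] decidable_eq[unfolded decidable_def] computable_cons_code)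
qed

definition entry_code :: "nat \<Rightarrow> nat \<Rightarrow> nat" where
  "entry_code c i = hd_code ((tl_code ^^ i) c)"

lemma computable_tl_funpow:
  assumes "computable F" "computable G"
  shows "computable (\<lambda>e. (tl_code ^^ G e) (F e))"
proof -
  have "computable (\<lambda>e. rec_nat (F e) (\<lambda>i y. tl_code y) (G e))"
    by (intro computable_rec assms computable_tl_code computable_var)
  moreover have "(tl_code ^^ n) c = rec_nat c (\<lambda>i y. tl_code y) n" for n c
    by (induction n) auto
  ultimately show ?thesis by (simp only:)
qed

lemma computable_entry_code: "computable F \<Longrightarrow> computable G \<Longrightarrow> computable (\<lambda>e. entry_code (F e) (G e))"
  unfolding entry_code_def by (intro computable_hd_code computable_tl_funpow)

lemma code_0_iff: "c = 0 \<longleftrightarrow> list_decode c = []"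
  by (cases c rule: code_cases) auto

lemma tl_funpow_0_iff: "(tl_code ^^ i) c = 0 \<longleftrightarrow> length (list_decode c) \<le> i"
  by (simp add: code_0_iff tl_code_funpow)

lemma entry_code_eq: "i < length (list_decode c) \<Longrightarrow> entry_code c i = list_decode c ! i"
proof -
  assume i: "i < length (list_decode c)"
  let ?d = "(tl_code ^^ i) c"
  have "list_decode ?d = list_decode c ! i # drop (Suc i) (list_decode c)"
    using i by (simp add: tl_code_funpow Cons_nth_drop_Suc)
  then have "?d = cons_code (list_decode c ! i) (list_encode (drop (Suc i) (list_decode c)))"
    by (metis cons_code_list_encode list_decode_inverse)
  then show ?thesis by (simp add: entry_code_def)
qed

lemma length_list_decode_le: "length (list_decode c) \<le> c"
proof (induction c rule: less_induct)
  case (less c)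
  show ?case
  proof (cases c rule: code_cases)
    case (2 d)
    then show ?thesis using less[of d] cons_code_gt[of d 0] by simp
  next
    case (3 x d)
    then show ?thesis using less[of d] cons_code_gt[of d "Suc x"] by simp
  qed simp
qed

definition len_code :: "nat \<Rightarrow> nat" where
  "len_code c = length (list_decode c)"

lemma computable_len_code:
  assumes "computable F"
  shows "computable (\<lambda>e. len_code (F e))"
proof (rule computable_comp1[OF _ assms])
  \<comment> \<open>The length counts the nonempty iterated tails; a list is no longer than its
    code, so \<open>c\<close> bounds the search.\<close>
  have "len_code c = (\<Sum>i<c. of_bool ((tl_code ^^ i) c \<noteq> 0))" for c
  proof -
    have "(\<Sum>i<c. of_bool ((tl_code ^^ i) c \<noteq> 0)) = (\<Sum>i<c. if i < len_code c then 1 else 0 :: nat)"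
      by (intro sum.cong) (auto simp: tl_funpow_0_iff len_code_def)
    also have "\<dots> = (\<Sum>i\<in>{..<c} \<inter> {i. i < len_code c}. 1)"
      by (simp add: sum.If_cases)
    also have "{..<c} \<inter> {i. i < len_code c} = {..<len_code c}"
      using length_list_decode_le[of c] by (auto simp: len_code_def)
    finally show ?thesis by simp
  qed
  then show "computable (\<lambda>e. len_code (e 0))"
    by (simp only:) (intro computable_sum decidable_not[unfolded decidable_def] decidable_eq[unfolded decidable_def] computable_tl_funpow
      computable_var computable_const)
qed

lemma decidable_set_code:
  assumes "computable F" "computable G"
  shows "decidable (\<lambda>e. F e \<in> set (list_decode (G e)))"
proof -
  have "x \<in> set (list_decode c) \<longleftrightarrow> (\<exists>i<len_code c. entry_code c i = x)" for x c
    by (auto simp: in_set_conv_nth len_code_def entry_code_eq)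
  then have "decidable (\<lambda>e. e 0 \<in> set (list_decode (e 1)))"
    by (simp only:) (intro decidable_bex decidable_eq computable_entry_code computable_len_code computable_var)
  then show ?thesis
    using assms unfolding decidable_def by (rule computable_comp2[of "\<lambda>x c. of_bool (x \<in> set (list_decode c))"])
qed

section \<open>Reading the input and deciding relations by machines\<close>

definition input_cell :: "nat list \<Rightarrow> int \<Rightarrow> nat" where
  "input_cell xs = fst (word_tape (encode_input xs))"

lemma input_cell_nat: "i < length (encode_input xs) \<Longrightarrow> input_cell xs (int i) = encode_input xs ! i"
  by (simp add: input_cell_def word_tape_def)

lemma input_cell_end: "input_cell xs (int (length (encode_input xs))) = 0"
  by (simp add: input_cell_def word_tape_def)

lemma input_cell_start: "input_cell xs (- 1) = 0"
  by (simp add: input_cell_def word_tape_def)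

definition seek_end :: cmd where
  "seek_end = While (Sees {1, 2}) (Basic (Head MoveRight))"

lemma exec_seek_end:
  "i + d = length (encode_input xs) \<Longrightarrow>
    exec (input_cell xs) seek_end (int i, \<sigma>) (int (length (encode_input xs)), \<sigma>)"
proof (induction d arbitrary: i)
  case 0
  then show ?case
    unfolding seek_end_def by (auto intro!: exec_While_stop simp: input_cell_end)
next
  case (Suc d)
  have "encode_input xs ! i \<in> {1, 2}"
  proof -
    have "i < length (encode_input xs)" using Suc.prems by simp
    then show ?thesis using encode_input_symbols[of xs] nth_mem by blast
  qed
  then have "holds (input_cell xs) (Sees {1, 2}) (int i, \<sigma>)"
    using Suc.prems by (simp add: input_cell_nat)
  moreover have "exec (input_cell xs) (Basic (Head MoveRight)) (int i, \<sigma>) (int (Suc i), \<sigma>)"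
    by (rule exec_Basic) simp_all
  moreover have "exec (input_cell xs) seek_end (int (Suc i), \<sigma>) (int (length (encode_input xs)), \<sigma>)"
    using Suc.prems by (intro Suc.IH) simp
  ultimately show ?case
    unfolding seek_end_def by (rule exec_While_loop)
qed

definition read_number :: cmd where
  "read_number = While (Sees {1}) (Seq (Basic (Head MoveLeft)) (Basic (Inc 0)))"

lemma exec_read_number:
  assumes "w (q - 1) \<noteq> 1" and "\<And>i. i < k \<Longrightarrow> w (q + int i) = 1"
  shows "exec w read_number (q + int k - 1, \<sigma>) (q - 1, \<sigma>(0 := \<sigma> 0 + k))"
  using assms(2)
proof (induction k arbitrary: \<sigma>)
  case 0
  then show ?case
    unfolding read_number_def using assms(1) by (auto intro!: exec_While_stop)
next
  case (Suc k)
  have step: "exec w (Seq (Basic (Head MoveLeft)) (Basic (Inc 0))) (q + int (Suc k) - 1, \<sigma>)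
      (q + int k - 1, \<sigma>(0 := Suc (\<sigma> 0)))"
  proof (rule exec_Seq)
    show "exec w (Basic (Head MoveLeft)) (q + int (Suc k) - 1, \<sigma>) (q + int k - 1, \<sigma>)"
      by (rule exec_Basic) simp_all
    show "exec w (Basic (Inc 0)) (q + int k - 1, \<sigma>) (q + int k - 1, \<sigma>(0 := Suc (\<sigma> 0)))"
      by (rule exec_Basic) simp_all
  qed
  have eq: "\<sigma>(0 := \<sigma> 0 + Suc k) = (\<sigma>(0 := Suc (\<sigma> 0)))(0 := (\<sigma>(0 := Suc (\<sigma> 0))) 0 + k)"
    by auto
  have rest: "exec w read_number (q + int k - 1, \<sigma>(0 := Suc (\<sigma> 0))) (q - 1, \<sigma>(0 := \<sigma> 0 + Suc k))"
    unfolding eq by (rule Suc.IH) (simp add: Suc.prems)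
  have test: "holds w (Sees {1}) (q + int (Suc k) - 1, \<sigma>)"
    using Suc.prems[of k] by simp
  show ?case
    using exec_While_loop[OF test step rest[unfolded read_number_def]]
    unfolding read_number_def .
qed

text \<open>The input is read from right to left, which is the order in which the code of a list is
  built. Register 0 counts and register 1 accumulates.\<close>

lemma exec_read_input:
  "\<exists>c. \<forall>xs. exec (input_cell xs) c (0, \<lambda>_. 0) (- 1, (\<lambda>_. 0)(1 := list_encode xs))"
proof -
  have "computable (\<lambda>e. cons_code (e 0) (e 1))"
    by (intro computable_cons_code computable_var)
  then obtain d where "realizes (\<lambda>e. cons_code (e 0) (e 1)) (\<lambda>i. if i = 0 then 0 else 1) 2 d"
    by (rule computable_E[of _ "\<lambda>i. if i = 0 then 0 else 1" 2]) auto
  note d = realizes_exec[OF this]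
  define clear where "clear r = While (NonZero r) (Basic (Dec r))" for r
  define move where "move = While (NonZero 2) (Seq (Basic (Dec 2)) (Basic (Inc 1)))"
  define body where "body = Seq (Basic (Head MoveLeft)) (Seq read_number (Seq d (Seq (clear 0) (Seq (clear 1) move))))"
  define loop where "loop = While (Sees {2}) body"
  define st :: "nat \<Rightarrow> nat \<Rightarrow> nat" where "st c = (\<lambda>_. 0)(1 := c)" for c
  \<comment> \<open>The invariant: register 1 holds the code of the part \<open>zs\<close> already
    read, and the head is on the final 2 of the unread part, or on the blank cell -1 when nothing is
    left.\<close>
  have loop: "exec (input_cell (ys @ zs)) loop (int (length (encode_input ys)) - 1, st (list_encode zs))
      (- 1, st (list_encode (ys @ zs)))" for ys zs
  proof (induction ys arbitrary: zs rule: rev_induct)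
    case Nil
    then show ?case
      unfolding loop_def by (auto intro!: exec_While_stop simp: input_cell_start encode_input_def)
  next
    case (snoc y ys)
    let ?w = "input_cell ((ys @ [y]) @ zs)"
    let ?q = "int (length (encode_input ys))"
    have enc: "encode_input ((ys @ [y]) @ zs) = encode_input ys @ replicate y 1 @ [2] @ encode_input zs"
      by (simp add: encode_input_def)
    have w1: "?w (?q + int i) = 1" if "i < y" for i
      using input_cell_nat[of "length (encode_input ys) + i" "(ys @ [y]) @ zs"] that
      unfolding enc by (simp add: nth_append)
    have w2: "?w (?q + int y) = 2"
      using input_cell_nat[of "length (encode_input ys) + y" "(ys @ [y]) @ zs"]
      unfolding enc by (simp add: nth_append)
    have w3: "?w (?q - 1) \<noteq> 1"
    proof (cases ys rule: rev_cases)
      case Nil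
      then show ?thesis using input_cell_start by (simp add: encode_input_def)
    next
      case (snoc us u)
      then have l: "0 < length (encode_input ys)" "encode_input ys ! (length (encode_input ys) - 1) = 2"
        by (simp_all add: encode_input_def nth_append)
      then have "?w (int (length (encode_input ys) - 1)) = 2"
        using input_cell_nat[of "length (encode_input ys) - 1" "(ys @ [y]) @ zs"]
        unfolding enc by (simp add: nth_append)
      then show ?thesis using l(1) by simp
    qed
    have "exec ?w (Basic (Head MoveLeft)) (?q + int y, st (list_encode zs)) (?q + int y - 1, st (list_encode zs))"
      by (rule exec_Basic) simp_all
    moreover have "exec ?w read_number (?q + int y - 1, st (list_encode zs)) (?q - 1, (st (list_encode zs))(0 := y))"
      using exec_read_number[of ?w ?q y "st (list_encode zs)", OF w3 w1] by (simp add: st_def)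
    moreover have "exec ?w d (?q - 1, (st (list_encode zs))(0 := y))
        (?q - 1, (st (list_encode zs))(0 := y, 2 := list_encode (y # zs)))"
      using d[of "(st (list_encode zs))(0 := y)" ?w "?q - 1"]
      by (simp add: st_def cons_code_list_encode del: list_encode.simps)
    moreover have "exec ?w (clear 0) (?q - 1, (st (list_encode zs))(0 := y, 2 := list_encode (y # zs)))
        (?q - 1, (st (list_encode zs))(0 := y, 2 := list_encode (y # zs), 0 := 0))"
      unfolding clear_def by (rule exec_clear)
    moreover have "exec ?w (clear 1) (?q - 1, (st (list_encode zs))(0 := y, 2 := list_encode (y # zs), 0 := 0))
        (?q - 1, (st (list_encode zs))(0 := y, 2 := list_encode (y # zs), 0 := 0, 1 := 0))"
      unfolding clear_def by (rule exec_clear)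
    moreover have "exec ?w move (?q - 1, (st (list_encode zs))(0 := y, 2 := list_encode (y # zs), 0 := 0, 1 := 0))
        (?q - 1, st (list_encode (y # zs)))"
    proof -
      let ?\<sigma> = "(st (list_encode zs))(0 := y, 2 := list_encode (y # zs), 0 := 0, 1 := 0)"
      have "?\<sigma>(2 := 0, 1 := ?\<sigma> 1 + ?\<sigma> 2) = st (list_encode (y # zs))"
        by (auto simp: st_def simp del: list_encode.simps)
      then show ?thesis
        using exec_move[of 2 1 ?w "?q - 1" ?\<sigma>] unfolding move_def by (simp del: list_encode.simps)
    qed
    ultimately have step: "exec ?w body (?q + int y, st (list_encode zs)) (?q - 1, st (list_encode (y # zs)))"
      unfolding body_def by (intro exec_Seq)
    have rest: "exec ?w loop (?q - 1, st (list_encode (y # zs))) (- 1, st (list_encode ((ys @ [y]) @ zs)))"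
      using snoc.IH[of "y # zs"] by simp
    have test: "holds ?w (Sees {2}) (?q + int y, st (list_encode zs))"
      using w2 by simp
    have "exec ?w loop (?q + int y, st (list_encode zs)) (- 1, st (list_encode ((ys @ [y]) @ zs)))"
      using exec_While_loop[OF test step rest[unfolded loop_def]] unfolding loop_def .
    moreover have "int (length (encode_input (ys @ [y]))) - 1 = ?q + int y"
      by (simp add: encode_input_def)
    ultimately show ?case by simp
  qed
  have "exec (input_cell xs) (Seq seek_end (Seq (Basic (Head MoveLeft)) loop)) (0, \<lambda>_. 0)
      (- 1, (\<lambda>_. 0)(1 := list_encode xs))" for xs
  proof -
    have "exec (input_cell xs) seek_end (0, \<lambda>_. 0) (int (length (encode_input xs)), \<lambda>_. 0)"
      using exec_seek_end[of 0 _ xs "\<lambda>_. 0"] by simp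
    moreover have "exec (input_cell xs) (Basic (Head MoveLeft)) (int (length (encode_input xs)), \<lambda>_. 0)
        (int (length (encode_input xs)) - 1, \<lambda>_. 0)"
      by (rule exec_Basic) simp_all
    moreover have "st 0 = (\<lambda>_. 0)"
      by (auto simp: st_def)
    then have "exec (input_cell xs) loop (int (length (encode_input xs)) - 1, \<lambda>_. 0) (- 1, (\<lambda>_. 0)(1 := list_encode xs))"
      using loop[of xs "[]"] by (simp add: st_def)
    ultimately show ?thesis
      by (intro exec_Seq)
  qed
  then show ?thesis by blast
qed

text \<open>After the input is read its code is in register 1, and the registers from 2 on are free
  for the decision program; its result is moved to register 0, from which the output is
  taken.\<close>

theorem decidable_tm:
  assumes "decidable (\<lambda>e. V (e 0))"
  shows "\<exists>M. wf_tm M \<and> (\<forall>xs. tm_computes M xs (of_bool (V (list_encode xs))))"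
proof -
  obtain c where c: "\<And>xs. exec (input_cell xs) c (0, \<lambda>_. 0) (- 1, (\<lambda>_. 0)(1 := list_encode xs))"
    using exec_read_input by blast
  obtain d where "realizes (\<lambda>e. of_bool (V (e 0))) (\<lambda>_. 1) 2 d"
    by (rule computable_E[OF assms[unfolded decidable_def], of "\<lambda>_. 1" 2]) simp
  note d = realizes_exec[OF this]
  let ?move = "While (NonZero 2) (Seq (Basic (Dec 2)) (Basic (Inc 0)))"
  have ex: "exec (input_cell xs) (Seq c (Seq d ?move)) (0, \<lambda>_. 0)
      (- 1, (\<lambda>_. 0)(1 := list_encode xs, 0 := of_bool (V (list_encode xs))))" for xs
  proof -
    let ?\<sigma> = "(\<lambda>_ :: nat. 0 :: nat)(1 := list_encode xs)"
    let ?v = "of_bool (V (list_encode xs))"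
    have "exec (input_cell xs) d (- 1, ?\<sigma>) (- 1, ?\<sigma>(2 := ?v))"
      using d[of ?\<sigma> "input_cell xs" "- 1"] by simp
    moreover have "exec (input_cell xs) ?move (- 1, ?\<sigma>(2 := ?v)) (- 1, ?\<sigma>(0 := ?v))"
    proof -
      have "(?\<sigma>(2 := ?v))(2 := 0, 0 := (?\<sigma>(2 := ?v)) 0 + (?\<sigma>(2 := ?v)) 2) = ?\<sigma>(0 := ?v)"
        by auto
      then show ?thesis
        using exec_move[of 2 0 "input_cell xs" "- 1" "?\<sigma>(2 := ?v)"] by simp
    qed
    ultimately show ?thesis
      using c by (intro exec_Seq)
  qed
  obtain M where M: "wf_tm M" "\<And>xs p \<sigma>. exec (fst (word_tape (encode_input xs))) (Seq c (Seq d ?move)) (0, \<lambda>_. 0) (p, \<sigma>) \<Longrightarrow>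
      tm_computes M xs (of_bool (\<sigma> 0 \<noteq> 0))"
    using cmd_tm[of "Seq c (Seq d ?move)"] by blast
  have "tm_computes M xs (of_bool (V (list_encode xs)))" for xs
    using M(2)[OF ex[unfolded input_cell_def]] by (simp split: if_splits)
  with M(1) show ?thesis by blast
qed

section \<open>Bounded evaluation of formulas\<close>

text \<open>\<open>u\<close> is kept apart from \<open>e 0\<close>: a quantifier may rebind variable
  0, while the witnessing set still depends on \<open>u\<close>.\<close>

primrec vmax :: "nat \<Rightarrow> (nat \<Rightarrow> nat) \<Rightarrow> nat \<Rightarrow> nat" where
  "vmax u e 0 = u"
| "vmax u e (Suc N) = max (vmax u e N) (e N)"

text \<open>Universal quantifiers are restricted to numbers below \<open>l\<close>. Existential ones are bounded by the value
  of \<open>G\<close> at an index which exceeds the current values of all variables, and are taken to be satisfied if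
  this index is not below \<open>l\<close>.\<close>

primrec bounded_sat :: "nat \<Rightarrow> (nat \<Rightarrow> nat) \<Rightarrow> nat \<Rightarrow> nat \<Rightarrow> (nat \<Rightarrow> nat set) \<Rightarrow> aform \<Rightarrow> bool \<Rightarrow> (nat \<Rightarrow> nat) \<Rightarrow> bool" where
  "bounded_sat l G u N S (FEq s t) b e = ((tval e s = tval e t) = b)"
| "bounded_sat l G u N S (FLess s t) b e = ((tval e s < tval e t) = b)"
| "bounded_sat l G u N S (FMem t v) b e = ((tval e t \<in> S v) = b)"
| "bounded_sat l G u N S (FNot p) b e = bounded_sat l G u N S p (\<not> b) e"
| "bounded_sat l G u N S (FAnd p q) b e =
    (if b then bounded_sat l G u N S p True e \<and> bounded_sat l G u N S q True e
     else bounded_sat l G u N S p False e \<or> bounded_sat l G u N S q False e)"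
| "bounded_sat l G u N S (FAll x p) b e =
    (if b then \<forall>k<l. bounded_sat l G u N S p True (e(x := k))
     else Suc (vmax u e N) < l \<longrightarrow> (\<exists>k\<le>G (Suc (vmax u e N)). bounded_sat l G u N S p False (e(x := k))))"

text \<open>The flag \<open>b\<close> pushes negations inward, so \<open>l\<close> occurs only as
  the range of universal quantifiers and in the guards of existential ones. Lowering it weakens
  both.\<close>

lemma bounded_sat_mono: "bounded_sat l' G u N S p b e \<Longrightarrow> l \<le> l' \<Longrightarrow> bounded_sat l G u N S p b e"
proof (induction p arbitrary: b e)
  case (FAll x p)
  then show ?case
    by (cases b) (auto, meson less_le_trans)
qed (auto split: if_splits)

text \<open>The guard of an existential quantifier lets \<open>G\<close> be consulted at indices
  below \<open>l\<close> only. Hence the verdict depends on an initial segment.\<close>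

lemma bounded_sat_cong_G: "(\<And>i. i < l \<Longrightarrow> G i = G' i) \<Longrightarrow> bounded_sat l G u N S p b e = bounded_sat l G' u N S p b e"
  by (induction p arbitrary: b e) auto

text \<open>All quantifiers are bounded, so only finitely many membership questions can be asked,
  and their range does not depend on the answers.\<close>

lemma bounded_sat_local:
  "\<exists>B. \<forall>S S'. (\<forall>v. \<forall>x<B. x \<in> S v \<longleftrightarrow> x \<in> S' v) \<longrightarrow> bounded_sat l G u N S p b e = bounded_sat l G u N S' p b e"
proof (induction p arbitrary: b e)
  case (FMem t v)
  show ?case by (rule exI[of _ "Suc (tval e t)"]) auto
next
  case (FNot p)
  then show ?case by simp
next
  case (FAnd p q)
  obtain B1 where B1: "\<And>S S'. (\<forall>v. \<forall>x<B1. x \<in> S v \<longleftrightarrow> x \<in> S' v) \<Longrightarrow> bounded_sat l G u N S p b e = bounded_sat l G u N S' p b e"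
    using FAnd.IH(1)[of b e] by blast
  obtain B2 where B2: "\<And>S S'. (\<forall>v. \<forall>x<B2. x \<in> S v \<longleftrightarrow> x \<in> S' v) \<Longrightarrow> bounded_sat l G u N S q b e = bounded_sat l G u N S' q b e"
    using FAnd.IH(2)[of b e] by blast
  have "bounded_sat l G u N S (FAnd p q) b e = bounded_sat l G u N S' (FAnd p q) b e"
    if "\<forall>v. \<forall>x<max B1 B2. x \<in> S v \<longleftrightarrow> x \<in> S' v" for S S'
    using B1[of S S'] B2[of S S'] that by (cases b) auto
  then show ?case by blast
next
  case (FAll x p)
  define K where "K = max l (Suc (G (Suc (vmax u e N))))"
  have "\<forall>k. \<exists>B. \<forall>S S'. (\<forall>v. \<forall>x<B. x \<in> S v \<longleftrightarrow> x \<in> S' v) \<longrightarrow>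
      bounded_sat l G u N S p b (e(x := k)) = bounded_sat l G u N S' p b (e(x := k))"
    using FAll.IH by blast
  then obtain B where B: "\<And>k S S'. (\<forall>v. \<forall>x<B k. x \<in> S v \<longleftrightarrow> x \<in> S' v) \<Longrightarrow>
      bounded_sat l G u N S p b (e(x := k)) = bounded_sat l G u N S' p b (e(x := k))"
    by metis
  have "bounded_sat l G u N S (FAll x p) b e = bounded_sat l G u N S' (FAll x p) b e"
    if SS: "\<forall>v. \<forall>y<(\<Sum>k<K. B k). y \<in> S v \<longleftrightarrow> y \<in> S' v" for S S'
  proof -
    have eq: "bounded_sat l G u N S p b (e(x := k)) = bounded_sat l G u N S' p b (e(x := k))" if "k < K" for k
    proof (rule B)
      have "B k \<le> (\<Sum>k<K. B k)"
        using that by (intro member_le_sum) auto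
      then show "\<forall>v. \<forall>x<B k. x \<in> S v \<longleftrightarrow> x \<in> S' v"
        using SS by auto
    qed
    show ?thesis
    proof (cases b)
      case True
      have "\<And>k. k < l \<Longrightarrow> k < K" by (simp add: K_def)
      then show ?thesis using True eq by auto
    next
      case False
      have "\<And>k. k \<le> G (Suc (vmax u e N)) \<Longrightarrow> k < K" by (auto simp: K_def)
      then show ?thesis using False eq by auto
    qed
  qed
  then show ?case by blast
qed simp_all

text \<open>This holds for every \<open>G\<close>, fast or not: the candidates for an existential
  quantifier do not depend on \<open>l\<close> and are finite in number. If each failed at some
  level, by monotonicity all would fail at a common one.\<close>

lemma bounded_sat_sound: "(\<And>l. bounded_sat l G u N S p b e) \<Longrightarrow> sat S e p = b"
proof (induction p arbitrary: b e)
  case (FNot p)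
  have "sat S e p = (\<not> b)"
    by (rule FNot.IH) (use FNot.prems in simp)
  then show ?case by auto
next
  case (FAnd p q)
  show ?case
  proof (cases b)
    case True
    have "sat S e p = True" "sat S e q = True"
      by (rule FAnd.IH, use FAnd.prems True in simp)+
    then show ?thesis using True by simp
  next
    case False
    have "(\<forall>l. bounded_sat l G u N S p False e) \<or> (\<forall>l. bounded_sat l G u N S q False e)"
    proof (rule ccontr)
      assume "\<not> ?thesis"
      then obtain l1 l2 where "\<not> bounded_sat l1 G u N S p False e" "\<not> bounded_sat l2 G u N S q False e" by blast
      then have "\<not> bounded_sat (max l1 l2) G u N S p False e" "\<not> bounded_sat (max l1 l2) G u N S q False e"
        using bounded_sat_mono max.cobounded1 max.cobounded2 by blast+
      then show False using FAnd.prems[of "max l1 l2"] False by simp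
    qed
    then show ?thesis using FAnd.IH[of False e] False by auto
  qed
next
  case (FAll x p)
  show ?case
  proof (cases b)
    case True
    have "sat S (e(x := k)) p = True" for k
    proof (rule FAll.IH)
      fix l
      have "bounded_sat (max l (Suc k)) G u N S p True (e(x := k))"
        using FAll.prems[of "max l (Suc k)"] True by simp
      then show "bounded_sat l G u N S p True (e(x := k))"
        by (rule bounded_sat_mono) simp
    qed
    then show ?thesis using True by simp
  next
    case False
    let ?m = "Suc (vmax u e N)"
    have "\<exists>k. \<forall>l. bounded_sat l G u N S p False (e(x := k))"
    proof (rule ccontr)
      assume "\<not> ?thesis"
      then obtain l where l: "\<And>k. \<not> bounded_sat (l k) G u N S p False (e(x := k))" by metis
      \<comment> \<open>\<open>Suc ?m\<close> satisfies the guard, and the sum exceeds the failure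
        level of every candidate.\<close>
      define L where "L = Suc ?m + (\<Sum>k\<le>G ?m. l k)"
      obtain k where k: "k \<le> G ?m" "bounded_sat L G u N S p False (e(x := k))"
        using FAll.prems[of L] False by (auto simp: L_def)
      have "l k \<le> (\<Sum>k\<le>G ?m. l k)"
        using k(1) by (intro member_le_sum) auto
      then have "l k \<le> L" by (simp add: L_def)
      then show False using bounded_sat_mono[OF k(2)] l by blast
    qed
    then obtain k where "\<And>l. bounded_sat l G u N S p False (e(x := k))" by blast
    then have "sat S (e(x := k)) p = False" by (rule FAll.IH)
    then show ?thesis using False by auto
  qed
qed simp_all

lemma vmax_ge: "u \<le> vmax u e N" "x < N \<Longrightarrow> e x \<le> vmax u e N"
  by (induction N) (auto simp: less_Suc_eq)

text \<open>One \<open>f\<close> has to serve all assignments and all \<open>u\<close>. Below an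
  index \<open>m\<close> there are only finitely many of either, so their least witnesses can be
  summed.\<close>

lemma bounded_sat_complete:
  fixes T :: "nat \<Rightarrow> nat \<Rightarrow> nat set"
  assumes "var_bound p \<le> N"
  shows "\<exists>f. \<forall>u e b G l. (\<forall>x\<ge>N. e x = 0) \<longrightarrow> sat (T u) e p = b \<longrightarrow> (\<forall>m. f m \<le> G (Suc m)) \<longrightarrow>
    bounded_sat l G u N (T u) p b e"
  using assms
proof (induction p)
  case (FNot p)
  then obtain f where f: "\<forall>u e b G l. (\<forall>x\<ge>N. e x = 0) \<longrightarrow> sat (T u) e p = b \<longrightarrow> (\<forall>m. f m \<le> G (Suc m)) \<longrightarrow>
    bounded_sat l G u N (T u) p b e"
    by auto
  show ?case
  proof (intro exI[of _ f] allI impI)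
    fix u e b G l
    assume "\<forall>x\<ge>N. e x = 0" "sat (T u) e (FNot p) = b" "\<forall>m. f m \<le> G (Suc m)"
    then show "bounded_sat l G u N (T u) (FNot p) b e"
      using f[THEN spec, THEN spec, THEN spec, THEN spec, THEN spec, of e u "\<not> b" G l] by auto
  qed
next
  case (FAnd p q)
  have "var_bound p \<le> N" "var_bound q \<le> N" using FAnd.prems by simp_all
  obtain f1 where f1: "\<forall>u e b G l. (\<forall>x\<ge>N. e x = 0) \<longrightarrow> sat (T u) e p = b \<longrightarrow> (\<forall>m. f1 m \<le> G (Suc m)) \<longrightarrow>
    bounded_sat l G u N (T u) p b e"
    using FAnd.IH(1)[OF \<open>var_bound p \<le> N\<close>] by (rule exE)
  obtain f2 where f2: "\<forall>u e b G l. (\<forall>x\<ge>N. e x = 0) \<longrightarrow> sat (T u) e q = b \<longrightarrow> (\<forall>m. f2 m \<le> G (Suc m)) \<longrightarrow>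
    bounded_sat l G u N (T u) q b e"
    using FAnd.IH(2)[OF \<open>var_bound q \<le> N\<close>] by (rule exE)
  have *: "bounded_sat l G u N (T u) (FAnd p q) b e"
    if "\<forall>x\<ge>N. e x = 0" "sat (T u) e (FAnd p q) = b" "\<forall>m. max (f1 m) (f2 m) \<le> G (Suc m)" for u e b G l
  proof -
    have G: "\<forall>m. f1 m \<le> G (Suc m)" "\<forall>m. f2 m \<le> G (Suc m)"
      using that(3) by simp_all
    have "bounded_sat l G u N (T u) p (sat (T u) e p) e" "bounded_sat l G u N (T u) q (sat (T u) e q) e"
      using f1[THEN spec, THEN spec, THEN spec, THEN spec, THEN spec, of e u _ G l]
        f2[THEN spec, THEN spec, THEN spec, THEN spec, THEN spec, of e u _ G l] G that(1) by simp_all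
    then show ?thesis using that(2) by (cases b; cases "sat (T u) e p") auto
  qed
  show ?case by (intro exI[of _ "\<lambda>m. max (f1 m) (f2 m)"] allI impI) (rule *)
next
  case (FAll x p)
  then have x: "x < N" and "var_bound p \<le> N" by simp_all
  obtain f where f: "\<forall>u e b G l. (\<forall>x\<ge>N. e x = 0) \<longrightarrow> sat (T u) e p = b \<longrightarrow>
      (\<forall>m. f m \<le> G (Suc m)) \<longrightarrow> bounded_sat l G u N (T u) p b e"
    using FAll.IH[OF \<open>var_bound p \<le> N\<close>] by (rule exE)
  have f: "bounded_sat l G u N (T u) p b e"
    if "\<forall>x\<ge>N. e x = 0" "sat (T u) e p = b" "\<forall>m. f m \<le> G (Suc m)" for u e b G l
    using f[THEN spec, THEN spec, THEN spec, THEN spec, THEN spec, of e u b G l] that by simp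
  \<comment> \<open>Where there is no counterexample the value is unspecified; it can only enlarge
    the bound.\<close>
  define W where "W u e = (LEAST k. \<not> sat (T u) (e(x := k)) p)" for u e
  define E where "E m = {e. \<forall>x. (x \<in> {..<N} \<longrightarrow> e x \<in> {..m}) \<and> (x \<notin> {..<N} \<longrightarrow> e x = 0)}" for m :: nat
  have fin: "finite (E m)" for m
    unfolding E_def by (rule finite_set_of_finite_funs) simp_all
  define f' where "f' m = f m + (\<Sum>u\<le>m. \<Sum>e\<in>E m. W u e)" for m
  have W: "W u e \<le> f' m" if "u \<le> m" "e \<in> E m" for u e m
  proof -
    have "W u e \<le> (\<Sum>e\<in>E m. W u e)"
      using that fin by (intro member_le_sum) auto
    also have "\<dots> \<le> (\<Sum>u\<le>m. \<Sum>e\<in>E m. W u e)"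
      using that by (intro member_le_sum) auto
    finally show ?thesis by (simp add: f'_def)
  qed
  have *: "bounded_sat l G u N (T u) (FAll x p) b e"
    if e: "\<forall>x\<ge>N. e x = 0" and s: "sat (T u) e (FAll x p) = b" and G: "\<forall>m. f' m \<le> G (Suc m)" for u e b G l
  proof -
    have e': "\<forall>y\<ge>N. (e(x := k)) y = 0" for k using e x by auto
    have G': "\<forall>m. f m \<le> G (Suc m)" using G unfolding f'_def by (meson add_leD1)
    show ?thesis
    proof (cases b)
      case True
      have "bounded_sat l G u N (T u) p True (e(x := k))" for k
        by (rule f[of "e(x := k)" u True G l, OF e' _ G']) (use s True in simp)
      then show ?thesis using True by simp
    next
      case False
      let ?m = "vmax u e N"
      have "\<exists>k. \<not> sat (T u) (e(x := k)) p" using s False by simp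
      then have "\<not> sat (T u) (e(x := W u e)) p"
        unfolding W_def by (rule LeastI_ex)
      then have "bounded_sat l G u N (T u) p False (e(x := W u e))"
        by (intro f[of "e(x := W u e)" u False G l, OF e' _ G']) simp
      moreover have "e \<in> E ?m"
        using e vmax_ge(2)[of _ N e u] by (auto simp: E_def)
      then have "W u e \<le> G (Suc ?m)"
        using W[OF vmax_ge(1)] G by (meson le_trans)
      ultimately show ?thesis using False by auto
    qed
  qed
  show ?case by (intro exI[of _ f'] allI impI) (rule *)
qed auto

section \<open>From analytical definitions to fast-growing sequences\<close>

lemma computable_tval:
  assumes "\<And>x. computable (T x)"
  shows "computable (\<lambda>e. tval (\<lambda>x. T x e) t)"
  by (induction t) (simp_all add: assms computable_add computable_mult computable_const)

lemma computable_vmax: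
  assumes "computable u" "\<And>x. computable (T x)"
  shows "computable (\<lambda>e. vmax (u e) (\<lambda>x. T x e) N)"
  by (induction N) (simp_all add: assms computable_max)

text \<open>The renaming under a further binder when variable 0 has to stay in place: it leaves room
  for the new variable at 1.\<close>

definition skip1 :: "nat \<Rightarrow> nat" where
  "skip1 i = (case i of 0 \<Rightarrow> 0 | Suc j \<Rightarrow> Suc (Suc j))"

lemma skip1_simps [simp]: "skip1 0 = 0" "skip1 (Suc j) = Suc (Suc j)"
  by (simp_all add: skip1_def)

text \<open>Every ingredient may depend on an outer environment, because quantifiers are evaluated
  under an extended one. The program is built along the fixed formula \<open>p\<close> instead of
  interpreting codes of formulas.\<close>

definition bounded_sat_decidable :: "nat \<Rightarrow> aform \<Rightarrow> bool" where
  "bounded_sat_decidable N p \<longleftrightarrow> (\<forall>b l G u S T. computable l \<longrightarrow> computable (\<lambda>e. G (\<lambda>i. e (Suc i)) (e 0)) \<longrightarrow> computable u \<longrightarrow>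
     (\<forall>v. decidable (\<lambda>e. e 0 \<in> S (\<lambda>i. e (Suc i)) v)) \<longrightarrow> (\<forall>x. computable (T x)) \<longrightarrow>
     decidable (\<lambda>e. bounded_sat (l e) (G e) (u e) N (S e) p b (\<lambda>x. T x e)))"

lemma bounded_sat_decidable_D:
  assumes "bounded_sat_decidable N p" "computable l" "computable (\<lambda>e. G (\<lambda>i. e (Suc i)) (e 0))" "computable u"
    "\<And>v. decidable (\<lambda>e. e 0 \<in> S (\<lambda>i. e (Suc i)) v)" "\<And>x. computable (T x)"
  shows "decidable (\<lambda>e. bounded_sat (l e) (G e) (u e) N (S e) p b (\<lambda>x. T x e))"
  using assms(1)[unfolded bounded_sat_decidable_def, THEN spec, THEN spec, THEN spec, THEN spec, THEN spec, THEN spec, of l G u S T b]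
    assms(2-) by simp

lemma bounded_sat_decidable_I:
  assumes "\<And>b l G u S T. computable l \<Longrightarrow> computable (\<lambda>e. G (\<lambda>i. e (Suc i)) (e 0)) \<Longrightarrow> computable u \<Longrightarrow>
    (\<forall>v. decidable (\<lambda>e. e 0 \<in> S (\<lambda>i. e (Suc i)) v)) \<Longrightarrow> (\<forall>x. computable (T x)) \<Longrightarrow>
    decidable (\<lambda>e. bounded_sat (l e) (G e) (u e) N (S e) p b (\<lambda>x. T x e))"
  shows "bounded_sat_decidable N p"
  unfolding bounded_sat_decidable_def by (intro allI impI) (rule assms)

lemma computable_at:
  assumes "computable (\<lambda>e. G (\<lambda>i. e (Suc i)) (e 0))" "computable F"
  shows "computable (\<lambda>e. G e (F e))"
  using computable_let[OF assms] by simp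

lemma decidable_iff_const: "decidable \<phi> \<Longrightarrow> decidable (\<lambda>e. \<phi> e = b)"
  by (cases b) (simp_all add: decidable_not)

lemma bounded_sat_decidable: "bounded_sat_decidable N p"
proof (induction p)
  case (FEq s t)
  show ?case
    by (rule bounded_sat_decidable_I) (simp add: decidable_iff_const decidable_eq computable_tval)
next
  case (FLess s t)
  show ?case
    by (rule bounded_sat_decidable_I) (simp add: decidable_iff_const decidable_less computable_tval)
next
  case (FMem t v)
  show ?case
  proof (rule bounded_sat_decidable_I)
    fix b l G u and S :: "(nat \<Rightarrow> nat) \<Rightarrow> nat \<Rightarrow> nat set" and T :: "nat \<Rightarrow> (nat \<Rightarrow> nat) \<Rightarrow> nat"
    assume S: "\<forall>v. decidable (\<lambda>e. e 0 \<in> S (\<lambda>i. e (Suc i)) v)" and T: "\<forall>x. computable (T x)"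
    have "decidable (\<lambda>e. tval (\<lambda>x. T x e) t \<in> S e v)"
      using decidable_let[OF S[THEN spec, of v] computable_tval[of T t]] T by simp
    then show "decidable (\<lambda>e. bounded_sat (l e) (G e) (u e) N (S e) (FMem t v) b (\<lambda>x. T x e))"
      by (simp add: decidable_iff_const)
  qed
next
  case (FNot p)
  show ?case
    by (rule bounded_sat_decidable_I) (simp add: bounded_sat_decidable_D[OF FNot])
next
  case (FAnd p q)
  show ?case
  proof (rule bounded_sat_decidable_I)
    fix b and l u :: "(nat \<Rightarrow> nat) \<Rightarrow> nat" and G :: "(nat \<Rightarrow> nat) \<Rightarrow> nat \<Rightarrow> nat"
      and S :: "(nat \<Rightarrow> nat) \<Rightarrow> nat \<Rightarrow> nat set" and T :: "nat \<Rightarrow> (nat \<Rightarrow> nat) \<Rightarrow> nat"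
    assume *: "computable l" "computable (\<lambda>e. G (\<lambda>i. e (Suc i)) (e 0))" "computable u"
      "\<forall>v. decidable (\<lambda>e. e 0 \<in> S (\<lambda>i. e (Suc i)) v)" "\<forall>x. computable (T x)"
    have "decidable (\<lambda>e. bounded_sat (l e) (G e) (u e) N (S e) p b (\<lambda>x. T x e))"
      "decidable (\<lambda>e. bounded_sat (l e) (G e) (u e) N (S e) q b (\<lambda>x. T x e))"
      by (rule bounded_sat_decidable_D[OF FAnd.IH(1)] bounded_sat_decidable_D[OF FAnd.IH(2)]; simp add: *)+
    then show "decidable (\<lambda>e. bounded_sat (l e) (G e) (u e) N (S e) (FAnd p q) b (\<lambda>x. T x e))"
      by (cases b) (simp_all add: decidable_and decidable_or)
  qed
next
  case (FAll x p)
  show ?case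
  proof (rule bounded_sat_decidable_I)
    fix b and l u :: "(nat \<Rightarrow> nat) \<Rightarrow> nat" and G :: "(nat \<Rightarrow> nat) \<Rightarrow> nat \<Rightarrow> nat"
      and S :: "(nat \<Rightarrow> nat) \<Rightarrow> nat \<Rightarrow> nat set" and T :: "nat \<Rightarrow> (nat \<Rightarrow> nat) \<Rightarrow> nat"
    assume l: "computable l" and G: "computable (\<lambda>e. G (\<lambda>i. e (Suc i)) (e 0))" and u: "computable u"
      and S: "\<forall>v. decidable (\<lambda>e. e 0 \<in> S (\<lambda>i. e (Suc i)) v)" and T: "\<forall>x. computable (T x)"
    define T' where "T' y = (if y = x then (\<lambda>e. e 0) else (\<lambda>e. T y (\<lambda>i. e (Suc i))))" for y
    have T': "(\<lambda>y. T' y e) = (\<lambda>y. T y (\<lambda>i. e (Suc i)))(x := e 0)" for e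
      by (auto simp: T'_def)
    have T'_mc: "computable (T' y)" for y
      using T computable_ren[OF T[THEN spec, of y], of Suc] by (simp add: T'_def computable_var)
    have S': "decidable (\<lambda>e. e 0 \<in> S (\<lambda>i. e (Suc (Suc i))) v)" for v
      using decidable_ren[OF S[THEN spec, of v], of skip1] by simp
    have G': "computable (\<lambda>e. G (\<lambda>i. e (Suc (Suc i))) (e 0))"
      using computable_ren[OF G, of skip1] by simp
    have "decidable (\<lambda>e. bounded_sat (l (\<lambda>i. e (Suc i))) (G (\<lambda>i. e (Suc i))) (u (\<lambda>i. e (Suc i))) N
        (S (\<lambda>i. e (Suc i))) p b (\<lambda>y. T' y e))"
      by (rule bounded_sat_decidable_D[of N p "\<lambda>e. l (\<lambda>i. e (Suc i))" "\<lambda>e. G (\<lambda>i. e (Suc i))"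
            "\<lambda>e. u (\<lambda>i. e (Suc i))" "\<lambda>e. S (\<lambda>i. e (Suc i))" T',
            OF FAll.IH computable_ren[OF l, of Suc] G' computable_ren[OF u, of Suc] S' T'_mc])
    then have body: "decidable (\<lambda>e. bounded_sat (l (\<lambda>i. e (Suc i))) (G (\<lambda>i. e (Suc i))) (u (\<lambda>i. e (Suc i))) N
        (S (\<lambda>i. e (Suc i))) p b ((\<lambda>y. T y (\<lambda>i. e (Suc i)))(x := e 0)))"
      unfolding T' .
    let ?m = "\<lambda>e. Suc (vmax (u e) (\<lambda>x. T x e) N)"
    have m: "computable ?m"
      using T by (intro computable_Suc computable_vmax u) simp
    show "decidable (\<lambda>e. bounded_sat (l e) (G e) (u e) N (S e) (FAll x p) b (\<lambda>x. T x e))"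
    proof (cases b)
      case True
      have "decidable (\<lambda>e. \<forall>k<l e. bounded_sat (l e) (G e) (u e) N (S e) p b ((\<lambda>x. T x e)(x := k)))"
        by (rule decidable_ball[OF _ l]) (rule body)
      then show ?thesis using True by simp
    next
      case False
      have "decidable (\<lambda>e. \<exists>k\<le>G e (?m e). bounded_sat (l e) (G e) (u e) N (S e) p b ((\<lambda>x. T x e)(x := k)))"
        by (rule decidable_bex_le[OF _ computable_at[OF G m]]) (rule body)
      then have "decidable (\<lambda>e. ?m e < l e \<longrightarrow>
          (\<exists>k\<le>G e (?m e). bounded_sat (l e) (G e) (u e) N (S e) p b ((\<lambda>x. T x e)(x := k))))"
        by (intro decidable_imp decidable_less m l)
      then show ?thesis using False by simp
    qed
  qed
qed

section \<open>Compactness and stages of the approximation\<close>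

lemma compactness:
  fixes A :: "nat \<Rightarrow> nat set"
  shows "\<exists>X. \<forall>B l0. \<exists>l\<ge>l0. \<forall>x<B. x \<in> A l \<longleftrightarrow> x \<in> X"
proof -
  \<comment> \<open>Koenig's lemma: \<open>J B\<close> is an infinite set of indices whose sets
    agree below \<open>B\<close>, refined by keeping an infinite half at each step.\<close>
  define J where "J = rec_nat UNIV (\<lambda>B I. if infinite {l \<in> I. B \<in> A l} then {l \<in> I. B \<in> A l} else {l \<in> I. B \<notin> A l})"
  have J0: "J 0 = UNIV"
    and JS: "J (Suc B) = (if infinite {l \<in> J B. B \<in> A l} then {l \<in> J B. B \<in> A l} else {l \<in> J B. B \<notin> A l})" for B
    by (simp_all add: J_def)
  have inf: "infinite (J B)" for B
  proof (induction B)
    case (Suc B)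
    have "J B = {l \<in> J B. B \<in> A l} \<union> {l \<in> J B. B \<notin> A l}" by auto
    then show ?case using Suc by (metis JS finite_UnI)
  qed (simp add: J0)
  define X where "X = {B. infinite {l \<in> J B. B \<in> A l}}"
  have agree: "\<forall>x<B. x \<in> A l \<longleftrightarrow> x \<in> X" if "l \<in> J B" for l B
    using that
  proof (induction B)
    case (Suc B)
    then have "l \<in> J B" "B \<in> A l \<longleftrightarrow> B \<in> X"
      by (auto simp: JS X_def split: if_splits)
    with Suc.IH show ?case by (auto simp: less_Suc_eq)
  qed simp
  have "\<exists>l\<ge>l0. \<forall>x<B. x \<in> A l \<longleftrightarrow> x \<in> X" for B l0
    using inf[of B] agree unfolding finite_nat_set_iff_bounded_le by (meson linear)
  then show ?thesis by blast
qed

definition init_sets :: "nat set \<Rightarrow> nat set \<Rightarrow> nat \<Rightarrow> nat set" where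
  "init_sets X A = (\<lambda>_. {})(0 := X, 1 := A)"

definition init_env :: "nat \<Rightarrow> nat \<Rightarrow> nat" where
  "init_env n = (\<lambda>_. 0)(0 := n)"

text \<open>The \<open>Suc\<close> keeps variable 0, which carries \<open>u\<close>, among the
  counted variables even when \<open>p\<close> has no variables.\<close>

definition approx :: "aform \<Rightarrow> bool \<Rightarrow> nat set \<Rightarrow> nat set \<Rightarrow> (nat \<Rightarrow> nat) \<Rightarrow> nat \<Rightarrow> nat \<Rightarrow> bool" where
  "approx p b X A G u l \<longleftrightarrow> bounded_sat l G u (Suc (var_bound p)) (init_sets X A) p b (init_env u)"

definition stage :: "aform \<Rightarrow> bool \<Rightarrow> nat set \<Rightarrow> (nat \<Rightarrow> nat) \<Rightarrow> nat \<Rightarrow> nat \<Rightarrow> bool" where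
  "stage p b A G u l \<longleftrightarrow> (\<exists>X. approx p b X A G u l)"

text \<open>The decidable form of \<open>stage\<close>. The bound \<open>G l\<close> is the first
  entry not consulted by the evaluation at level \<open>l\<close>, so it can dominate a number that
  depends on all earlier entries.\<close>

definition bstage :: "aform \<Rightarrow> bool \<Rightarrow> nat set \<Rightarrow> (nat \<Rightarrow> nat) \<Rightarrow> nat \<Rightarrow> nat \<Rightarrow> bool" where
  "bstage p b A G u l \<longleftrightarrow> (\<exists>c\<le>G l. approx p b (set (list_decode c)) A G u l)"

lemma approx_cong_G: "(\<And>i. i < l \<Longrightarrow> G i = G' i) \<Longrightarrow> approx p b X A G u l = approx p b X A G' u l"
  unfolding approx_def by (rule bounded_sat_cong_G)

lemma bstage_cong_G:
  assumes "\<And>i. i \<le> l \<Longrightarrow> G i = G' i"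
  shows "bstage p b A G u l = bstage p b A G' u l"
  using approx_cong_G[of l G G'] assms by (simp add: bstage_def)

lemma approx_local:
  "\<exists>B. \<forall>X X' A A'. (\<forall>x<B. x \<in> X \<longleftrightarrow> x \<in> X') \<longrightarrow> (\<forall>x<B. x \<in> A \<longleftrightarrow> x \<in> A') \<longrightarrow>
     approx p b X A G u l = approx p b X' A' G u l"
proof -
  obtain B where B: "\<And>S S'. (\<forall>v. \<forall>x<B. x \<in> S v \<longleftrightarrow> x \<in> S' v) \<Longrightarrow>
      bounded_sat l G u (Suc (var_bound p)) S p b (init_env u) = bounded_sat l G u (Suc (var_bound p)) S' p b (init_env u)"
    using bounded_sat_local[of l G u "Suc (var_bound p)" p b "init_env u"] by blast
  have "approx p b X A G u l = approx p b X' A' G u l"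
    if "\<forall>x<B. x \<in> X \<longleftrightarrow> x \<in> X'" "\<forall>x<B. x \<in> A \<longleftrightarrow> x \<in> A'" for X X' A A'
    unfolding approx_def by (rule B) (use that in \<open>simp add: init_sets_def\<close>)
  then show ?thesis by blast
qed

lemma stage_local:
  "\<exists>B. \<forall>A A'. (\<forall>x<B. x \<in> A \<longleftrightarrow> x \<in> A') \<longrightarrow> stage p b A G u l = stage p b A' G u l"
proof -
  obtain B where B: "\<And>X X' A A'. (\<forall>x<B. x \<in> X \<longleftrightarrow> x \<in> X') \<Longrightarrow> (\<forall>x<B. x \<in> A \<longleftrightarrow> x \<in> A') \<Longrightarrow>
     approx p b X A G u l = approx p b X' A' G u l"
    using approx_local[of p b G u l] by blast
  have "stage p b A G u l = stage p b A' G u l" if A: "\<forall>x<B. x \<in> A \<longleftrightarrow> x \<in> A'" for A A'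
  proof -
    have "approx p b X A G u l = approx p b X A' G u l" for X
      by (rule B) (simp_all add: A)
    then show ?thesis by (simp add: stage_def)
  qed
  then show ?thesis by blast
qed

lemma stage_mono: "stage p b A G u l' \<Longrightarrow> l \<le> l' \<Longrightarrow> stage p b A G u l"
  unfolding stage_def approx_def using bounded_sat_mono by blast

text \<open>The witnesses of the single stages have a limit set. On the finite part inspected at
  level \<open>l0\<close> it agrees with the witness of some later level, which by monotonicity also
  works at \<open>l0\<close>.\<close>

lemma stage_sound:
  assumes "\<And>l. stage p b A G u l"
  shows "\<exists>X. holds_at p u X A = b"
proof -
  obtain Y where Y: "\<And>l. approx p b (Y l) A G u l"
    using assms unfolding stage_def by metis
  obtain X where X: "\<And>B l0. \<exists>l\<ge>l0. \<forall>x<B. x \<in> Y l \<longleftrightarrow> x \<in> X"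
    using compactness[of Y] by blast
  have "approx p b X A G u l0" for l0
  proof -
    obtain B where B: "\<And>X X' A A'. (\<forall>x<B. x \<in> X \<longleftrightarrow> x \<in> X') \<Longrightarrow> (\<forall>x<B. x \<in> A \<longleftrightarrow> x \<in> A') \<Longrightarrow>
        approx p b X A G u l0 = approx p b X' A' G u l0"
      using approx_local[of p b G u l0] by blast
    obtain l where l: "l0 \<le> l" "\<forall>x<B. x \<in> Y l \<longleftrightarrow> x \<in> X"
      using X by blast
    have "approx p b (Y l) A G u l0"
      using Y[of l] l(1) unfolding approx_def by (rule bounded_sat_mono)
    then show ?thesis using B[OF l(2), of A A] by simp
  qed
  then have "sat (init_sets X A) (init_env u) p = b"
    unfolding approx_def by (rule bounded_sat_sound)
  then show ?thesis
    unfolding holds_at_def init_sets_def init_env_def by blast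
qed

text \<open>Uniformity in \<open>u\<close> matters for guessing the hyperjump, where
  \<open>U\<close> is the complement of \<open>H\<close>; for the verdict \<open>U\<close> is a
  singleton.\<close>

lemma stage_complete:
  assumes "\<And>u. u \<in> U \<Longrightarrow> \<exists>X. holds_at p u X A = b"
  shows "\<exists>f. \<forall>G. (\<forall>m. f m \<le> G (Suc m)) \<longrightarrow> (\<forall>u\<in>U. \<forall>l. stage p b A G u l)"
proof -
  obtain X where X: "\<And>u. u \<in> U \<Longrightarrow> holds_at p u (X u) A = b"
    using assms by metis
  obtain f where f: "\<forall>u e b G l. (\<forall>x\<ge>Suc (var_bound p). e x = 0) \<longrightarrow> sat (init_sets (X u) A) e p = b \<longrightarrow>
      (\<forall>m. f m \<le> G (Suc m)) \<longrightarrow> bounded_sat l G u (Suc (var_bound p)) (init_sets (X u) A) p b e"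
    using bounded_sat_complete[of p "Suc (var_bound p)" "\<lambda>u. init_sets (X u) A"] by auto
  have "stage p b A G u l" if "\<forall>m. f m \<le> G (Suc m)" "u \<in> U" for G u l
  proof -
    have "sat (init_sets (X u) A) (init_env u) p = b"
      using X[OF that(2)] by (simp add: holds_at_def init_sets_def init_env_def)
    moreover have "\<forall>x\<ge>Suc (var_bound p). init_env u x = 0"
      by (simp add: init_env_def)
    ultimately show ?thesis
      using f that(1) unfolding stage_def approx_def by blast
  qed
  then show ?thesis by blast
qed

text \<open>What is used of a fast-growing sequence: \<open>f m \<le> G (Suc m)\<close> bounds
  number witnesses, and \<open>f (G m) \<le> G (Suc m)\<close> bounds quantities that depend on the
  entries so far.\<close>

definition paced :: "(nat \<Rightarrow> nat) \<Rightarrow> (nat \<Rightarrow> nat) \<Rightarrow> bool" where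
  "paced f G \<longleftrightarrow> mono G \<and> f 0 \<le> G 0 \<and> (\<forall>m. m \<le> G m \<and> f m \<le> G (Suc m) \<and> f (G m) \<le> G (Suc m))"

lemma paced_mono: "paced f' G \<Longrightarrow> (\<And>m. f m \<le> f' m) \<Longrightarrow> paced f G"
  unfolding paced_def by (meson le_trans)

lemma fast_growing_paced: "\<exists>F. \<forall>g. fast_growing F g \<longrightarrow> paced f g"
proof -
  \<comment> \<open>The sum is a monotone majorant of \<open>f\<close>; the summand \<open>m\<close>
    makes \<open>F\<close>-fast sequences strictly increasing, so that
    \<open>m \<le> g m\<close>.\<close>
  define F where "F m = m + (\<Sum>i\<le>m. f i)" for m
  have F: "f i \<le> F m" if "i \<le> m" for i m
  proof -
    have "f i \<le> (\<Sum>i\<le>m. f i)" using that by (intro member_le_sum) auto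
    then show ?thesis by (simp add: F_def)
  qed
  have "paced f g" if g: "fast_growing F g" for g
  proof -
    have Fg: "F (g m) < g (Suc m)" "F 0 < g 0" for m
      using g by (simp_all add: fast_growing_def)
    have lt: "g m < g (Suc m)" for m
      using Fg(1)[of m] by (simp add: F_def)
    then have mono: "strict_mono g" by (simp add: strict_mono_Suc_iff)
    have "m \<le> g m" for m by (rule strict_mono_imp_increasing[OF mono])
    then have "f m \<le> g (Suc m)" "f (g m) \<le> g (Suc m)" for m
      using F[of m "g m"] F[of "g m" "g m"] Fg(1)[of m] by (auto intro: le_trans less_imp_le)
    moreover have "f 0 \<le> g 0" using F[of 0 0] Fg(2) by simp
    ultimately show ?thesis
      using mono \<open>\<And>m. m \<le> g m\<close> by (simp add: paced_def strict_mono_mono)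
  qed
  then show ?thesis by blast
qed

lemma approx_code_bound:
  "\<exists>K. \<forall>X A. \<exists>c\<le>K. approx p b X A G u l = approx p b (set (list_decode c)) A G u l"
proof -
  obtain B where B: "\<And>X X' A A'. (\<forall>x<B. x \<in> X \<longleftrightarrow> x \<in> X') \<Longrightarrow> (\<forall>x<B. x \<in> A \<longleftrightarrow> x \<in> A') \<Longrightarrow>
      approx p b X A G u l = approx p b X' A' G u l"
    using approx_local[of p b G u l] by blast
  define code where "code Y = list_encode (sorted_list_of_set Y)" for Y
  have fin: "finite (Pow {..<B})" by simp
  have "\<exists>c\<le>(\<Sum>Y\<in>Pow {..<B}. code Y). approx p b X A G u l = approx p b (set (list_decode c)) A G u l" for X A
  proof (intro exI conjI)
    show "code (X \<inter> {..<B}) \<le> (\<Sum>Y\<in>Pow {..<B}. code Y)"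
      by (rule member_le_sum) (use fin in auto)
    show "approx p b X A G u l = approx p b (set (list_decode (code (X \<inter> {..<B})))) A G u l"
      by (rule B) (auto simp: code_def)
  qed
  then show ?thesis by blast
qed

text \<open>The bound for the codes of sets depends on \<open>u\<close> and the first
  \<open>Suc l\<close> values of \<open>G\<close>. All of these are at most \<open>G l\<close>, so a
  function of \<open>G l\<close> dominates it, and \<open>G (Suc l)\<close> dominates that
  function.\<close>

lemma bstage_stage:
  "\<exists>f. \<forall>G. paced f G \<longrightarrow> (\<forall>A u l. u \<le> G l \<longrightarrow> bstage p b A G u (Suc l) = stage p b A G u (Suc l))"
proof -
  \<comment> \<open>\<open>G\<close> is replaced by a finite list of its values, so that the bound
    has only finitely many arguments below a given number.\<close>
  have "\<forall>xs u. \<exists>K. \<forall>X A. \<exists>c\<le>K. approx p b X A (nth xs) u (length xs)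
      = approx p b (set (list_decode c)) A (nth xs) u (length xs)"
    using approx_code_bound by blast
  then obtain K where K: "\<And>xs u X A. \<exists>c\<le>K xs u. approx p b X A (nth xs) u (length xs)
      = approx p b (set (list_decode c)) A (nth xs) u (length xs)"
    by metis
  \<comment> \<open>The length bound is adequate because the list has \<open>Suc l\<close> entries
    and \<open>l \<le> G l\<close>.\<close>
  define Ls where "Ls m = {xs :: nat list. set xs \<subseteq> {..m} \<and> length xs \<le> Suc m}" for m
  have fin: "finite (Ls m)" for m
    unfolding Ls_def by (rule finite_lists_length_le) simp
  define f where "f m = (\<Sum>u\<le>m. \<Sum>xs\<in>Ls m. K xs u)" for m
  have f: "K xs u \<le> f m" if "u \<le> m" "xs \<in> Ls m" for u xs m
  proof -
    have "K xs u \<le> (\<Sum>xs\<in>Ls m. K xs u)"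
      using that fin by (intro member_le_sum) auto
    also have "\<dots> \<le> f m"
      unfolding f_def using that by (intro member_le_sum) auto
    finally show ?thesis .
  qed
  have "bstage p b A G u (Suc l) = stage p b A G u (Suc l)"
    if G: "paced f G" and u: "u \<le> G l" for G A u l
  proof
    assume "bstage p b A G u (Suc l)"
    then show "stage p b A G u (Suc l)"
      unfolding bstage_def stage_def by blast
  next
    define xs where "xs = map G [0..<Suc l]"
    have len: "length xs = Suc l" by (simp add: xs_def)
    have "G i \<le> G l" if "i \<le> l" for i
      using G that unfolding paced_def by (meson monoD)
    moreover have "l \<le> G l" using G by (simp add: paced_def)
    ultimately have "xs \<in> Ls (G l)"
      by (auto simp: Ls_def xs_def)
    then have bound: "K xs u \<le> G (Suc l)"
      using f[OF u] G unfolding paced_def by (meson le_trans)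
    have cong: "approx p b X A (nth xs) u (Suc l) = approx p b X A G u (Suc l)" for X
      by (rule approx_cong_G) (simp add: xs_def del: upt_Suc)
    assume "stage p b A G u (Suc l)"
    then obtain X where X: "approx p b X A G u (Suc l)"
      unfolding stage_def by blast
    obtain c where "c \<le> K xs u" "approx p b X A G u (Suc l) = approx p b (set (list_decode c)) A G u (Suc l)"
      using K[of xs u X A] unfolding len cong by blast
    with X bound show "bstage p b A G u (Suc l)"
      unfolding bstage_def by (meson le_trans)
  qed
  then show ?thesis by blast
qed

text \<open>The verdict is read off the first stage below \<open>L\<close> at which \<open>\<exists>X. p\<close> or \<open>\<exists>X. \<not> q\<close> is refuted.\<close>

definition verdict :: "aform \<Rightarrow> aform \<Rightarrow> nat set \<Rightarrow> (nat \<Rightarrow> nat) \<Rightarrow> nat \<Rightarrow> nat \<Rightarrow> bool" where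
  "verdict p q A G n L \<longleftrightarrow> (\<exists>l<L. bstage p True A G n (Suc l) \<and> \<not> bstage q False A G n (Suc l) \<and>
     (\<forall>j<l. bstage p True A G n (Suc j) \<and> bstage q False A G n (Suc j)))"

text \<open>Stages are counted at successors, where \<open>bstage_stage\<close> applies.\<close>

lemma stage_first_refuted:
  assumes "\<nexists>X. holds_at p n X A = b"
  obtains l where "\<not> stage p b A G n (Suc l)" "\<And>j. j < l \<Longrightarrow> stage p b A G n (Suc j)"
proof -
  obtain l where "\<not> stage p b A G n l"
    using stage_sound[of p b A G n] assms by blast
  then have "\<not> stage p b A G n (Suc l)"
    using stage_mono[of p b A G n "Suc l" l] by auto
  then have "\<exists>l. \<not> stage p b A G n (Suc l)" by blast
  then obtain l where "\<not> stage p b A G n (Suc l)" "\<forall>j<l. stage p b A G n (Suc j)"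
    using exists_least_iff[of "\<lambda>l. \<not> stage p b A G n (Suc l)"] by blast
  then show ?thesis using that by blast
qed

lemma stages_local:
  "\<exists>B. \<forall>A A' j. j \<le> l \<longrightarrow> (\<forall>x<B. x \<in> A \<longleftrightarrow> x \<in> A') \<longrightarrow> stage p b A G u (Suc j) = stage p b A' G u (Suc j)"
proof -
  have "\<forall>j. \<exists>B. \<forall>A A'. (\<forall>x<B. x \<in> A \<longleftrightarrow> x \<in> A') \<longrightarrow> stage p b A G u (Suc j) = stage p b A' G u (Suc j)"
    using stage_local by blast
  then obtain B where B: "\<And>j A A'. (\<forall>x<B j. x \<in> A \<longleftrightarrow> x \<in> A') \<Longrightarrow> stage p b A G u (Suc j) = stage p b A' G u (Suc j)"
    by metis
  have "stage p b A G u (Suc j) = stage p b A' G u (Suc j)"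
    if "j \<le> l" "\<forall>x<(\<Sum>j\<le>l. B j). x \<in> A \<longleftrightarrow> x \<in> A'" for A A' j
  proof (rule B)
    have "B j \<le> (\<Sum>j\<le>l. B j)" using that(1) by (intro member_le_sum) auto
    then show "\<forall>x<B j. x \<in> A \<longleftrightarrow> x \<in> A'" using that(2) by auto
  qed
  then show ?thesis by blast
qed

text \<open>The stages of the true formula never fail, and the false one fails first at some
  \<open>l0\<close>. Up to there only finitely many entries of \<open>g\<close> and finitely many
  facts about \<open>H\<close> matter. So the answer persists for every \<open>G\<close> and
  \<open>A\<close> that agree so far: this admits guesses for \<open>H\<close> as well as arbitrary
  extensions.\<close>

lemma verdict_correct:
  assumes P: "n \<in> P \<longleftrightarrow> (\<exists>X. holds_at p n X H)" "n \<in> P \<longleftrightarrow> (\<forall>X. holds_at q n X H)"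
  shows "\<exists>f. \<forall>g. paced f g \<longrightarrow> (\<exists>m B. \<forall>L A G. m \<le> L \<longrightarrow> (\<forall>i\<le>m. G i = g i) \<longrightarrow>
    (\<forall>x<B. x \<in> A \<longleftrightarrow> x \<in> H) \<longrightarrow> (verdict p q A G n L \<longleftrightarrow> n \<in> P))"
proof -
  obtain fp where fp: "\<And>G A u l. paced fp G \<Longrightarrow> u \<le> G l \<Longrightarrow>
      bstage p True A G u (Suc l) = stage p True A G u (Suc l)"
    using bstage_stage[of p True] by blast
  obtain fq where fq: "\<And>G A u l. paced fq G \<Longrightarrow> u \<le> G l \<Longrightarrow>
      bstage q False A G u (Suc l) = stage q False A G u (Suc l)"
    using bstage_stage[of q False] by blast
  obtain fc where fc: "\<And>G l. \<forall>m. fc m \<le> G (Suc m) \<Longrightarrow>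
      (if n \<in> P then stage p True H G n l else stage q False H G n l)"
  proof (cases "n \<in> P")
    case True
    then have "\<exists>X. holds_at p n X H = True" using P(1) by simp
    then obtain f where "\<forall>G. (\<forall>m. f m \<le> G (Suc m)) \<longrightarrow> (\<forall>u\<in>{n}. \<forall>l. stage p True H G u l)"
      using stage_complete[of "{n}" p H True] by blast
    then show ?thesis using that[of f] True by simp
  next
    case False
    then have "\<exists>X. holds_at q n X H = False" using P(2) by simp
    then obtain f where "\<forall>G. (\<forall>m. f m \<le> G (Suc m)) \<longrightarrow> (\<forall>u\<in>{n}. \<forall>l. stage q False H G u l)"
      using stage_complete[of "{n}" q H False] by blast
    then show ?thesis using that[of f] False by simp
  qed
  \<comment> \<open>The summand \<open>n\<close> yields \<open>n \<le> g l\<close> for all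
    \<open>l\<close>, as \<open>bstage_stage\<close> requires; \<open>f\<close> may depend on
    \<open>n\<close>, like the notion \<open>Q\<close>.\<close>
  define f where "f m = fp m + fq m + fc m + n" for m
  have "\<exists>m B. \<forall>L A G. m \<le> L \<longrightarrow> (\<forall>i\<le>m. G i = g i) \<longrightarrow>
      (\<forall>x<B. x \<in> A \<longleftrightarrow> x \<in> H) \<longrightarrow> (verdict p q A G n L \<longleftrightarrow> n \<in> P)" if g: "paced f g" for g
  proof -
    have paced: "paced fp g" "paced fq g" "paced fc g"
      using g by (rule paced_mono; simp add: f_def)+
    have n: "n \<le> g l" for l
    proof -
      have "n \<le> f 0" "f 0 \<le> g 0" "g 0 \<le> g l"
        using g by (simp_all add: f_def paced_def monoD)
      then show ?thesis by linarith
    qed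
    have c: "if n \<in> P then stage p True H g n l else stage q False H g n l" for l
      using fc paced(3) by (simp add: paced_def)
    obtain l0 where l0: "\<not> (stage p True H g n (Suc l0) \<and> stage q False H g n (Suc l0))"
      "\<And>j. j < l0 \<Longrightarrow> stage p True H g n (Suc j) \<and> stage q False H g n (Suc j)"
    proof (cases "n \<in> P")
      case True
      then obtain l0 where "\<not> stage q False H g n (Suc l0)" "\<And>j. j < l0 \<Longrightarrow> stage q False H g n (Suc j)"
        using stage_first_refuted[of q n H False g] P(2) by blast
      then show ?thesis using that[of l0] c True by simp
    next
      case False
      then obtain l0 where "\<not> stage p True H g n (Suc l0)" "\<And>j. j < l0 \<Longrightarrow> stage p True H g n (Suc j)"
        using stage_first_refuted[of p n H True g] P(1) by blast
      then show ?thesis using that[of l0] c False by simp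
    qed
    obtain Bp where Bp: "\<And>A A' j. j \<le> l0 \<Longrightarrow> (\<forall>x<Bp. x \<in> A \<longleftrightarrow> x \<in> A') \<Longrightarrow>
        stage p True A g n (Suc j) = stage p True A' g n (Suc j)"
      using stages_local[of l0 p True g n] by blast
    obtain Bq where Bq: "\<And>A A' j. j \<le> l0 \<Longrightarrow> (\<forall>x<Bq. x \<in> A \<longleftrightarrow> x \<in> A') \<Longrightarrow>
        stage q False A g n (Suc j) = stage q False A' g n (Suc j)"
      using stages_local[of l0 q False g n] by blast
    have "verdict p q A G n L \<longleftrightarrow> n \<in> P"
      if L: "Suc l0 \<le> L" and G: "\<forall>i\<le>Suc l0. G i = g i" and A: "\<forall>x<Bp + Bq. x \<in> A \<longleftrightarrow> x \<in> H" for L A G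
    proof -
      have st: "bstage p True A G n (Suc j) = stage p True H g n (Suc j)"
        "bstage q False A G n (Suc j) = stage q False H g n (Suc j)" if j: "j \<le> l0" for j
      proof -
        have "bstage p True A G n (Suc j) = bstage p True A g n (Suc j)"
          "bstage q False A G n (Suc j) = bstage q False A g n (Suc j)"
          using G j by (auto intro!: bstage_cong_G)
        then show "bstage p True A G n (Suc j) = stage p True H g n (Suc j)"
          "bstage q False A G n (Suc j) = stage q False H g n (Suc j)"
          using fp[OF paced(1) n] fq[OF paced(2) n] Bp[OF j, of A H] Bq[OF j, of A H] A by simp_all
      qed
      show ?thesis
      proof
        assume "n \<in> P"
        then have "bstage p True A G n (Suc l0)" "\<not> bstage q False A G n (Suc l0)"
          "\<forall>j<l0. bstage p True A G n (Suc j) \<and> bstage q False A G n (Suc j)"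
          using st l0 c by auto
        then show "verdict p q A G n L"
          unfolding verdict_def using L by (intro exI[of _ l0]) auto
      next
        assume "verdict p q A G n L"
        then obtain l where l: "bstage p True A G n (Suc l)" "\<not> bstage q False A G n (Suc l)"
          "\<And>j. j < l \<Longrightarrow> bstage p True A G n (Suc j) \<and> bstage q False A G n (Suc j)"
          unfolding verdict_def by blast
        \<comment> \<open>A verdict after \<open>l0\<close> would require both formulas to be
          unrefuted at \<open>l0\<close>.\<close>
        have "\<not> l0 < l" using l(3)[of l0] st[of l0] l0(1) by auto
        then have "\<not> stage q False H g n (Suc l)" using l(2) st[of l] by simp
        then show "n \<in> P" using c[of "Suc l"] by (auto split: if_splits)
      qed
    qed
    then show ?thesis by blast
  qed
  then show ?thesis by blast
qed

definition guess :: "aform \<Rightarrow> (nat \<Rightarrow> nat) \<Rightarrow> nat \<Rightarrow> nat set" where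
  "guess h G L = {u. \<not> bstage h False {} G u L}"

text \<open>A member is refuted as a non-member at some level, and this persists. For non-members
  one \<open>f\<close> bounds all counterexamples, so they are never refuted. Both arguments need
  \<open>u\<close> to be within the level, so the convergence is pointwise.\<close>

lemma guess_limit:
  assumes H: "\<And>u. u \<in> H \<longleftrightarrow> (\<forall>Y. holds_at h u Y {})"
  shows "\<exists>f. \<forall>g. paced f g \<longrightarrow> (\<forall>B. \<exists>L0. \<forall>L\<ge>L0. \<forall>u<B. u \<in> guess h g L \<longleftrightarrow> u \<in> H)"
proof -
  obtain fb where fb: "\<And>G A u l. paced fb G \<Longrightarrow> u \<le> G l \<Longrightarrow>
      bstage h False A G u (Suc l) = stage h False A G u (Suc l)"
    using bstage_stage[of h False] by blast
  obtain fc where fc: "\<And>G u l. \<forall>m. fc m \<le> G (Suc m) \<Longrightarrow> u \<notin> H \<Longrightarrow> stage h False {} G u l"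
  proof -
    have "\<exists>X. holds_at h u X {} = False" if "u \<in> - H" for u
      using that H[of u] by simp
    then obtain f where "\<forall>G. (\<forall>m. f m \<le> G (Suc m)) \<longrightarrow> (\<forall>u\<in>- H. \<forall>l. stage h False {} G u l)"
      using stage_complete[of "- H" h "{}" False] by blast
    then show ?thesis using that[of f] by simp
  qed
  define f where "f m = fb m + fc m" for m
  have "\<exists>L0. \<forall>L\<ge>L0. \<forall>u<B. u \<in> guess h g L \<longleftrightarrow> u \<in> H" if g: "paced f g" for g B
  proof -
    have paced: "paced fb g" "paced fc g"
      using g by (rule paced_mono; simp add: f_def)+
    have st: "u \<in> guess h g (Suc l) \<longleftrightarrow> \<not> stage h False {} g u (Suc l)" if "u \<le> l" for u l
    proof -
      have "l \<le> g l" using g by (simp add: paced_def)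
      then have "u \<le> g l" using that by linarith
      then show ?thesis using fb[OF paced(1)] by (simp add: guess_def)
    qed
    have "\<exists>L0. \<forall>l\<ge>L0. u \<le> l \<longrightarrow> (u \<in> guess h g (Suc l) \<longleftrightarrow> u \<in> H)" for u
    proof (cases "u \<in> H")
      case True
      then obtain l where l: "\<not> stage h False {} g u l"
        using stage_sound[of h False "{}" g u] H by blast
      have "\<not> stage h False {} g u (Suc l')" if "l \<le> l'" for l'
        using l stage_mono[of h False "{}" g u "Suc l'" l] that by auto
      then show ?thesis using st True by blast
    next
      case False
      then have "stage h False {} g u l" for l
        using fc paced(2) by (simp add: paced_def)
      then show ?thesis using st False by blast
    qed
    then obtain L0 where L0: "\<And>u l. L0 u \<le> l \<Longrightarrow> u \<le> l \<Longrightarrow> u \<in> guess h g (Suc l) \<longleftrightarrow> u \<in> H"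
      by metis
    \<comment> \<open>The level exceeds \<open>B\<close>, hence every \<open>u < B\<close>, and also
      all of the finitely many thresholds \<open>L0 u\<close>.\<close>
    have "u \<in> guess h g L \<longleftrightarrow> u \<in> H" if L: "Suc (B + (\<Sum>u<B. L0 u)) \<le> L" and u: "u < B" for L u
    proof -
      obtain l where l: "L = Suc l" "B + (\<Sum>u<B. L0 u) \<le> l" using L by (cases L) auto
      have "L0 u \<le> (\<Sum>u<B. L0 u)" using u by (intro member_le_sum) auto
      then show ?thesis using L0[of u l] l u by simp
    qed
    then show ?thesis by blast
  qed
  then show ?thesis by blast
qed

lemma decidable_bstage:
  assumes "computable l" and G: "computable (\<lambda>e. G (\<lambda>i. e (Suc i)) (e 0))" and u: "computable u"
    and A: "decidable (\<lambda>e. e 0 \<in> A (\<lambda>i. e (Suc i)))"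
  shows "decidable (\<lambda>e. bstage p b (A e) (G e) (u e) (l e))"
proof -
  define S :: "(nat \<Rightarrow> nat) \<Rightarrow> nat \<Rightarrow> nat set" where
    "S e = init_sets (set (list_decode (e 0))) (A (\<lambda>i. e (Suc i)))" for e
  define T where "T x = (if x = 0 then (\<lambda>e. u (\<lambda>i. e (Suc i))) else (\<lambda>e. 0))" for x :: nat
  have S': "decidable (\<lambda>e. e 0 \<in> S (\<lambda>i. e (Suc i)) v)" for v
  proof -
    consider "v = 0" | "v = 1" | "1 < v" by linarith
    then show ?thesis
    proof cases
      case 1
      then show ?thesis by (simp add: S_def init_sets_def decidable_set_code computable_var)
    next
      case 2
      then show ?thesis
        using decidable_ren[OF A, of skip1] by (simp add: S_def init_sets_def)
    next
      case 3
      then show ?thesis by (simp add: S_def init_sets_def decidable_const)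
    qed
  qed
  have T': "computable (T x)" for x
    using computable_ren[OF u, of Suc] by (simp add: T_def computable_const)
  have G': "computable (\<lambda>e. G (\<lambda>i. e (Suc (Suc i))) (e 0))"
    using computable_ren[OF G, of skip1] by simp
  have "decidable (\<lambda>e. bounded_sat (l (\<lambda>i. e (Suc i))) (G (\<lambda>i. e (Suc i))) (u (\<lambda>i. e (Suc i)))
      (Suc (var_bound p)) (S e) p b (\<lambda>x. T x e))"
    by (rule bounded_sat_decidable_D[of "Suc (var_bound p)" p "\<lambda>e. l (\<lambda>i. e (Suc i))" "\<lambda>e. G (\<lambda>i. e (Suc i))"
          "\<lambda>e. u (\<lambda>i. e (Suc i))" S T,
          OF bounded_sat_decidable computable_ren[OF assms(1), of Suc] G' computable_ren[OF u, of Suc] S' T'])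
  moreover have "(\<lambda>x. T x e) = init_env (u (\<lambda>i. e (Suc i)))" for e
    by (auto simp: T_def init_env_def)
  ultimately have "decidable (\<lambda>e. approx p b (set (list_decode (e 0))) (A (\<lambda>i. e (Suc i)))
      (G (\<lambda>i. e (Suc i))) (u (\<lambda>i. e (Suc i))) (l (\<lambda>i. e (Suc i))))"
    by (simp add: approx_def S_def)
  then show ?thesis
    unfolding bstage_def by (intro decidable_bex_le computable_at[OF G assms(1)])
qed

lemma decidable_verdict:
  assumes L: "computable L" and G: "computable (\<lambda>e. G (\<lambda>i. e (Suc i)) (e 0))" and u: "computable u"
    and A: "decidable (\<lambda>e. e 0 \<in> A (\<lambda>i. e (Suc i)))"
  shows "decidable (\<lambda>e. verdict p q (A e) (G e) (u e) (L e))"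
proof -
  have "decidable (\<lambda>e. bstage p b (A (\<lambda>i. e (Suc i))) (G (\<lambda>i. e (Suc i))) (u (\<lambda>i. e (Suc i))) (Suc (e 0)))" for p b
    using decidable_ren[OF A, of skip1] computable_ren[OF G, of skip1]
    by (intro decidable_bstage[of "\<lambda>e. Suc (e 0)" "\<lambda>e. G (\<lambda>i. e (Suc i))" "\<lambda>e. u (\<lambda>i. e (Suc i))"
          "\<lambda>e. A (\<lambda>i. e (Suc i))"] computable_Suc computable_var computable_ren[OF u]) simp_all
  note 1 = this decidable_ren[OF this, where \<rho> = skip1, simplified]
  show ?thesis
    unfolding verdict_def
    by (rule decidable_bex[OF _ L], intro decidable_and decidable_not decidable_ball 1 computable_var)
qed

section \<open>The machines for both notions\<close>

theorem Delta11_fast_growing: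
  assumes "Pi11 H" and "Delta11_in H P"
  shows "computable_fast_growing P"
proof -
  obtain h where h: "\<And>u. u \<in> H \<longleftrightarrow> (\<forall>Y. holds_at h u Y {})"
    using assms(1) unfolding Pi11_in_def by blast
  obtain p q where p: "\<And>n. n \<in> P \<longleftrightarrow> (\<exists>X. holds_at p n X H)"
    and q: "\<And>n. n \<in> P \<longleftrightarrow> (\<forall>X. holds_at q n X H)"
    using assms(2) unfolding Delta11_in_def Sigma11_in_def Pi11_in_def by blast
  \<comment> \<open>The input codes \<open>n\<close> followed by the sequence, so \<open>G i\<close>
    is entry \<open>Suc i\<close>. The level is the length of the sequence minus 1, its last index,
    because \<open>bstage\<close> at level \<open>l\<close> reads \<open>G\<close> up to
    \<open>l\<close>.\<close>
  define V where "V c \<longleftrightarrow> verdict p q (guess h (\<lambda>i. entry_code c (Suc i)) (len_code c - 2)) (\<lambda>i. entry_code c (Suc i))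
      (entry_code c 0) (len_code c - 2)" for c
  have "decidable (\<lambda>e. V (e 0))"
  proof -
    have L: "computable (\<lambda>e. len_code (e k) - 2)" for k
      by (intro computable_diff computable_len_code computable_var computable_const)
    have G: "computable (\<lambda>e. entry_code (e k) (Suc (e 0)))" for k
      by (intro computable_entry_code computable_var computable_Suc)
    have "decidable (\<lambda>e. bstage h False {} (\<lambda>i. entry_code (e 1) (Suc i)) (e 0) (len_code (e 1) - 2))"
      by (rule decidable_bstage[of _ "\<lambda>e i. entry_code (e 1) (Suc i)" _ "\<lambda>e. {}", OF L G computable_var]) (simp add: decidable_const)
    then have "decidable (\<lambda>e. e 0 \<in> guess h (\<lambda>i. entry_code (e (Suc 0)) (Suc i)) (len_code (e (Suc 0)) - 2))"
      unfolding guess_def mem_Collect_eq One_nat_def by (rule decidable_not)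
    from decidable_verdict[of _ "\<lambda>e i. entry_code (e 0) (Suc i)" _
        "\<lambda>e. guess h (\<lambda>i. entry_code (e 0) (Suc i)) (len_code (e 0) - 2)", OF L G _ this]
    show ?thesis
      unfolding V_def by (simp add: computable_entry_code computable_var computable_const)
  qed
  then obtain M where M: "wf_tm M" "\<And>xs. tm_computes M xs (of_bool (V (list_encode xs)))"
    using decidable_tm[of V] by blast
  obtain fh where fh: "\<And>g B. paced fh g \<Longrightarrow> \<exists>L0. \<forall>L\<ge>L0. \<forall>u<B. u \<in> guess h g L \<longleftrightarrow> u \<in> H"
    using guess_limit[OF h] by blast
  have "\<exists>Q. valid_notion Q \<and> (\<forall>s\<in>Q. tm_computes M (n # s) (of_bool (n \<in> P)))" for n
  proof -
    obtain fv where fv: "\<And>g. paced fv g \<Longrightarrow> \<exists>m B. \<forall>L A G. m \<le> L \<longrightarrow> (\<forall>i\<le>m. G i = g i) \<longrightarrow>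
        (\<forall>x<B. x \<in> A \<longleftrightarrow> x \<in> H) \<longrightarrow> (verdict p q A G n L \<longleftrightarrow> n \<in> P)"
      using verdict_correct[OF p q, of n] by blast
    obtain F where F: "\<And>g. fast_growing F g \<Longrightarrow> paced (\<lambda>m. fh m + fv m) g"
      using fast_growing_paced by blast
    define Q where "Q = {s. V (list_encode (n # s)) \<longleftrightarrow> n \<in> P}"
    have "\<exists>m. \<forall>k\<ge>m. initial_segment g k \<in> Q" if g: "fast_growing F g" for g
    proof -
      have paced: "paced fh g" "paced fv g"
        using F[OF g] by (rule paced_mono; simp)+
      obtain m B where mB: "\<And>L A G. m \<le> L \<Longrightarrow> (\<forall>i\<le>m. G i = g i) \<Longrightarrow>
          (\<forall>x<B. x \<in> A \<longleftrightarrow> x \<in> H) \<Longrightarrow> (verdict p q A G n L \<longleftrightarrow> n \<in> P)"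
        using fv[OF paced(2)] by blast
      obtain L0 where L0: "\<And>L. L0 \<le> L \<Longrightarrow> \<forall>u<B. u \<in> guess h g L \<longleftrightarrow> u \<in> H"
        using fh[OF paced(1)] by blast
      \<comment> \<open>The level is \<open>k - 1\<close>, so this length puts it above both
        \<open>m\<close> and \<open>L0\<close>.\<close>
      have "initial_segment g k \<in> Q" if k: "Suc (m + L0) \<le> k" for k
      proof -
        define c where "c = list_encode (n # initial_segment g k)"
        have dec: "list_decode c = n # initial_segment g k"
          by (simp only: c_def list_encode_inverse)
        have len: "len_code c - 2 = k - 1"
          by (simp add: len_code_def dec)
        have n: "entry_code c 0 = n"
          using entry_code_eq[of 0 c] by (simp add: dec)
        have G: "entry_code c (Suc i) = g i" if "i < k" for i
          using entry_code_eq[of "Suc i" c] that by (simp add: dec)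
        have "bstage h False {} (\<lambda>i. entry_code c (Suc i)) u (k - 1) = bstage h False {} g u (k - 1)" for u
          by (rule bstage_cong_G, rule G) (use k in simp)
        then have "guess h (\<lambda>i. entry_code c (Suc i)) (k - 1) = guess h g (k - 1)"
          by (simp add: guess_def)
        then have "\<forall>x<B. x \<in> guess h (\<lambda>i. entry_code c (Suc i)) (k - 1) \<longleftrightarrow> x \<in> H"
          using L0[of "k - 1"] k by simp
        then have "V c \<longleftrightarrow> n \<in> P"
          unfolding V_def len n using k G by (intro mB) auto
        then show ?thesis by (simp add: Q_def c_def)
      qed
      then show ?thesis by blast
    qed
    then have "valid_notion Q" unfolding valid_notion_def by blast
    moreover have "tm_computes M (n # s) (of_bool (n \<in> P))" if "s \<in> Q" for s
      using M(2)[of "n # s"] that by (simp add: Q_def)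
    ultimately show ?thesis by blast
  qed
  with M(1) show ?thesis
    unfolding computable_fast_growing_def computable_using_def by blast
qed

theorem Delta11_fast_growing_ext:
  assumes "Delta11 P"
  shows "computable_fast_growing_ext P"
proof -
  obtain p q where p: "\<And>n. n \<in> P \<longleftrightarrow> (\<exists>X. holds_at p n X {})"
    and q: "\<And>n. n \<in> P \<longleftrightarrow> (\<forall>X. holds_at q n X {})"
    using assms unfolding Delta11_in_def Sigma11_in_def Pi11_in_def by blast
  \<comment> \<open>With the empty parameter nothing is guessed, so the answer cannot change once
    the first refutation is within reach.\<close>
  define V where "V c \<longleftrightarrow> verdict p q {} (\<lambda>i. entry_code c (Suc i)) (entry_code c 0) (len_code c - 2)" for c
  have "decidable (\<lambda>e. V (e 0))"
    unfolding V_def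
  proof (rule decidable_verdict)
    show "computable (\<lambda>e. entry_code (e (Suc 0)) (Suc (e 0)))"
      by (intro computable_entry_code computable_var computable_Suc)
  qed (simp_all add: computable_diff computable_len_code computable_entry_code computable_var computable_const decidable_const)
  then obtain M where M: "wf_tm M" "\<And>xs. tm_computes M xs (of_bool (V (list_encode xs)))"
    using decidable_tm[of V] by blast
  have "\<exists>Q. valid_notion_ext Q \<and> (\<forall>s\<in>Q. tm_computes M (n # s) (of_bool (n \<in> P)))" for n
  proof -
    obtain fv where fv: "\<And>g. paced fv g \<Longrightarrow> \<exists>m B. \<forall>L A G. m \<le> L \<longrightarrow> (\<forall>i\<le>m. G i = g i) \<longrightarrow>
        (\<forall>x<B. x \<in> A \<longleftrightarrow> x \<in> {}) \<longrightarrow> (verdict p q A G n L \<longleftrightarrow> n \<in> P)"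
      using verdict_correct[OF p q, of n] by blast
    obtain F where F: "\<And>g. fast_growing F g \<Longrightarrow> paced fv g"
      using fast_growing_paced by blast
    \<comment> \<open>Correctness on all extensions is part of \<open>Q\<close>. Long initial
      segments qualify because \<open>mB\<close> constrains \<open>G\<close> only up to
      \<open>m\<close> and the level only from below.\<close>
    define Q where "Q = {s. \<forall>t. V (list_encode (n # s @ t)) \<longleftrightarrow> n \<in> P}"
    have "\<exists>m. \<forall>k\<ge>m. initial_segment g k \<in> Q" if g: "fast_growing F g" for g
    proof -
      obtain m B where mB: "\<And>L A G. m \<le> L \<Longrightarrow> (\<forall>i\<le>m. G i = g i) \<Longrightarrow>
          (\<forall>x<B. x \<in> A \<longleftrightarrow> x \<in> {}) \<Longrightarrow> (verdict p q A G n L \<longleftrightarrow> n \<in> P)"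
        using fv[OF F[OF g]] by blast
      have "V (list_encode (n # initial_segment g k @ t)) \<longleftrightarrow> n \<in> P" if k: "Suc m \<le> k" for k t
      proof -
        define c where "c = list_encode (n # initial_segment g k @ t)"
        have dec: "list_decode c = n # initial_segment g k @ t"
          by (simp only: c_def list_encode_inverse)
        have len: "m \<le> len_code c - 2"
          using k by (simp add: len_code_def dec)
        have n: "entry_code c 0 = n"
          using entry_code_eq[of 0 c] by (simp add: dec)
        have G: "entry_code c (Suc i) = g i" if "i \<le> m" for i
          using entry_code_eq[of "Suc i" c] that k by (simp add: dec nth_append)
        have "V c \<longleftrightarrow> n \<in> P"
          unfolding V_def n using len G by (intro mB) auto
        then show ?thesis by (simp add: c_def)
      qed
      then show ?thesis unfolding Q_def by blast
    qed
    then have "valid_notion Q" unfolding valid_notion_def by blast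
    then have "valid_notion_ext (extension_closure Q)" unfolding valid_notion_ext_def by blast
    moreover have "tm_computes M (n # s) (of_bool (n \<in> P))" if s: "s \<in> extension_closure Q" for s
    proof -
      obtain s' t where "s' \<in> Q" "s = s' @ t"
        using s unfolding extension_closure_def by blast
      then show ?thesis
        using M(2)[of "n # s"] by (simp add: Q_def)
    qed
    ultimately show ?thesis by blast
  qed
  with M(1) show ?thesis
    unfolding computable_fast_growing_ext_def computable_using_def by blast
qed

theorem theorem4p4:
  fixes P :: "nat set"
  shows "(\<forall>H. is_hyperjump_of_0 H \<longrightarrow> (computable_fast_growing P \<longleftrightarrow> Delta11_in H P)) \<and>
         (computable_fast_growing_ext P \<longleftrightarrow> Delta11 P)"
  using fast_growing_Delta11_hyperjump Delta11_fast_growing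
    fast_growing_ext_Delta11 Delta11_fast_growing_ext
  unfolding is_hyperjump_of_0_def by blast

end
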